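(* Consider the structured switched linear system $\dot x(t)=A_{\sigma(t)}x(t)+B_{\sigma(t)}u_{\sigma(t)}(t)$ with structured matrices $(A_i,B_i)_{i=1}^N$ and colored union graph $\mathcal G_c$. The following are equivalent: (a) every state vertex $x_i\in X$ is input-reachable in $\mathcal G_c$, and $\operatorname{grank}[A_1,\dots,A_N,B_1,\dots,B_N]=n$; (b) $\mathcal G_c$ contains a collection of vertex-disjoint generalized stems and generalized buds that cover $X$; (c) the system is structurally controllable.
   Context: System: $x(t)\in\mathbb R^n$, designable switching signal $\sigma:[0,\infty)\to[N]=\{1,\dots,N\}$, piecewise continuous input $u_{\sigma(t)}(t)\in\mathbb R^{m_{\sigma(t)}}$, $A_i$ of size $n\times n$, $B_i$ of size $n\times m_i$. A state $x$ is controllable if there exist finite $t_f$, a switching signal $\sigma:[0,t_f)\to[N]$ and an input with $x(0)=x$, $x(t_f)=0$; the system is controllable if all states are controllable. A structured matrix has entries either fixed zero or independent free real parameters; a realization assigns real values to the free entries; $\operatorname{grank}$ denotes the maximum rank over all realizations. The structured system is structurally controllable if some realization is controllable. Colored union graph $\mathcal G_c$: vertices $X=\{x_1,\dots,x_n\}$ and $U=\bigcup_iU_i$, $U_i=\{u^i_1,\dots,u^i_{m_i}\}$; for each $i$ and each nonzero entry $(j,k)$ of $A_i$ a state edge $(x_k,x_j)$ with color index $i$ (parallel edges of different colors allowed); for each nonzero entry $(j,k)$ of $B_i$ an input edge $(u^i_k,x_j)$ with color index $i$. A state vertex is input-reachable if some path from a vertex of $U$ reaches it. A set of edges is S-disjoint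 if their heads are all distinct and edges with the same tail have different color indices. A cycle is a closed walk whose only repeated vertex is its start/end (self-loops allowed). Generalized stem: a subgraph $(V_s,E_s)$ of $\mathcal G_c$ with exactly one input vertex in $V_s$ and no cycle, each state vertex of $V_s$ having exactly one ingoing edge in $E_s$, and with $E_s$ S-disjoint. Generalized bud: a subgraph $(V_s,E_s)$ with no input vertex and exactly one cycle, every state vertex of $V_s$ input-reachable in $\mathcal G_c$, each state vertex of $V_s$ having exactly one ingoing edge in $E_s$, and with $E_s$ S-disjoint. A collection of subgraphs covers $X$ if every vertex of $X$ lies in one of them. *)

theory Defs
  imports "HOL-Analysis.Analysis"
begin

text \<open>
  Modes are indexed by {1..N}. The state space is real^'n (n = CARD('n)).
  Structured matrices: PA i j k holds iff entry (j,k) (row j, column k) of A_i is a free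
  parameter; PB i j k holds iff entry (j,k) of B_i is free (k < m i, m i = number of inputs
  of mode i). Column k of B_i is represented as a vector Bc i k :: real^'n.
\<close>

definition realization ::
  "nat \<Rightarrow> (nat \<Rightarrow> nat) \<Rightarrow> (nat \<Rightarrow> 'n::finite \<Rightarrow> 'n \<Rightarrow> bool) \<Rightarrow> (nat \<Rightarrow> 'n \<Rightarrow> nat \<Rightarrow> bool)
   \<Rightarrow> (nat \<Rightarrow> real^'n^'n) \<Rightarrow> (nat \<Rightarrow> nat \<Rightarrow> real^'n) \<Rightarrow> bool" where
  "realization N m PA PB A Bc \<longleftrightarrow>
     (\<forall>i\<in>{1..N}. (\<forall>j k. A i $ j $ k \<noteq> 0 \<longrightarrow> PA i j k) \<and>
                  (\<forall>j k. k < m i \<longrightarrow> Bc i k $ j \<noteq> 0 \<longrightarrow> PB i j k))"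

definition concat_columns ::
  "nat \<Rightarrow> (nat \<Rightarrow> nat) \<Rightarrow> (nat \<Rightarrow> real^'n^'n) \<Rightarrow> (nat \<Rightarrow> nat \<Rightarrow> real^'n::finite) \<Rightarrow> (real^'n) set" where
  "concat_columns N m A Bc =
     {column k (A i) | i k. i \<in> {1..N}} \<union> {Bc i k | i k. i \<in> {1..N} \<and> k < m i}"

definition concat_rank ::
  "nat \<Rightarrow> (nat \<Rightarrow> nat) \<Rightarrow> (nat \<Rightarrow> real^'n^'n) \<Rightarrow> (nat \<Rightarrow> nat \<Rightarrow> real^'n::finite) \<Rightarrow> nat" where
  "concat_rank N m A Bc = dim (span (concat_columns N m A Bc))"

definition grank ::
  "nat \<Rightarrow> (nat \<Rightarrow> nat) \<Rightarrow> (nat \<Rightarrow> 'n::finite \<Rightarrow> 'n \<Rightarrow> bool) \<Rightarrow> (nat \<Rightarrow> 'n \<Rightarrow> nat \<Rightarrow> bool) \<Rightarrow> nat" where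
  "grank N m PA PB =
     Max {concat_rank N m A Bc | A Bc. realization N m PA PB A Bc}"

definition switched_trajectory ::
  "nat \<Rightarrow> (nat \<Rightarrow> nat) \<Rightarrow> (nat \<Rightarrow> real^'n^'n) \<Rightarrow> (nat \<Rightarrow> nat \<Rightarrow> real^'n::finite)
   \<Rightarrow> real \<Rightarrow> (real \<Rightarrow> nat) \<Rightarrow> (real \<Rightarrow> nat \<Rightarrow> real) \<Rightarrow> (real \<Rightarrow> real^'n) \<Rightarrow> bool" where
  "switched_trajectory N m A Bc tf \<sigma> u x \<longleftrightarrow>
     0 \<le> tf \<and> continuous_on {0..tf} x \<and>
     (\<exists>(ts::nat \<Rightarrow> real) (K::nat). ts 0 = 0 \<and> ts K = tf \<and>
        (\<forall>l<K. ts l < ts (Suc l)) \<and>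
        (\<forall>l<K. \<exists>i\<in>{1..N}. (\<forall>t\<in>{ts l..<ts (Suc l)}. \<sigma> t = i) \<and>
           (\<forall>r<m i. \<exists>g. continuous_on {ts l..ts (Suc l)} g \<and>
                        (\<forall>t\<in>{ts l<..<ts (Suc l)}. u t r = g t)) \<and>
           (\<forall>t\<in>{ts l<..<ts (Suc l)}.
              (x has_vector_derivative (A i *v x t + (\<Sum>r<m i. u t r *\<^sub>R Bc i r))) (at t))))"

definition controllable_state ::
  "nat \<Rightarrow> (nat \<Rightarrow> nat) \<Rightarrow> (nat \<Rightarrow> real^'n^'n) \<Rightarrow> (nat \<Rightarrow> nat \<Rightarrow> real^'n::finite) \<Rightarrow> real^'n \<Rightarrow> bool" where
  "controllable_state N m A Bc x0 \<longleftrightarrow>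
     (\<exists>tf \<sigma> u x. switched_trajectory N m A Bc tf \<sigma> u x \<and> x 0 = x0 \<and> x tf = 0)"

definition switched_controllable ::
  "nat \<Rightarrow> (nat \<Rightarrow> nat) \<Rightarrow> (nat \<Rightarrow> real^'n^'n) \<Rightarrow> (nat \<Rightarrow> nat \<Rightarrow> real^'n::finite) \<Rightarrow> bool" where
  "switched_controllable N m A Bc \<longleftrightarrow> (\<forall>x0. controllable_state N m A Bc x0)"

definition structurally_controllable ::
  "nat \<Rightarrow> (nat \<Rightarrow> nat) \<Rightarrow> (nat \<Rightarrow> 'n::finite \<Rightarrow> 'n \<Rightarrow> bool) \<Rightarrow> (nat \<Rightarrow> 'n \<Rightarrow> nat \<Rightarrow> bool) \<Rightarrow> bool" where
  "structurally_controllable N m PA PB \<longleftrightarrow>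
     (\<exists>A Bc. realization N m PA PB A Bc \<and> switched_controllable N m A Bc)"

datatype 'n vtx = SV 'n | IV nat nat  \<comment> \<open>state vertex x_j; input vertex u^i_k\<close>

type_synonym 'n cedge = "'n vtx \<times> 'n vtx \<times> nat"

definition etail :: "'n cedge \<Rightarrow> 'n vtx" where "etail e = fst e"
definition ehead :: "'n cedge \<Rightarrow> 'n vtx" where "ehead e = fst (snd e)"
definition ecolor :: "'n cedge \<Rightarrow> nat" where "ecolor e = snd (snd e)"

fun is_input :: "'n vtx \<Rightarrow> bool" where
  "is_input (SV _) = False" | "is_input (IV _ _) = True"

definition Gc_vertices :: "nat \<Rightarrow> (nat \<Rightarrow> nat) \<Rightarrow> 'n vtx set" where
  "Gc_vertices N m = range SV \<union> {IV i k | i k. i \<in> {1..N} \<and> k < m i}"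

definition Gc_edges ::
  "nat \<Rightarrow> (nat \<Rightarrow> nat) \<Rightarrow> (nat \<Rightarrow> 'n \<Rightarrow> 'n \<Rightarrow> bool) \<Rightarrow> (nat \<Rightarrow> 'n \<Rightarrow> nat \<Rightarrow> bool) \<Rightarrow> 'n cedge set" where
  "Gc_edges N m PA PB =
     {(SV k, SV j, i) | i j k. i \<in> {1..N} \<and> PA i j k} \<union>
     {(IV i k, SV j, i) | i j k. i \<in> {1..N} \<and> k < m i \<and> PB i j k}"

definition input_reachable ::
  "nat \<Rightarrow> (nat \<Rightarrow> nat) \<Rightarrow> (nat \<Rightarrow> 'n \<Rightarrow> 'n \<Rightarrow> bool) \<Rightarrow> (nat \<Rightarrow> 'n \<Rightarrow> nat \<Rightarrow> bool) \<Rightarrow> 'n \<Rightarrow> bool" where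
  "input_reachable N m PA PB j \<longleftrightarrow>
     (\<exists>v. is_input v \<and> v \<in> Gc_vertices N m \<and>
          (v, SV j) \<in> {(etail e, ehead e) | e. e \<in> Gc_edges N m PA PB}\<^sup>+)"

definition S_disjoint :: "'n cedge set \<Rightarrow> bool" where
  "S_disjoint Es \<longleftrightarrow>
     (\<forall>e1\<in>Es. \<forall>e2\<in>Es. ehead e1 = ehead e2 \<longrightarrow> e1 = e2) \<and>
     (\<forall>e1\<in>Es. \<forall>e2\<in>Es. e1 \<noteq> e2 \<and> etail e1 = etail e2 \<longrightarrow> ecolor e1 \<noteq> ecolor e2)"

text \<open>A cycle of the edge set Es, represented by its (nonempty) set of edges: a closed walk
  whose vertices are distinct except for start = end (self-loops allowed).\<close>
definition cycle_in :: "'n cedge set \<Rightarrow> 'n cedge set \<Rightarrow> bool" where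
  "cycle_in Es C \<longleftrightarrow>
     (\<exists>es. es \<noteq> [] \<and> set es = C \<and> set es \<subseteq> Es \<and> distinct (map etail es) \<and>
           (\<forall>l. Suc l < length es \<longrightarrow> ehead (es ! l) = etail (es ! Suc l)) \<and>
           ehead (last es) = etail (hd es))"

definition is_subgraph ::
  "nat \<Rightarrow> (nat \<Rightarrow> nat) \<Rightarrow> (nat \<Rightarrow> 'n \<Rightarrow> 'n \<Rightarrow> bool) \<Rightarrow> (nat \<Rightarrow> 'n \<Rightarrow> nat \<Rightarrow> bool)
   \<Rightarrow> 'n vtx set \<Rightarrow> 'n cedge set \<Rightarrow> bool" where
  "is_subgraph N m PA PB Vs Es \<longleftrightarrow>
     Vs \<subseteq> Gc_vertices N m \<and> Es \<subseteq> Gc_edges N m PA PB \<and>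
     (\<forall>e\<in>Es. etail e \<in> Vs \<and> ehead e \<in> Vs)"

definition unique_indeg :: "'n vtx set \<Rightarrow> 'n cedge set \<Rightarrow> bool" where
  "unique_indeg Vs Es \<longleftrightarrow> (\<forall>j. SV j \<in> Vs \<longrightarrow> (\<exists>!e. e \<in> Es \<and> ehead e = SV j))"

definition gen_stem ::
  "nat \<Rightarrow> (nat \<Rightarrow> nat) \<Rightarrow> (nat \<Rightarrow> 'n \<Rightarrow> 'n \<Rightarrow> bool) \<Rightarrow> (nat \<Rightarrow> 'n \<Rightarrow> nat \<Rightarrow> bool)
   \<Rightarrow> 'n vtx set \<Rightarrow> 'n cedge set \<Rightarrow> bool" where
  "gen_stem N m PA PB Vs Es \<longleftrightarrow>
     is_subgraph N m PA PB Vs Es \<and>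
     (\<exists>!v. v \<in> Vs \<and> is_input v) \<and>
     \<not> (\<exists>C. cycle_in Es C) \<and>
     unique_indeg Vs Es \<and> S_disjoint Es"

definition gen_bud ::
  "nat \<Rightarrow> (nat \<Rightarrow> nat) \<Rightarrow> (nat \<Rightarrow> 'n \<Rightarrow> 'n \<Rightarrow> bool) \<Rightarrow> (nat \<Rightarrow> 'n \<Rightarrow> nat \<Rightarrow> bool)
   \<Rightarrow> 'n vtx set \<Rightarrow> 'n cedge set \<Rightarrow> bool" where
  "gen_bud N m PA PB Vs Es \<longleftrightarrow>
     is_subgraph N m PA PB Vs Es \<and>
     \<not> (\<exists>v\<in>Vs. is_input v) \<and>
     (\<exists>!C. cycle_in Es C) \<and>
     (\<forall>j. SV j \<in> Vs \<longrightarrow> input_reachable N m PA PB j) \<and>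
     unique_indeg Vs Es \<and> S_disjoint Es"

definition stem_bud_cover ::
  "nat \<Rightarrow> (nat \<Rightarrow> nat) \<Rightarrow> (nat \<Rightarrow> 'n \<Rightarrow> 'n \<Rightarrow> bool) \<Rightarrow> (nat \<Rightarrow> 'n \<Rightarrow> nat \<Rightarrow> bool)
   \<Rightarrow> ('n vtx set \<times> 'n cedge set) set \<Rightarrow> bool" where
  "stem_bud_cover N m PA PB S \<longleftrightarrow>
     (\<forall>(Vs, Es)\<in>S. gen_stem N m PA PB Vs Es \<or> gen_bud N m PA PB Vs Es) \<and>
     (\<forall>s1\<in>S. \<forall>s2\<in>S. s1 \<noteq> s2 \<longrightarrow> fst s1 \<inter> fst s2 = {}) \<and>
     (\<forall>j. \<exists>s\<in>S. SV j \<in> fst s)"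

end

theory Submission
  imports Defs
begin

text \<open>
  Necessity: a covector annihilating all columns is constant along trajectories, and the
  coordinates of unreachable states obey an autonomous linear equation, so Gronwall keeps a
  nonzero value away from zero. A realization of rank $n$ has a nonzero term in some determinant,
  which is a matching assigning to each state an ingoing edge, with distinct (tail, colour) pairs;
  the components of the parent map of this matching are the stems and buds.

  Sufficiency: a switched system is controllable unless some proper subspace contains all input
  columns and is invariant under every $A_i$. Start from the states whose chain of matching
  parents ends in an input (level 0) and repeatedly add one edge leaving the set reached so far,
  together with everything its head reaches by matching edges (the next level). Give the matching
  edges weights growing rapidly with the level, and the added edges powers of a small
  $\epsilon$. If a proper invariant subspace existed for arbitrarily small $\epsilon$, let
  $\epsilon \to 0$ in two ways. Directly, the system tends to the matching, and following a cycle
  of the matching gives a word with nonzero trace on the limit quotient. After rescaling the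
  states by powers of $\epsilon$, it tends to a system that moves only within or up the levels,
  and there all long words vanish on the limit quotient. Traces of words are invariant under the
  rescaling, a contradiction.
\<close>

section \<open>Linear differential equations\<close>

text \<open>Neither limit system need be controllable, so neither alone gives a contradiction: the
  matching may have cycles cut off from the inputs, and the rescaled limit loses the matching edges
  that descend a level. What the two share is the trace of a word on the quotient by the invariant
  subspace. It does not depend on the chosen complement, so orthogonal projections may be taken
  separately in the original and in the rescaled coordinates. These form bounded sets, hence
  converge along a common subsequence, and the equations \<open>P A P = P A\<close> and
  \<open>P B = 0\<close> survive the limit, although the two limit subspaces may be unrelated. The
  growth of the weights rules out coincidences: two self-loops of the same colour and weight,
  entered from the same state by edges of one colour, would move in parallel, and their difference
  would be a part of the rescaled limit that the inputs cannot influence and on which words have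
  nonzero trace.\<close>

lemma abs_deriv_le_imp_exp_bounds:
  fixes g :: "real \<Rightarrow> real"
  assumes "a \<le> b" and cont: "continuous_on {a..b} g"
    and der: "\<And>t. a < t \<Longrightarrow> t < b \<Longrightarrow> \<exists>d. DERIV g t :> d \<and> \<bar>d\<bar> \<le> C * g t"
  shows "g b \<le> exp (C * (b - a)) * g a" and "g a \<le> exp (C * (b - a)) * g b"
proof -
  \<comment> \<open>Gronwall in both directions of time: \<open>g t * exp (- C * t)\<close> is
    nonincreasing and \<open>g t * exp (C * t)\<close> is nondecreasing. Derivatives are assumed
    only in the open interval, since trajectories may have corners at switching times.\<close>
  have "g b * exp (- C * b) \<le> g a * exp (- C * a)"
  proof (rule DERIV_nonpos_imp_decreasing_open[OF \<open>a \<le> b\<close>])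
    fix t assume "a < t" "t < b"
    with der obtain d where d: "DERIV g t :> d" "\<bar>d\<bar> \<le> C * g t" by blast
    have "((\<lambda>t. g t * exp (- C * t)) has_real_derivative (d - C * g t) * exp (- C * t)) (at t)"
      by (rule derivative_eq_intros d refl | simp add: algebra_simps)+
    moreover have "(d - C * g t) * exp (- C * t) \<le> 0"
      using d(2) by (intro mult_nonpos_nonneg) auto
    ultimately show "\<exists>y. ((\<lambda>t. g t * exp (- C * t)) has_real_derivative y) (at t) \<and> y \<le> 0" by blast
  qed (intro continuous_intros cont)
  then have "g b * exp (- C * b) * exp (C * b) \<le> g a * exp (- C * a) * exp (C * b)"
    by (rule mult_right_mono) simp
  then show "g b \<le> exp (C * (b - a)) * g a"
    by (simp add: mult.assoc exp_add[symmetric] algebra_simps)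
  have "g a * exp (C * a) \<le> g b * exp (C * b)"
  proof (rule DERIV_nonneg_imp_increasing_open[OF \<open>a \<le> b\<close>])
    fix t assume "a < t" "t < b"
    with der obtain d where d: "DERIV g t :> d" "\<bar>d\<bar> \<le> C * g t" by blast
    have "((\<lambda>t. g t * exp (C * t)) has_real_derivative (d + C * g t) * exp (C * t)) (at t)"
      by (rule derivative_eq_intros d refl | simp add: algebra_simps)+
    moreover have "(d + C * g t) * exp (C * t) \<ge> 0"
      using d(2) by (intro mult_nonneg_nonneg) auto
    ultimately show "\<exists>y. ((\<lambda>t. g t * exp (C * t)) has_real_derivative y) (at t) \<and> y \<ge> 0" by blast
  qed (intro continuous_intros cont)
  then have "g a * exp (C * a) * exp (- C * a) \<le> g b * exp (C * b) * exp (- C * a)"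
    by (rule mult_right_mono) simp
  then show "g a \<le> exp (C * (b - a)) * g b"
    by (simp add: mult.assoc exp_add[symmetric] algebra_simps)
qed

text \<open>The squared norm has a derivative bounded by \<open>2 * K\<close> times itself. Asking
  for an inequality instead of an equation lets the lemma serve projections of trajectories with
  arbitrary inputs.\<close>

lemma linear_growth_zero_iff:
  fixes x :: "real \<Rightarrow> 'a::real_inner"
  assumes "a \<le> b" and cont: "continuous_on {a..b} x"
    and der: "\<And>t. a < t \<Longrightarrow> t < b \<Longrightarrow> \<exists>D. (x has_vector_derivative D) (at t) \<and> norm D \<le> K * norm (x t)"
  shows "x a = 0 \<longleftrightarrow> x b = 0"
proof -
  let ?g = "\<lambda>t. x t \<bullet> x t"
  have c: "continuous_on {a..b} ?g" by (intro continuous_intros cont)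
  have d: "\<exists>d. DERIV ?g t :> d \<and> \<bar>d\<bar> \<le> (2 * K) * ?g t" if "a < t" "t < b" for t
  proof -
    from der[OF that] obtain D where D: "(x has_vector_derivative D) (at t)" "norm D \<le> K * norm (x t)" by blast
    have "(?g has_derivative (\<lambda>h. x t \<bullet> (h *\<^sub>R D) + (h *\<^sub>R D) \<bullet> x t)) (at t)"
      using D(1) unfolding has_vector_derivative_def by (intro has_derivative_inner)
    moreover have "(\<lambda>h. x t \<bullet> (h *\<^sub>R D) + (h *\<^sub>R D) \<bullet> x t) = (*) (2 * (x t \<bullet> D))"
      by (auto simp: inner_commute fun_eq_iff)
    ultimately have "DERIV ?g t :> 2 * (x t \<bullet> D)"
      unfolding has_field_derivative_def by simp
    moreover have "\<bar>2 * (x t \<bullet> D)\<bar> \<le> (2 * K) * ?g t"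
    proof -
      have "\<bar>x t \<bullet> D\<bar> \<le> norm (x t) * norm D" by (rule Cauchy_Schwarz_ineq2)
      also have "\<dots> \<le> norm (x t) * (K * norm (x t))" by (intro mult_left_mono D) auto
      finally show ?thesis by (simp add: dot_square_norm power2_eq_square algebra_simps)
    qed
    ultimately show ?thesis by blast
  qed
  from abs_deriv_le_imp_exp_bounds[OF \<open>a \<le> b\<close> c d] show ?thesis
    by (metis inner_eq_zero_iff inner_ge_zero mult_zero_right order_antisym)
qed

text \<open>The solution is the everywhere convergent series
  \<open>z + t w + (t^2 / 2!) A w + ...\<close> with initial velocity \<open>w = A z + c\<close>. It
  is summed coordinatewise, so that termwise differentiation of real power series applies.\<close>

lemma affine_ode_solution_exists:
  fixes A :: "real^'n^'n" and c z :: "real^'n"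
  shows "\<exists>\<phi>. \<phi> 0 = z \<and> (\<forall>t. (\<phi> has_vector_derivative (A *v \<phi> t + c)) (at t))"
proof -
  define w where "w = A *v z + c"
  define pw where "pw n = (((*v) A) ^^ n) w" for n
  define a where "a n = (case n of 0 \<Rightarrow> z | Suc k \<Rightarrow> pw k /\<^sub>R fact (Suc k))" for n
  have pw_Suc: "pw (Suc n) = A *v pw n" for n by (simp add: pw_def)
  obtain K where K: "K > 0" "\<And>x. norm (A *v x) \<le> norm x * K"
    using bounded_linear.pos_bounded[OF matrix_vector_mul_bounded_linear[of A]] by blast
  have pw_le: "norm (pw n) \<le> K ^ n * norm w" for n
  proof (induction n)
    case (Suc n)
    have "norm (pw (Suc n)) \<le> norm (pw n) * K" using K(2) by (simp add: pw_Suc)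
    also have "\<dots> \<le> K ^ n * norm w * K" using Suc K by (intro mult_right_mono) auto
    finally show ?case by (simp add: ac_simps)
  qed (simp add: pw_def)
  have s1_abs: "summable (\<lambda>n. \<bar>pw n $ j / fact n * y ^ n\<bar>)" for j y
  proof (rule summable_comparison_test')
    have "summable (\<lambda>n. (K * \<bar>y\<bar>) ^ n /\<^sub>R fact n)" by (rule summable_exp_generic)
    then show "summable (\<lambda>n. norm w * ((K * \<bar>y\<bar>) ^ n /\<^sub>R fact n))" by (rule summable_mult)
    fix n :: nat
    have "\<bar>pw n $ j\<bar> \<le> K ^ n * norm w" using pw_le component_le_norm_cart order_trans by blast
    then have "\<bar>pw n $ j\<bar> * (\<bar>y\<bar> ^ n / fact n) \<le> K ^ n * norm w * (\<bar>y\<bar> ^ n / fact n)"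
      by (intro mult_right_mono) auto
    then show "norm \<bar>pw n $ j / fact n * y ^ n\<bar> \<le> norm w * ((K * \<bar>y\<bar>) ^ n /\<^sub>R fact n)"
      by (simp add: abs_mult power_abs power_mult_distrib field_simps)
  qed
  have s1: "summable (\<lambda>n. pw n $ j / fact n * y ^ n)" for j y
    using s1_abs by (rule summable_rabs_cancel)
  have dif: "diffs (\<lambda>n. a n $ j) n = pw n $ j / fact n" for j n
    by (simp add: diffs_def a_def field_simps del: of_nat_Suc)
  have Aa: "(A *v a (Suc n)) = pw (Suc n) /\<^sub>R fact (Suc n)" for n
    by (simp add: a_def pw_Suc matrix_vector_mult_scaleR)
  \<comment> \<open>Without its constant term and one factor \<open>y\<close>, the series is
    dominated by that of its derivative.\<close>
  have s2: "summable (\<lambda>n. a n $ j * y ^ n)" for j y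
  proof -
    have "summable (\<lambda>n. (a (Suc n) $ j * y ^ n) * y)"
    proof (rule summable_mult2, rule summable_comparison_test'[OF s1_abs[of j y]])
      fix n :: nat
      have "\<bar>pw n $ j\<bar> * \<bar>y\<bar> ^ n / fact (Suc n) \<le> \<bar>pw n $ j\<bar> * \<bar>y\<bar> ^ n / fact n"
        by (intro divide_left_mono) (auto intro: fact_mono simp del: fact_Suc)
      then show "norm (a (Suc n) $ j * y ^ n) \<le> \<bar>pw n $ j / fact n * y ^ n\<bar>"
        by (simp add: a_def abs_mult power_abs divide_inverse_commute mult.assoc del: fact_Suc)
    qed
    then show ?thesis by (subst summable_Suc_iff[symmetric]) (simp add: ac_simps)
  qed
  define \<phi> where "\<phi> t = (\<chi> j. \<Sum>n. a n $ j * t ^ n)" for t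
  have "(\<phi> has_vector_derivative (A *v \<phi> t + c)) (at t)" for t
  proof -
    have "((\<lambda>t. \<phi> t $ j) has_real_derivative (A *v \<phi> t + c) $ j) (at t)" for j
    proof -
      have "((\<lambda>t. \<phi> t $ j) has_real_derivative (\<Sum>n. diffs (\<lambda>n. a n $ j) n * t ^ n)) (at t)"
        unfolding \<phi>_def using termdiffs_strong_converges_everywhere[of "\<lambda>n. a n $ j" t] s2 by simp
      \<comment> \<open>The constant \<open>c\<close> enters through the zeroth coefficient only, as
        \<open>A z + c = w\<close>; on the later coefficients, multiplication by \<open>A\<close>
        raises the index of \<open>pw\<close> by one.\<close>
      moreover have "(A *v \<phi> t + c) $ j = (\<Sum>n. diffs (\<lambda>n. a n $ j) n * t ^ n)"
      proof -
        have "(A *v \<phi> t) $ j = (\<Sum>l\<in>UNIV. \<Sum>n. A $ j $ l * (a n $ l * t ^ n))"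
          using s2 by (simp add: matrix_vector_mult_def \<phi>_def suminf_mult)
        also have "\<dots> = (\<Sum>n. \<Sum>l\<in>UNIV. A $ j $ l * (a n $ l * t ^ n))"
          using s2 by (intro suminf_sum[symmetric] summable_mult)
        also have "\<dots> = (\<Sum>n. (A *v a n) $ j * t ^ n)"
          by (simp add: matrix_vector_mult_def sum_distrib_right mult.assoc)
        also have "\<dots> = (A *v z) $ j + (\<Sum>n. (A *v a (Suc n)) $ j * t ^ Suc n)"
        proof -
          have "summable (\<lambda>n. (A *v a n) $ j * t ^ n)"
            using summable_sum[of UNIV "\<lambda>l n. A $ j $ l * (a n $ l * t ^ n)"] s2
            by (simp add: matrix_vector_mult_def sum_distrib_right mult.assoc summable_mult)
          then show ?thesis by (subst suminf_split_head) (auto simp: a_def)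
        qed
        finally have "(A *v \<phi> t + c) $ j = w $ j + (\<Sum>n. pw (Suc n) $ j / fact (Suc n) * t ^ Suc n)"
          by (simp add: w_def Aa divide_inverse_commute del: fact_Suc)
        also have "\<dots> = (\<Sum>n. pw n $ j / fact n * t ^ n)"
          using suminf_split_head[OF s1[of j t]] by (simp add: pw_def)
        finally show ?thesis by (simp add: dif)
      qed
      ultimately show ?thesis by simp
    qed
    then show ?thesis
      unfolding has_vector_derivative_def has_derivative_componentwise_within[of \<phi>]
        has_field_derivative_def
      by (simp add: Basis_vec_def inner_axis mult_commute_abs)
  qed
  moreover have "\<phi> 0 = z" by (simp add: \<phi>_def a_def vec_eq_iff)
  ultimately show ?thesis by blast
qed

section \<open>Flow of an affine equation with constant input\<close>

definition affine_flow :: "real^'n^'n \<Rightarrow> real^'n \<Rightarrow> real^'n \<Rightarrow> real \<Rightarrow> real^'n" where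
  "affine_flow A c z = (SOME \<phi>. \<phi> 0 = z \<and> (\<forall>t. (\<phi> has_vector_derivative (A *v \<phi> t + c)) (at t)))"

lemma affine_flow_0 [simp]: "affine_flow A c z 0 = z"
  and affine_flow_deriv: "(affine_flow A c z has_vector_derivative (A *v affine_flow A c z t + c)) (at t)"
  using someI_ex[OF affine_ode_solution_exists[of z A c]] unfolding affine_flow_def by auto

lemma affine_flow_continuous: "continuous_on S (affine_flow A c z)"
  by (meson affine_flow_deriv continuous_at_imp_continuous_on has_vector_derivative_continuous)

lemma linear_ode_zero_everywhere:
  fixes A :: "real^'n^'n"
  assumes d: "\<And>t. (\<phi> has_vector_derivative (A *v \<phi> t)) (at t)" and "\<phi> s = 0"
  shows "\<phi> t = 0"
proof -
  obtain K where K: "K > 0" "\<And>x. norm (A *v x) \<le> norm x * K"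
    using bounded_linear.pos_bounded[OF matrix_vector_mul_bounded_linear[of A]] by blast
  have cont: "continuous_on S \<phi>" for S
    by (meson d continuous_at_imp_continuous_on has_vector_derivative_continuous)
  have "\<phi> a = 0 \<longleftrightarrow> \<phi> b = 0" if "a \<le> b" for a b
    by (rule linear_growth_zero_iff[OF that cont, of K]) (use d K in \<open>auto simp: mult.commute\<close>)
  then show ?thesis using \<open>\<phi> s = 0\<close> by (metis linear)
qed

lemma affine_flow_unique:
  assumes d: "\<And>t. (\<phi> has_vector_derivative (A *v \<phi> t + c)) (at t)" and "\<phi> 0 = z"
  shows "affine_flow A c z t = \<phi> t"
proof -
  have "affine_flow A c z t - \<phi> t = 0"
  proof (rule linear_ode_zero_everywhere)
    show "((\<lambda>t. affine_flow A c z t - \<phi> t) has_vector_derivative A *v (affine_flow A c z t - \<phi> t)) (at t)" for t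
      using has_vector_derivative_diff[OF affine_flow_deriv[of A c z t] d[of t]]
      by (simp add: matrix_vector_mult_diff_distrib)
    show "affine_flow A c z 0 - \<phi> 0 = 0" using assms by simp
  qed
  then show ?thesis by simp
qed

text \<open>Joint linearity in input and state is what makes the sets of states steered to 0, or
  from 0, subspaces.\<close>

lemma affine_flow_add:
  "affine_flow A (c + c') (z + z') t = affine_flow A c z t + affine_flow A c' z' t"
proof (rule affine_flow_unique)
  show "((\<lambda>t. affine_flow A c z t + affine_flow A c' z' t) has_vector_derivative
     A *v (affine_flow A c z t + affine_flow A c' z' t) + (c + c')) (at t)" for t
    using has_vector_derivative_add[OF affine_flow_deriv[of A c z t] affine_flow_deriv[of A c' z' t]]
    by (simp add: matrix_vector_right_distrib algebra_simps)
qed simp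

lemma affine_flow_scaleR:
  "affine_flow A (r *\<^sub>R c) (r *\<^sub>R z) t = r *\<^sub>R affine_flow A c z t"
proof (rule affine_flow_unique)
  show "((\<lambda>t. r *\<^sub>R affine_flow A c z t) has_vector_derivative
     A *v (r *\<^sub>R affine_flow A c z t) + r *\<^sub>R c) (at t)" for t
    using bounded_linear.has_vector_derivative[OF bounded_linear_scaleR_right affine_flow_deriv[of A c z t]]
    by (simp add: matrix_vector_mult_scaleR scaleR_add_right)
qed simp

lemma affine_flow_zero_zero [simp]: "affine_flow A 0 0 t = 0"
  using affine_flow_scaleR[of A 0 0 0 t] by simp

lemma affine_flow_inj: "affine_flow A 0 z t = 0 \<Longrightarrow> z = 0"
  using linear_ode_zero_everywhere[of "affine_flow A 0 z" A t 0] affine_flow_deriv[of A 0 z] by simp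

section \<open>Invariant subspaces and controllability\<close>

text \<open>
  Inputs are constant on each piece. The flow is run backwards from the end \<open>z\<close> of a piece, so that
  no inverse flow is needed.
\<close>

primrec steers :: "(nat \<Rightarrow> nat) \<Rightarrow> (nat \<Rightarrow> real^'n^'n) \<Rightarrow> (nat \<Rightarrow> nat \<Rightarrow> real^'n)
    \<Rightarrow> (nat \<times> real) list \<Rightarrow> real^'n \<Rightarrow> real^'n \<Rightarrow> bool" where
  "steers m A Bc [] x y \<longleftrightarrow> x = y"
| "steers m A Bc (p # s) x y \<longleftrightarrow>
     (\<exists>u z. x = affine_flow (A (fst p)) (\<Sum>r<m (fst p). u r *\<^sub>R Bc (fst p) r) z (- snd p) \<and>
            steers m A Bc s z y)"

lemma steers_append:
  "steers m A Bc (s @ s') x y \<longleftrightarrow> (\<exists>z. steers m A Bc s x z \<and> steers m A Bc s' z y)"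
  by (induction s arbitrary: x) auto

lemma steers_add:
  "steers m A Bc s x y \<Longrightarrow> steers m A Bc s x' y' \<Longrightarrow> steers m A Bc s (x + x') (y + y')"
proof (induction s arbitrary: x x')
  case (Cons p s)
  from Cons.prems obtain u z u' z' where
    *: "x = affine_flow (A (fst p)) (\<Sum>r<m (fst p). u r *\<^sub>R Bc (fst p) r) z (- snd p)"
      "x' = affine_flow (A (fst p)) (\<Sum>r<m (fst p). u' r *\<^sub>R Bc (fst p) r) z' (- snd p)"
      "steers m A Bc s z y" "steers m A Bc s z' y'" by auto
  have "x + x' = affine_flow (A (fst p)) (\<Sum>r<m (fst p). (u r + u' r) *\<^sub>R Bc (fst p) r) (z + z') (- snd p)"
    by (simp add: * affine_flow_add[symmetric] scaleR_add_left sum.distrib)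
  with Cons.IH[OF *(3,4)] show ?case
    by (auto intro!: exI[of _ "\<lambda>r. u r + u' r"] exI[of _ "z + z'"])
qed simp

lemma steers_scaleR: "steers m A Bc s x y \<Longrightarrow> steers m A Bc s (k *\<^sub>R x) (k *\<^sub>R y)"
proof (induction s arbitrary: x)
  case (Cons p s)
  from Cons.prems obtain u z where
    *: "x = affine_flow (A (fst p)) (\<Sum>r<m (fst p). u r *\<^sub>R Bc (fst p) r) z (- snd p)"
      "steers m A Bc s z y" by auto
  have "k *\<^sub>R x = affine_flow (A (fst p)) (\<Sum>r<m (fst p). (k * u r) *\<^sub>R Bc (fst p) r) (k *\<^sub>R z) (- snd p)"
    by (simp add: * affine_flow_scaleR[symmetric] scaleR_sum_right)
  with Cons.IH[OF *(2)] show ?case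
    by (auto intro!: exI[of _ "\<lambda>r. k * u r"] exI[of _ "k *\<^sub>R z"])
qed simp

lemma steers_diff:
  "steers m A Bc s x y \<Longrightarrow> steers m A Bc s x' y' \<Longrightarrow> steers m A Bc s (x - x') (y - y')"
  using steers_add[of m A Bc s x y "- x'" "- y'"] steers_scaleR[of m A Bc s x' y' "-1"] by simp

lemma steers_zero: "steers m A Bc s 0 0"
  by (induction s) (auto intro!: exI[of _ "\<lambda>_. 0"] exI[of _ 0])

text \<open>Running the schedule backwards with zero input is linear and injective, because
  homogeneous flows are. Later \<open>\<Psi>\<close> carries the states reached from 0 injectively
  into the states steered to 0.\<close>

lemma steers_free_motion:
  "\<exists>\<Psi>. linear \<Psi> \<and> (\<forall>y. \<Psi> y = 0 \<longrightarrow> y = 0) \<and> (\<forall>y. steers m A Bc s (\<Psi> y) y)"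
proof (induction s)
  case Nil
  show ?case by (intro exI[of _ id] conjI linear_id) auto
next
  case (Cons p s)
  then obtain \<Psi> where \<Psi>: "linear \<Psi>" "\<forall>y. \<Psi> y = 0 \<longrightarrow> y = 0" "\<forall>y. steers m A Bc s (\<Psi> y) y" by blast
  let ?F = "\<lambda>z. affine_flow (A (fst p)) 0 z (- snd p)"
  have "linear ?F"
    using affine_flow_add[of "A (fst p)" 0 0] affine_flow_scaleR[of "A (fst p)" _ 0]
    by (intro linearI) auto
  then have "linear (\<lambda>y. ?F (\<Psi> y))" using linear_compose[OF \<Psi>(1)] by (simp add: o_def)
  moreover have "\<forall>y. ?F (\<Psi> y) = 0 \<longrightarrow> y = 0" using \<Psi>(2) affine_flow_inj by blast
  moreover have "\<forall>y. steers m A Bc (p # s) (?F (\<Psi> y)) y" using \<Psi>(3)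
    by (auto intro!: exI[of _ "\<lambda>_. 0"])
  ultimately show ?case by blast
qed

lemma steers_imp_trajectory:
  assumes "\<And>p. p \<in> set s \<Longrightarrow> fst p \<in> {1..N} \<and> snd p > 0" and "steers m A Bc s x0 y"
  shows "\<exists>tf \<sigma> u x. switched_trajectory N m A Bc tf \<sigma> u x \<and> x 0 = x0 \<and> x tf = y"
  using assms
proof (induction s arbitrary: x0)
  case Nil
  then show ?case
    by (intro exI[of _ 0] exI[of _ "\<lambda>_. 0"] exI[of _ "\<lambda>_ _. 0"] exI[of _ "\<lambda>_. y"])
       (auto simp: switched_trajectory_def intro!: exI[of _ "\<lambda>_. 0"] exI[of _ "0::nat"])
next
  case (Cons p s)
  obtain i h where p: "p = (i, h)" by (cases p)
  have i: "i \<in> {1..N}" and h: "h > 0" using Cons.prems(1)[of p] p by auto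
  from Cons.prems(2) obtain v z where
    x0: "x0 = affine_flow (A i) (\<Sum>r<m i. v r *\<^sub>R Bc i r) z (- h)" and z: "steers m A Bc s z y"
    by (auto simp: p)
  let ?c = "\<Sum>r<m i. v r *\<^sub>R Bc i r"
  from Cons.IH[OF Cons.prems(1) z] obtain tf \<sigma> u x where
    tr: "switched_trajectory N m A Bc tf \<sigma> u x" "x 0 = z" "x tf = y" by auto
  from tr(1) obtain ts K where tf: "0 \<le> tf" and cx: "continuous_on {0..tf} x"
    and ts: "ts 0 = 0" "ts K = tf" "\<And>l. l < K \<Longrightarrow> ts l < ts (Suc l)"
    and pc: "\<And>l. l < K \<Longrightarrow> \<exists>i\<in>{1..N}. (\<forall>t\<in>{ts l..<ts (Suc l)}. \<sigma> t = i) \<and>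
           (\<forall>r<m i. \<exists>g. continuous_on {ts l..ts (Suc l)} g \<and>
                        (\<forall>t\<in>{ts l<..<ts (Suc l)}. u t r = g t)) \<and>
           (\<forall>t\<in>{ts l<..<ts (Suc l)}.
              (x has_vector_derivative (A i *v x t + (\<Sum>r<m i. u t r *\<^sub>R Bc i r))) (at t))"
    unfolding switched_trajectory_def by blast
  have ts_nonneg: "l \<le> K \<Longrightarrow> ts l \<ge> 0" for l
  proof (induction l)
    case (Suc l) then show ?case using ts(3)[of l] by simp
  qed (simp add: ts)
  \<comment> \<open>The rest of the trajectory is delayed by \<open>h\<close>. The flow is evaluated
    at \<open>t - h\<close>, so it leaves \<open>x0\<close> at time 0 and meets \<open>z\<close> at
    time \<open>h\<close>. Mode and input change at \<open>t = h\<close> itself, as pieces are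
    closed on the left and open on the right, whereas both branches of \<open>x'\<close> agree
    there.\<close>
  define \<sigma>' where "\<sigma>' t = (if t < h then i else \<sigma> (t - h))" for t
  define u' where "u' t = (if t < h then v else u (t - h))" for t
  define x' where "x' t = (if t \<le> h then affine_flow (A i) ?c z (t - h) else x (t - h))" for t
  define ts' where "ts' l = (case l of 0 \<Rightarrow> 0 | Suc l \<Rightarrow> ts l + h)" for l
  have "continuous_on ({0..h} \<union> {h..tf + h}) x'"
    unfolding x'_def
  proof (rule continuous_on_cases)
    show "continuous_on {0..h} (\<lambda>t. affine_flow (A i) ?c z (t - h))"
      by (rule continuous_on_compose2[OF affine_flow_continuous[of UNIV]]) (auto intro!: continuous_intros)
    show "continuous_on {h..tf + h} (\<lambda>t. x (t - h))"
      by (rule continuous_on_compose2[OF cx]) (auto intro!: continuous_intros)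
  qed (use tr(2) in auto)
  moreover have "{0..h} \<union> {h..tf + h} = {0..tf + h}" using h tf by auto
  ultimately have cx': "continuous_on {0..tf + h} x'" by simp
  have pc': "\<exists>j\<in>{1..N}. (\<forall>t\<in>{ts' l..<ts' (Suc l)}. \<sigma>' t = j) \<and>
           (\<forall>r<m j. \<exists>g. continuous_on {ts' l..ts' (Suc l)} g \<and>
                        (\<forall>t\<in>{ts' l<..<ts' (Suc l)}. u' t r = g t)) \<and>
           (\<forall>t\<in>{ts' l<..<ts' (Suc l)}.
              (x' has_vector_derivative (A j *v x' t + (\<Sum>r<m j. u' t r *\<^sub>R Bc j r))) (at t))"
    if l: "l < Suc K" for l
  proof (cases l)
    case 0
    have "(x' has_vector_derivative (A i *v x' t + ?c)) (at t)" if "t \<in> {0<..<h}" for t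
    proof (rule has_vector_derivative_transform_within_open[of _ _ _ "{0<..<h}"])
      have "((affine_flow (A i) ?c z \<circ> (\<lambda>t. t - h)) has_vector_derivative
          1 *\<^sub>R (A i *v affine_flow (A i) ?c z (t - h) + ?c)) (at t)"
        by (rule vector_diff_chain_at) (auto intro!: derivative_eq_intros affine_flow_deriv)
      then show "((\<lambda>t. affine_flow (A i) ?c z (t - h)) has_vector_derivative (A i *v x' t + ?c)) (at t)"
        using that by (simp add: o_def x'_def)
    qed (use that in \<open>auto simp: x'_def\<close>)
    moreover have "\<exists>g. continuous_on {0..h} g \<and> (\<forall>t\<in>{0<..<h}. u' t r = g t)" for r
      by (rule exI[of _ "\<lambda>_. v r"]) (auto simp: u'_def)
    ultimately show ?thesis
      using i by (intro bexI[of _ i]) (auto simp: 0 ts'_def ts \<sigma>'_def u'_def)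
  next
    case (Suc k)
    then have k: "k < K" using l by simp
    have tk: "ts k \<ge> 0" using ts_nonneg k by simp
    from pc[OF k] obtain j where j: "j \<in> {1..N}" "\<forall>t\<in>{ts k..<ts (Suc k)}. \<sigma> t = j"
      "\<forall>r<m j. \<exists>g. continuous_on {ts k..ts (Suc k)} g \<and> (\<forall>t\<in>{ts k<..<ts (Suc k)}. u t r = g t)"
      and d: "\<And>t. t\<in>{ts k<..<ts (Suc k)} \<Longrightarrow>
              (x has_vector_derivative (A j *v x t + (\<Sum>r<m j. u t r *\<^sub>R Bc j r))) (at t)" by blast
    have "(x' has_vector_derivative (A j *v x' t + (\<Sum>r<m j. u' t r *\<^sub>R Bc j r))) (at t)"
      if t: "t \<in> {ts k + h<..<ts (Suc k) + h}" for t
    proof (rule has_vector_derivative_transform_within_open[of _ _ _ "{ts k + h<..<ts (Suc k) + h}"])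
      have "((x \<circ> (\<lambda>t. t - h)) has_vector_derivative
          1 *\<^sub>R (A j *v x (t - h) + (\<Sum>r<m j. u (t - h) r *\<^sub>R Bc j r))) (at t)"
        by (rule vector_diff_chain_at) (use t d in \<open>auto intro!: derivative_eq_intros\<close>)
      then show "((\<lambda>t. x (t - h)) has_vector_derivative
          (A j *v x' t + (\<Sum>r<m j. u' t r *\<^sub>R Bc j r))) (at t)"
        using t tk by (simp add: o_def x'_def u'_def)
    qed (use t tk in \<open>auto simp: x'_def\<close>)
    moreover have "\<exists>g. continuous_on {ts k + h..ts (Suc k) + h} g \<and>
        (\<forall>t\<in>{ts k + h<..<ts (Suc k) + h}. u' t r = g t)" if r: "r < m j" for r
    proof -
      from j(3) r obtain g where g: "continuous_on {ts k..ts (Suc k)} g" "\<forall>t\<in>{ts k<..<ts (Suc k)}. u t r = g t"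
        by blast
      have "continuous_on {ts k + h..ts (Suc k) + h} (\<lambda>t. g (t - h))"
        by (rule continuous_on_compose2[OF g(1)]) (auto intro!: continuous_intros)
      then show ?thesis using g(2) tk by (intro exI[of _ "\<lambda>t. g (t - h)"]) (auto simp: u'_def)
    qed
    ultimately show ?thesis
      using j tk by (intro bexI[of _ j]) (auto simp: Suc ts'_def \<sigma>'_def)
  qed
  have "ts' l < ts' (Suc l)" if "l < Suc K" for l
    using that ts(3) h by (cases l) (auto simp: ts'_def ts(1))
  then have "switched_trajectory N m A Bc (tf + h) \<sigma>' u' x'"
    unfolding switched_trajectory_def using tf h cx' pc'
    by (intro conjI exI[of _ ts'] exI[of _ "Suc K"]) (auto simp: ts'_def ts)
  moreover have "x' 0 = x0" using h x0 by (simp add: x'_def)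
  moreover have "x' (tf + h) = y" using tf h tr by (auto simp: x'_def)
  ultimately show ?case by blast
qed

definition invariant_subspace :: "nat \<Rightarrow> (nat \<Rightarrow> nat) \<Rightarrow> (nat \<Rightarrow> real^'n^'n) \<Rightarrow> (nat \<Rightarrow> nat \<Rightarrow> real^'n)
    \<Rightarrow> (real^'n) set \<Rightarrow> bool" where
  "invariant_subspace N m A Bc C \<longleftrightarrow> subspace C \<and>
     (\<forall>i\<in>{1..N}. (\<forall>x\<in>C. A i *v x \<in> C) \<and> (\<forall>r<m i. Bc i r \<in> C))"

text \<open>Only values at negative times are known to lie in \<open>D\<close>; their limit and the
  left difference quotients stay in \<open>D\<close> because a finite-dimensional subspace is
  closed.\<close>

lemma vector_derivative_in_closed_subspace:
  fixes \<phi> :: "real \<Rightarrow> 'a::euclidean_space"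
  assumes "subspace D" and "\<And>h. h > 0 \<Longrightarrow> \<phi> (- h) \<in> D" and "(\<phi> has_vector_derivative d) (at 0)"
  shows "\<phi> 0 \<in> D" and "d \<in> D"
proof -
  have cl: "closed D" using assms(1) by (rule closed_subspace)
  have c: "\<phi> \<midarrow>0\<rightarrow> \<phi> 0" using assms(3) has_vector_derivative_continuous isCont_def by blast
  have lim: "(\<lambda>n. - inverse (real (Suc n))) \<longlonglongrightarrow> 0"
    using tendsto_minus[OF LIMSEQ_inverse_real_of_nat] by simp
  have f: "filterlim (\<lambda>n. - inverse (real (Suc n))) (at 0) sequentially"
    unfolding filterlim_at using lim by (auto intro!: always_eventually)
  have "(\<lambda>n. \<phi> (- inverse (real (Suc n)))) \<longlonglongrightarrow> \<phi> 0"
    using filterlim_compose[OF c f] .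
  then show 0: "\<phi> 0 \<in> D"
    by (rule closed_sequentially[OF cl, rotated]) (use assms(2) in auto)
  have q: "(\<lambda>t. (\<phi> t - \<phi> 0) /\<^sub>R t) \<midarrow>0\<rightarrow> d"
  proof -
    have l: "(\<lambda>h. norm (\<phi> (0 + h) - \<phi> 0 - h *\<^sub>R d) / norm h) \<midarrow>0\<rightarrow> 0"
      using assms(3) unfolding has_vector_derivative_def has_derivative_at by blast
    have e: "norm (\<phi> (0 + h) - \<phi> 0 - h *\<^sub>R d) / norm h = norm ((\<phi> h - \<phi> 0) /\<^sub>R h - d)" if "h \<noteq> 0" for h
    proof -
      have "\<phi> (0 + h) - \<phi> 0 - h *\<^sub>R d = h *\<^sub>R ((\<phi> h - \<phi> 0) /\<^sub>R h - d)"
        using that by (simp add: scaleR_diff_right)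
      then show ?thesis using that by (simp only: norm_scaleR) simp
    qed
    have "(\<lambda>h. norm ((\<phi> h - \<phi> 0) /\<^sub>R h - d)) \<midarrow>0\<rightarrow> 0"
      by (rule Lim_transform_eventually[OF l])
         (use e in \<open>auto simp: eventually_at_filter intro!: always_eventually\<close>)
    then show ?thesis by (simp add: tendsto_norm_zero_iff LIM_zero_iff)
  qed
  have "(\<lambda>n. (\<phi> (- inverse (real (Suc n))) - \<phi> 0) /\<^sub>R (- inverse (real (Suc n)))) \<longlonglongrightarrow> d"
    using filterlim_compose[OF q f] .
  then show "d \<in> D"
  proof (rule closed_sequentially[OF cl, rotated])
    fix n
    show "(\<phi> (- inverse (real (Suc n))) - \<phi> 0) /\<^sub>R (- inverse (real (Suc n))) \<in> D"
      by (intro subspace_scale subspace_diff assms 0) auto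
  qed
qed

text \<open>
  A schedule \<open>s\<close> for which the subspace of states steered to 0 has maximal dimension cannot be
  improved by running \<open>s\<close>, another piece and \<open>s\<close> again; letting the duration of the inserted piece
  tend to 0 gives invariance.
\<close>

lemma not_controllable_imp_invariant_subspace:
  assumes "\<not> switched_controllable N m A Bc"
  shows "\<exists>C. invariant_subspace N m A Bc C \<and> C \<noteq> UNIV"
proof -
  let ?S = "{s :: (nat \<times> real) list. \<forall>p\<in>set s. fst p \<in> {1..N} \<and> snd p > 0}"
  let ?C = "\<lambda>s. {x. steers m A Bc s x 0}"
  have sub: "subspace (?C s)" for s
    using steers_add[of m A Bc s _ 0 _ 0] steers_scaleR[of m A Bc s _ 0] steers_zero
    by (auto simp: subspace_def)
  have "\<exists>s. s \<in> ?S \<and> (\<forall>s'. s' \<in> ?S \<longrightarrow> dim (?C s') \<le> dim (?C s))"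
    by (rule ex_has_greatest_nat[of "\<lambda>s. s \<in> ?S" "[]" _ "Suc (CARD('a))"])
       (use dim_subset_UNIV_cart in \<open>auto simp: less_Suc_eq_le\<close>)
  then obtain s where s: "s \<in> ?S" and max: "\<And>s'. s' \<in> ?S \<Longrightarrow> dim (?C s') \<le> dim (?C s)" by blast
  let ?D = "{y. steers m A Bc s 0 y}"
  have subD: "subspace ?D"
    using steers_add[of m A Bc s 0 _ 0] steers_scaleR[of m A Bc s 0] steers_zero
    by (auto simp: subspace_def)
  have inD: "affine_flow (A i) (\<Sum>r<m i. u r *\<^sub>R Bc i r) z (- h) \<in> ?D"
    if "i \<in> {1..N}" "h > 0" "z \<in> ?C s" for i h u z
  proof -
    let ?y = "affine_flow (A i) (\<Sum>r<m i. u r *\<^sub>R Bc i r) z (- h)"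
    let ?s = "s @ (i, h) # s"
    \<comment> \<open>\<open>s\<close> carries \<open>\<Psi> y\<close> freely to \<open>y\<close>,
      the inserted piece carries \<open>y\<close> to \<open>z\<close>, and \<open>s\<close> carries
      \<open>z\<close> to 0. So \<open>\<Psi> y\<close> lies in the enlarged subspace, which equals
      \<open>?C s\<close> by maximality. Thus \<open>s\<close> steers \<open>\<Psi> y\<close> both
      to \<open>y\<close> and to 0, and the difference of these motions leads from 0 to
      \<open>y\<close>.\<close>
    obtain \<Psi> where \<Psi>: "\<And>y. steers m A Bc s (\<Psi> y) y" using steers_free_motion by blast
    have "steers m A Bc ((i, h) # s) ?y 0" using that(3) by auto
    then have "\<Psi> ?y \<in> ?C ?s" unfolding mem_Collect_eq steers_append using \<Psi> by blast
    moreover have "?C s = ?C ?s"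
    proof (rule subspace_dim_equal[OF sub sub])
      show "?C s \<subseteq> ?C ?s" using steers_append steers_zero by blast
      show "dim (?C ?s) \<le> dim (?C s)" using s that by (intro max) auto
    qed
    ultimately have "steers m A Bc s (\<Psi> ?y) 0" by blast
    with \<Psi>[of ?y] steers_diff[of m A Bc s "\<Psi> ?y" ?y "\<Psi> ?y" 0] show ?thesis by simp
  qed
  \<comment> \<open>Subtracting a motion from 0 to \<open>y\<close> from the free motion shows that
    \<open>\<Psi>\<close> maps \<open>?D\<close> into \<open>?C s\<close>. The inclusion of
    \<open>?C s\<close> in \<open>?D\<close>, obtained from short pieces, then makes the two
    subspaces equal.\<close>
  have dimD: "dim ?D \<le> dim (?C s)"
  proof -
    obtain \<Psi> where \<Psi>: "linear \<Psi>" "\<And>y. \<Psi> y = 0 \<Longrightarrow> y = 0" "\<And>y. steers m A Bc s (\<Psi> y) y"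
      using steers_free_motion[of m A Bc s] by blast
    have "inj \<Psi>" using \<Psi>(1,2) linear_injective_0 by blast
    then have "dim (\<Psi> ` ?D) = dim ?D" using \<Psi>(1) by (intro dim_image_eq) (auto intro: inj_on_subset)
    moreover have "\<Psi> ` ?D \<subseteq> ?C s"
    proof clarify
      fix y assume "steers m A Bc s 0 y"
      from steers_diff[OF \<Psi>(3)[of y] this] show "steers m A Bc s (\<Psi> y) 0" by simp
    qed
    ultimately show ?thesis by (metis dim_subset)
  qed
  have lim: "z \<in> ?D \<and> A i *v z + (\<Sum>r<m i. u r *\<^sub>R Bc i r) \<in> ?D"
    if "i \<in> {1..N}" "z \<in> ?C s" for i z u
    using vector_derivative_in_closed_subspace[OF subD inD[OF that(1) _ that(2)] affine_flow_deriv] by simp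
  have "invariant_subspace N m A Bc (?C s)"
    unfolding invariant_subspace_def
  proof (intro conjI ballI allI impI)
    show "subspace (?C s)" by (rule sub)
  next
    fix i x assume i: "i \<in> {1..N}" and x: "x \<in> ?C s"
    have "?C s = ?D" using lim[OF i] by (intro subspace_dim_equal[OF sub subD _ dimD]) blast
    with lim[OF i x, of "\<lambda>_. 0"] show "A i *v x \<in> ?C s" by simp
  next
    fix i r assume i: "i \<in> {1..N}" and r: "r < m i"
    have "?C s = ?D" using lim[OF i] by (intro subspace_dim_equal[OF sub subD _ dimD]) blast
    moreover have "(\<Sum>k<m i. (if k = r then 1 else 0) *\<^sub>R Bc i k) = Bc i r"
      using r by (simp add: if_distrib[of "\<lambda>c. c *\<^sub>R _"] cong: if_cong)
    moreover have "0 \<in> ?C s" using steers_zero by blast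
    ultimately show "Bc i r \<in> ?C s"
      using lim[OF i, of 0 "\<lambda>k. if k = r then 1 else 0"] by simp
  qed
  moreover have "?C s \<noteq> UNIV"
  proof
    assume "?C s = UNIV"
    then have "steers m A Bc s x0 0" for x0 by blast
    with s have "controllable_state N m A Bc x0" for x0
      unfolding controllable_state_def by (intro steers_imp_trajectory) auto
    with assms show False by (simp add: switched_controllable_def)
  qed
  ultimately show ?thesis by blast
qed

section \<open>Necessity\<close>

text \<open>The bound, uniform in \<open>w\<close>, says that the part of the state seen by
  \<open>F\<close> moves independently of the inputs and of the rest. Zero therefore propagates
  backwards from the last piece; \<open>d\<close> counts pieces from the end.\<close>

lemma trajectory_zero_backward:
  fixes F :: "real^'n \<Rightarrow> 'b::real_inner"
  assumes tr: "switched_trajectory N m A Bc tf \<sigma> u x" and F: "bounded_linear F"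
    and K: "\<And>i. i \<in> {1..N} \<Longrightarrow> \<exists>K. \<forall>v w. norm (F (A i *v v + (\<Sum>r<m i. w r *\<^sub>R Bc i r))) \<le> K * norm (F v)"
    and zero: "F (x tf) = 0"
  shows "F (x 0) = 0"
proof -
  from tr obtain ts n where cx: "continuous_on {0..tf} x"
    and ts: "ts 0 = 0" "ts n = tf" "\<And>l. l < n \<Longrightarrow> ts l < ts (Suc l)"
    and "\<And>l. l < n \<Longrightarrow> \<exists>i\<in>{1..N}. (\<forall>t\<in>{ts l..<ts (Suc l)}. \<sigma> t = i) \<and>
           (\<forall>r<m i. \<exists>g. continuous_on {ts l..ts (Suc l)} g \<and>
                        (\<forall>t\<in>{ts l<..<ts (Suc l)}. u t r = g t)) \<and>
           (\<forall>t\<in>{ts l<..<ts (Suc l)}.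
              (x has_vector_derivative (A i *v x t + (\<Sum>r<m i. u t r *\<^sub>R Bc i r))) (at t))"
    unfolding switched_trajectory_def by blast
  then have pc: "\<And>l. l < n \<Longrightarrow> \<exists>i\<in>{1..N}. \<forall>t\<in>{ts l<..<ts (Suc l)}.
              (x has_vector_derivative (A i *v x t + (\<Sum>r<m i. u t r *\<^sub>R Bc i r))) (at t)"
    by blast
  have lo: "l \<le> n \<Longrightarrow> 0 \<le> ts l" for l
  proof (induction l)
    case (Suc l) then show ?case using ts(3)[of l] by simp
  qed (simp add: ts)
  have hi: "ts (n - d) \<le> tf" if "d \<le> n" for d
    using that
  proof (induction d)
    case (Suc d)
    then have "Suc (n - Suc d) = n - d" "ts (n - d) \<le> tf" by auto
    then show ?case using ts(3)[of "n - Suc d"] Suc by force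
  qed (simp add: ts)
  have "F (x (ts (n - d))) = 0" if "d \<le> n" for d
    using that
  proof (induction d)
    case (Suc d)
    let ?l = "n - Suc d"
    have l: "?l < n" "Suc ?l = n - d" using Suc.prems by auto
    from pc[OF l(1)] obtain i where i: "i \<in> {1..N}" and der: "\<And>t. t\<in>{ts ?l<..<ts (Suc ?l)} \<Longrightarrow>
        (x has_vector_derivative (A i *v x t + (\<Sum>r<m i. u t r *\<^sub>R Bc i r))) (at t)" by blast
    from K[OF i] obtain k where k: "\<And>v w. norm (F (A i *v v + (\<Sum>r<m i. w r *\<^sub>R Bc i r))) \<le> k * norm (F v)" by blast
    have "F (x (ts ?l)) = 0 \<longleftrightarrow> F (x (ts (Suc ?l))) = 0"
    proof (rule linear_growth_zero_iff[where K = k])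
      show "ts ?l \<le> ts (Suc ?l)" using ts(3)[OF l(1)] by simp
      have "{ts ?l..ts (Suc ?l)} \<subseteq> {0..tf}" using lo[of ?l] hi[of d] Suc.prems by (auto simp: l(2))
      then show "continuous_on {ts ?l..ts (Suc ?l)} (\<lambda>t. F (x t))"
        by (intro bounded_linear.continuous_on[OF F] continuous_on_subset[OF cx])
      fix t assume "ts ?l < t" "t < ts (Suc ?l)"
      then have "(x has_vector_derivative (A i *v x t + (\<Sum>r<m i. u t r *\<^sub>R Bc i r))) (at t)" using der by simp
      from bounded_linear.has_vector_derivative[OF F this] k[of "x t" "u t"]
      show "\<exists>D. ((\<lambda>t. F (x t)) has_vector_derivative D) (at t) \<and> norm D \<le> k * norm (F (x t))" by blast
    qed
    with Suc show ?case by (simp add: l(2))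
  qed (simp add: ts zero)
  from this[of n] show ?thesis by (simp add: ts)
qed

text \<open>Every state starts a trajectory that ends at 0. With a covector or a coordinate
  projection as \<open>F\<close>, this yields the two necessary conditions.\<close>

lemma controllable_imp_zero_functional:
  fixes F :: "real^'n \<Rightarrow> 'b::real_inner"
  assumes "switched_controllable N m A Bc" and "bounded_linear F"
    and "\<And>i. i \<in> {1..N} \<Longrightarrow> \<exists>K. \<forall>v w. norm (F (A i *v v + (\<Sum>r<m i. w r *\<^sub>R Bc i r))) \<le> K * norm (F v)"
  shows "F x = 0"
proof -
  obtain tf \<sigma> u y where y: "switched_trajectory N m A Bc tf \<sigma> u y" "y 0 = x" "y tf = 0"
    using assms(1) unfolding switched_controllable_def controllable_state_def by blast
  have "F (y tf) = 0" by (simp add: y linear_0 bounded_linear.linear assms(2))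
  from trajectory_zero_backward[OF y(1) assms(2,3) this] y(2) show ?thesis by simp
qed

section \<open>Full rank and input reachability as necessary conditions\<close>

lemma concat_rank_le: "concat_rank N m A (Bc :: nat \<Rightarrow> nat \<Rightarrow> real^'n) \<le> CARD('n)"
  unfolding concat_rank_def by (rule dim_subset_UNIV_cart)

lemma concat_rank_eq_card_iff:
  "concat_rank N m A (Bc :: nat \<Rightarrow> nat \<Rightarrow> real^'n) = CARD('n) \<longleftrightarrow> span (concat_columns N m A Bc) = UNIV"
  unfolding concat_rank_def using dim_eq_full[of "concat_columns N m A Bc"] by simp

lemma grank_eq_card_iff:
  fixes PA :: "nat \<Rightarrow> 'n::finite \<Rightarrow> 'n \<Rightarrow> bool"
  shows "grank N m PA PB = CARD('n) \<longleftrightarrow>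
    (\<exists>A Bc. realization N m PA PB A Bc \<and> span (concat_columns N m A Bc) = UNIV)"
proof -
  let ?S = "{concat_rank N m A Bc | A Bc. realization N m PA PB A Bc}"
  have fin: "finite ?S" by (rule finite_subset[of _ "{..CARD('n)}"]) (auto simp: concat_rank_le)
  have "realization N m PA PB (\<lambda>_. 0) (\<lambda>_ _. 0)" by (simp add: realization_def)
  then have ne: "?S \<noteq> {}" by blast
  have "Max ?S = CARD('n) \<longleftrightarrow> CARD('n) \<in> ?S"
  proof
    assume "Max ?S = CARD('n)" then show "CARD('n) \<in> ?S" using Max_in[OF fin ne] by simp
  next
    assume "CARD('n) \<in> ?S" then show "Max ?S = CARD('n)"
      by (intro Max_eqI[OF fin]) (use concat_rank_le in blast)+
  qed
  also have "\<dots> \<longleftrightarrow> (\<exists>A Bc. realization N m PA PB A Bc \<and> span (concat_columns N m A Bc) = UNIV)"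
    unfolding concat_rank_eq_card_iff[symmetric] mem_Collect_eq by metis
  finally show ?thesis by (simp add: grank_def)
qed

lemma controllable_imp_full_rank:
  assumes "switched_controllable N m A (Bc :: nat \<Rightarrow> nat \<Rightarrow> real^'n)"
  shows "span (concat_columns N m A Bc) = UNIV"
proof (rule ccontr)
  assume "span (concat_columns N m A Bc) \<noteq> UNIV"
  then obtain q where q: "q \<noteq> 0" "\<And>y. y \<in> span (concat_columns N m A Bc) \<Longrightarrow> orthogonal q y"
    using orthogonal_to_subspace_exists_gen[of "concat_columns N m A Bc" UNIV] by auto
  have "q \<bullet> (A i *v v + (\<Sum>r<m i. w r *\<^sub>R Bc i r)) = 0" if "i \<in> {1..N}" for i v w
  proof -
    have "q \<bullet> column k (A i) = 0" for k
      using q(2)[OF span_base] that unfolding concat_columns_def orthogonal_def by blast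
    moreover have "q \<bullet> Bc i r = 0" if "r < m i" for r
      using q(2)[OF span_base] that \<open>i \<in> {1..N}\<close> unfolding concat_columns_def orthogonal_def by blast
    ultimately show ?thesis
      by (simp add: matrix_mult_sum inner_add_right inner_sum_right scalar_mult_eq_scaleR)
  qed
  then have "q \<bullet> q = 0"
    by (intro controllable_imp_zero_functional[OF assms, of "\<lambda>x. q \<bullet> x"])
       (auto intro: bounded_linear_inner_right exI[of _ 0])
  with q(1) show False by simp
qed

lemma input_reachable_state_edge:
  assumes "(SV k, SV j, i) \<in> Gc_edges N m PA PB" and "input_reachable N m PA PB k"
  shows "input_reachable N m PA PB j"
proof -
  let ?E = "{(etail e, ehead e) | e. e \<in> Gc_edges N m PA PB}"
  have "(SV k, SV j) \<in> ?E"
    using assms(1) by (intro CollectI exI[of _ "(SV k, SV j, i)"]) (simp add: etail_def ehead_def)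
  moreover obtain v where v: "is_input v" "v \<in> Gc_vertices N m" "(v, SV k) \<in> ?E\<^sup>+"
    using assms(2) unfolding input_reachable_def by blast
  ultimately have "(v, SV j) \<in> ?E\<^sup>+" by (intro trancl_into_trancl[OF v(3)])
  with v(1,2) show ?thesis unfolding input_reachable_def by blast
qed

lemma input_reachable_input_edge:
  assumes "(IV c r, SV j, i) \<in> Gc_edges N m PA PB"
  shows "input_reachable N m PA PB j"
proof -
  let ?E = "{(etail e, ehead e) | e. e \<in> Gc_edges N m PA PB}"
  have "(IV c r, SV j) \<in> ?E\<^sup>+"
    using assms by (intro r_into_trancl CollectI exI[of _ "(IV c r, SV j, i)"]) (simp add: etail_def ehead_def)
  moreover have "IV c r \<in> Gc_vertices N m" using assms by (auto simp: Gc_edges_def Gc_vertices_def)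
  ultimately show ?thesis unfolding input_reachable_def by (intro exI[of _ "IV c r"]) simp
qed

lemma controllable_imp_input_reachable:
  fixes PA :: "nat \<Rightarrow> 'n::finite \<Rightarrow> 'n \<Rightarrow> bool"
  assumes real: "realization N m PA PB A Bc" and "switched_controllable N m A Bc"
  shows "input_reachable N m PA PB j"
proof -
  let ?U = "{j. \<not> input_reachable N m PA PB j}"
  \<comment> \<open>\<open>F\<close> keeps the unreachable coordinates. A nonzero entry leading into
    one of them from a reachable state or an input would be an edge making it reachable, so
    \<open>F\<close> of the velocity depends on \<open>F v\<close> alone.\<close>
  define F :: "real^'n \<Rightarrow> real^'n" where "F v = (\<chi> j. if j \<in> ?U then v $ j else 0)" for v
  have lin: "linear F" by (rule linearI) (auto simp: F_def vec_eq_iff)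
  have Fle: "norm (F v) \<le> norm v" for v
    by (rule norm_le_componentwise_cart) (simp add: F_def)
  have Fcong: "(\<And>j. j \<in> ?U \<Longrightarrow> v $ j = w $ j) \<Longrightarrow> F v = F w" for v w
    by (auto simp: F_def vec_eq_iff)
  have A0: "A i $ j $ k = 0" if "i \<in> {1..N}" "j \<in> ?U" "k \<notin> ?U" for i j k
  proof (rule ccontr)
    assume "A i $ j $ k \<noteq> 0"
    then have "PA i j k" using real that(1) unfolding realization_def by blast
    then have "(SV k, SV j, i) \<in> Gc_edges N m PA PB" using that(1) by (auto simp: Gc_edges_def)
    from input_reachable_state_edge[OF this] that(2,3) show False by simp
  qed
  have B0: "Bc i r $ j = 0" if "i \<in> {1..N}" "j \<in> ?U" "r < m i" for i j r
  proof (rule ccontr)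
    assume "Bc i r $ j \<noteq> 0"
    then have "PB i j r" using real that(1,3) unfolding realization_def by blast
    then have "(IV i r, SV j, i) \<in> Gc_edges N m PA PB" using that by (auto simp: Gc_edges_def)
    from input_reachable_input_edge[OF this] that(2) show False by simp
  qed
  have eq: "F (A i *v v + (\<Sum>r<m i. w r *\<^sub>R Bc i r)) = F (A i *v F v)" if i: "i \<in> {1..N}" for i v w
  proof -
    have "(A i *v v + (\<Sum>r<m i. w r *\<^sub>R Bc i r)) $ j = (A i *v F v) $ j" if "j \<in> ?U" for j
    proof -
      have "(\<Sum>k\<in>UNIV. A i $ j $ k * v $ k) = (\<Sum>k\<in>UNIV. A i $ j $ k * F v $ k)"
        using A0[OF i that] by (intro sum.cong) (auto simp: F_def)
      moreover have "(\<Sum>r<m i. w r *\<^sub>R Bc i r) $ j = 0"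
        using B0[OF i that] by (simp add: sum_component)
      ultimately show ?thesis by (simp add: matrix_vector_mult_def)
    qed
    then show ?thesis by (rule Fcong)
  qed
  have "F x = 0" for x
  proof (rule controllable_imp_zero_functional[where F = F, OF assms(2)])
    show "bounded_linear F" using lin linear_conv_bounded_linear by blast
    fix i assume i: "i \<in> {1..N}"
    obtain K where K: "\<And>x. norm (A i *v x) \<le> norm x * K"
      using bounded_linear.pos_bounded[OF matrix_vector_mul_bounded_linear[of "A i"]] by blast
    have "norm (F (A i *v v + (\<Sum>r<m i. w r *\<^sub>R Bc i r))) \<le> K * norm (F v)" for v w
      unfolding eq[OF i] using order_trans[OF Fle K] by (simp add: mult.commute)
    then show "\<exists>K. \<forall>v w. norm (F (A i *v v + (\<Sum>r<m i. w r *\<^sub>R Bc i r))) \<le> K * norm (F v)" by blast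
  qed
  then have "F (axis j 1) $ j = 0" by simp
  moreover have "F (axis j 1) $ j = 1" if "\<not> input_reachable N m PA PB j"
    using that by (simp add: F_def)
  ultimately show ?thesis by force
qed

section \<open>Matchings and covers by stems and buds\<close>

text \<open>\<open>f j\<close> is the tail and colour of the edge chosen into state
  \<open>j\<close>. One edge per head makes heads distinct, and \<open>inj f\<close> says that edges
  with the same tail differ in colour: together this is S-disjointness.\<close>

definition matching :: "nat \<Rightarrow> (nat \<Rightarrow> nat) \<Rightarrow> (nat \<Rightarrow> 'n \<Rightarrow> 'n \<Rightarrow> bool) \<Rightarrow> (nat \<Rightarrow> 'n \<Rightarrow> nat \<Rightarrow> bool)
    \<Rightarrow> ('n \<Rightarrow> 'n vtx \<times> nat) \<Rightarrow> bool" where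
  "matching N m PA PB f \<longleftrightarrow> inj f \<and> (\<forall>j. (fst (f j), SV j, snd (f j)) \<in> Gc_edges N m PA PB)"

lemma matching_cases:
  assumes "matching N m PA PB f"
  obtains (state) k i where "f j = (SV k, i)" "i \<in> {1..N}" "PA i j k"
    | (input) r i where "f j = (IV i r, i)" "i \<in> {1..N}" "r < m i" "PB i j r"
proof -
  have "(fst (f j), SV j, snd (f j)) \<in> Gc_edges N m PA PB" using assms by (simp add: matching_def)
  then show thesis using that by (cases "f j") (auto simp: Gc_edges_def)
qed

lemma full_rank_imp_matching:
  fixes PA :: "nat \<Rightarrow> 'n::finite \<Rightarrow> 'n \<Rightarrow> bool"
  assumes real: "realization N m PA PB A Bc" and full: "span (concat_columns N m A Bc) = UNIV"
  shows "\<exists>f. matching N m PA PB f"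
proof -
  obtain Bs where Bs: "Bs \<subseteq> concat_columns N m A Bc" "independent Bs"
    "concat_columns N m A Bc \<subseteq> span Bs" "card Bs = dim (concat_columns N m A Bc)"
    using basis_exists by blast
  have "span (concat_columns N m A Bc) \<subseteq> span Bs" by (rule span_minimal[OF Bs(3) subspace_span])
  then have spanBs: "span Bs = UNIV" using full by auto
  have "dim (span (concat_columns N m A Bc)) = CARD('n)" unfolding full by (simp add: dim_UNIV)
  then have "card Bs = card (UNIV :: 'n set)" using Bs(4) by simp
  then obtain e :: "'n \<Rightarrow> real^'n" where e: "bij_betw e UNIV Bs"
    using finite_same_card_bij[of "UNIV :: 'n set" Bs] independent_imp_finite[OF Bs(2)] by auto
  define X :: "real^'n^'n" where "X = (\<chi> j k. e k $ j)"
  have "column k X = e k" for k by (simp add: column_def X_def)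
  then have "columns X = range e" by (auto simp: columns_def)
  then have "columns X = Bs" using e by (simp add: bij_betw_def)
  then have "\<exists>Y. X ** Y = mat 1" by (simp add: matrix_right_invertible_span_columns span_vec_eq spanBs)
  then have "det X \<noteq> 0" by (simp add: invertible_right_inverse flip: invertible_det_nz)
  then have "\<exists>p. p permutes (UNIV :: 'n set) \<and> (\<Prod>i\<in>UNIV. X $ i $ p i) \<noteq> 0"
    unfolding det_def by (rule contrapos_np) (auto intro!: sum.neutral)
  then obtain p where p: "p permutes (UNIV :: 'n set)" "(\<Prod>i\<in>UNIV. X $ i $ p i) \<noteq> 0" by blast
  have nz: "e (p j) $ j \<noteq> 0" for j using p(2) by (auto simp: X_def)
  define val :: "'n vtx \<times> nat \<Rightarrow> real^'n" where
    "val t = (case fst t of SV k \<Rightarrow> column k (A (snd t)) | IV a r \<Rightarrow> Bc (snd t) r)" for t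
  have "\<exists>t. val t = e (p j) \<and> (fst t, SV j, snd t) \<in> Gc_edges N m PA PB" for j
  proof -
    have "e (p j) \<in> concat_columns N m A Bc" using e Bs(1) by (auto simp: bij_betw_def)
    then consider i k where "i \<in> {1..N}" "e (p j) = column k (A i)"
      | i r where "i \<in> {1..N}" "r < m i" "e (p j) = Bc i r"
      unfolding concat_columns_def by blast
    then show ?thesis
    proof cases
      case 1
      then have "A i $ j $ k \<noteq> 0" using nz[of j] by (simp add: column_def)
      then have "PA i j k" using real 1(1) unfolding realization_def by blast
      then show ?thesis using 1 by (intro exI[of _ "(SV k, i)"]) (auto simp: val_def Gc_edges_def)
    next
      case 2
      then have "Bc i r $ j \<noteq> 0" using nz[of j] by simp
      then have "PB i j r" using real 2(1,2) unfolding realization_def by blast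
      then show ?thesis using 2 by (intro exI[of _ "(IV i r, i)"]) (auto simp: val_def Gc_edges_def)
    qed
  qed
  then have "\<exists>f. \<forall>j. val (f j) = e (p j) \<and> (fst (f j), SV j, snd (f j)) \<in> Gc_edges N m PA PB"
    by (intro choice allI)
  then obtain f where f: "\<And>j. val (f j) = e (p j)" "\<And>j. (fst (f j), SV j, snd (f j)) \<in> Gc_edges N m PA PB"
    by blast
  \<comment> \<open>Different pairs may name equal columns; injectivity comes from the basis columns
    \<open>e (p j)\<close>, which are distinct for distinct \<open>j\<close>.\<close>
  have "inj f"
  proof
    fix j k assume "f j = f k"
    then have "e (p j) = e (p k)" using f(1) by metis
    then have "p j = p k" using e by (auto simp: bij_betw_def inj_on_def)
    then show "j = k" using permutes_inj[OF p(1)] by (auto simp: inj_on_def)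
  qed
  with f(2) show ?thesis unfolding matching_def by blast
qed

text \<open>With weight 1 on the chosen edges and 0 elsewhere, injectivity leaves the column named
  by \<open>f j\<close> a single nonzero entry, in row \<open>j\<close>; so every unit vector is a
  column.\<close>

lemma matching_imp_full_rank:
  fixes PA :: "nat \<Rightarrow> 'n::finite \<Rightarrow> 'n \<Rightarrow> bool"
  assumes f: "matching N m PA PB f"
  shows "\<exists>A Bc. realization N m PA PB A Bc \<and> span (concat_columns N m A Bc) = UNIV"
proof -
  define A :: "nat \<Rightarrow> real^'n^'n" where "A i = (\<chi> j k. if f j = (SV k, i) then 1 else 0)" for i
  define Bc :: "nat \<Rightarrow> nat \<Rightarrow> real^'n" where "Bc i r = (\<chi> j. if f j = (IV i r, i) then 1 else 0)" for i r
  have inj: "f j = f k \<longleftrightarrow> j = k" for j k using f by (auto simp: matching_def inj_on_def)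
  have "PA i j k" if "i \<in> {1..N}" "A i $ j $ k \<noteq> 0" for i j k
    using that by (cases rule: matching_cases[OF f, of j]) (auto simp: A_def split: if_splits)
  moreover have "PB i j k" if "i \<in> {1..N}" "Bc i k $ j \<noteq> 0" for i j k
    using that by (cases rule: matching_cases[OF f, of j]) (auto simp: Bc_def split: if_splits)
  ultimately have "realization N m PA PB A Bc" unfolding realization_def by blast
  moreover have "axis j 1 \<in> concat_columns N m A Bc" for j
    using f
  proof (cases rule: matching_cases[where j = j])
    case (state k i)
    then have "axis j 1 = column k (A i)"
      by (simp add: vec_eq_iff column_def A_def axis_def inj flip: state(1))
    then show ?thesis using state unfolding concat_columns_def by blast
  next
    case (input r i)
    then have "axis j 1 = Bc i r"
      by (simp add: vec_eq_iff Bc_def axis_def inj flip: input(1))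
    then show ?thesis using input unfolding concat_columns_def by blast
  qed
  then have "Basis \<subseteq> concat_columns N m A Bc" by (auto simp: Basis_vec_def)
  then have "span (concat_columns N m A Bc) = UNIV" by (metis span_Basis span_mono top.extremum_uniqueI)
  ultimately show ?thesis by blast
qed

text \<open>\<open>p\<close> runs against the edges, from head to tail, so the closed walk lists the
  orbit of \<open>c\<close> in reverse order. Taking the least period \<open>M\<close> makes the
  tails distinct.\<close>

lemma cycle_in_orbit:
  fixes e :: "'n \<Rightarrow> 'n cedge"
  assumes per: "(p ^^ L) c = c" "L > 0"
    and e: "\<And>k. e ((p ^^ k) c) \<in> Es" "\<And>k. ehead (e ((p ^^ k) c)) = SV ((p ^^ k) c)"
      "\<And>k. etail (e ((p ^^ k) c)) = SV ((p ^^ Suc k) c)"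
  shows "cycle_in Es (range (\<lambda>k. e ((p ^^ k) c)))"
proof -
  define M where "M = (LEAST L. (p ^^ L) c = c \<and> L > 0)"
  have M: "(p ^^ M) c = c" "M > 0" using LeastI[of "\<lambda>L. (p ^^ L) c = c \<and> L > 0" L] per by (auto simp: M_def)
  have min: "(p ^^ d) c \<noteq> c" if "d < M" "d > 0" for d
    using not_less_Least[of d "\<lambda>L. (p ^^ L) c = c \<and> L > 0"] that by (auto simp: M_def)
  \<comment> \<open>Exponents run from 1 to \<open>M\<close>, because the tail of edge number
    \<open>l\<close> of the list is the \<open>(M - l)\<close>-th iterate.\<close>
  have inj: "a = b" if "(p ^^ a) c = (p ^^ b) c" "1 \<le> a" "a \<le> b" "b \<le> M" for a b
  proof (rule ccontr)
    assume "a \<noteq> b"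
    then have ab: "a < b" using that by simp
    have "(p ^^ (b - a)) c = (p ^^ (b - a)) ((p ^^ M) c)" by (simp add: M)
    also have "\<dots> = (p ^^ (M - a)) ((p ^^ b) c)"
      using ab that by (simp add: funpow_add[THEN fun_cong, unfolded o_apply, symmetric] add.commute)
    also have "\<dots> = (p ^^ (M - a)) ((p ^^ a) c)" by (simp add: that(1))
    also have "\<dots> = (p ^^ M) c"
      using ab that(4) by (simp add: funpow_add[THEN fun_cong, unfolded o_apply, symmetric])
    finally show False using min[of "b - a"] ab that M(1) by auto
  qed
  define es where "es = map (\<lambda>l. e ((p ^^ (M - 1 - l)) c)) [0..<M]"
  have len: "length es = M" by (simp add: es_def)
  have tail: "etail (es ! l) = SV ((p ^^ (M - l)) c)" if "l < M" for l
    using that e(3)[of "M - Suc l"] Suc_diff_Suc[OF that] by (simp add: es_def del: funpow.simps)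
  have head: "ehead (es ! l) = SV ((p ^^ (M - 1 - l)) c)" if "l < M" for l
    using that e(2) by (simp add: es_def)
  have setes: "set es = range (\<lambda>k. e ((p ^^ k) c))"
  proof
    show "range (\<lambda>k. e ((p ^^ k) c)) \<subseteq> set es"
    proof (rule image_subsetI)
      fix k
      have "(p ^^ k) c = (p ^^ (k mod M)) c" using funpow_mod_eq[OF M(1)] by metis
      moreover have "k mod M < M" using M(2) by simp
      ultimately show "e ((p ^^ k) c) \<in> set es"
        by (auto simp: es_def image_iff intro!: bexI[of _ "M - 1 - k mod M"])
    qed
  qed (auto simp: es_def)
  have "distinct (map etail es)"
    unfolding distinct_conv_nth
  proof (intro allI impI)
    fix a b assume ab: "a < length (map etail es)" "b < length (map etail es)" "a \<noteq> b"
    show "map etail es ! a \<noteq> map etail es ! b"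
    proof
      assume "map etail es ! a = map etail es ! b"
      then have eq: "(p ^^ (M - a)) c = (p ^^ (M - b)) c" using ab tail by (simp add: len)
      have "M - a = M - b"
      proof (cases "a \<le> b")
        case True
        have "M - b = M - a" by (rule inj[OF eq[symmetric]]) (use ab True in \<open>auto simp: len\<close>)
        then show ?thesis by simp
      next
        case False
        show ?thesis by (rule inj[OF eq]) (use ab False in \<open>auto simp: len\<close>)
      qed
      then show False using ab by (simp add: len)
    qed
  qed
  moreover have "ehead (es ! l) = etail (es ! Suc l)" if "Suc l < length es" for l
    using that head[of l] tail[of "Suc l"] by (simp add: len)
  moreover have ne: "es \<noteq> []" using M(2) len by force
  moreover have "ehead (last es) = etail (hd es)"
    using M head[of "M - 1"] tail[of 0] ne by (simp add: last_conv_nth hd_conv_nth len)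
  ultimately show ?thesis unfolding cycle_in_def using setes e(1)
    by (intro exI[of _ es]) auto
qed

text \<open>When \<open>P\<close> sends each head to its tail, a step of \<open>P\<close> is a step
  back in the cyclic list, that is, adding \<open>length es - 1\<close> modulo
  \<open>length es\<close>. So all heads share a period under \<open>P\<close>, which is the key to
  excluding or identifying cycles.\<close>

lemma cycle_in_heads:
  assumes cyc: "cycle_in Es C" and P: "\<And>e. e \<in> Es \<Longrightarrow> P (ehead e) = etail e"
  shows "C \<noteq> {}" and "C \<subseteq> Es"
    and "\<exists>n>0. \<forall>w\<in>ehead ` C. (P ^^ n) w = w \<and> P w \<in> ehead ` C"
proof -
  from cyc obtain es where es: "es \<noteq> []" "set es = C" "set es \<subseteq> Es"
    "\<And>l. Suc l < length es \<Longrightarrow> ehead (es ! l) = etail (es ! Suc l)" "ehead (last es) = etail (hd es)"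
    unfolding cycle_in_def by blast
  let ?n = "length es"
  let ?h = "\<lambda>l. ehead (es ! l)"
  have n: "?n > 0" using es(1) by simp
  have step: "P (?h l) = ?h ((l + (?n - 1)) mod ?n)" if "l < ?n" for l
  proof (cases l)
    case 0
    have "P (?h 0) = etail (es ! 0)" using P es(3) n nth_mem by blast
    then show ?thesis using es(1,5) 0 by (simp add: last_conv_nth hd_conv_nth)
  next
    case (Suc k)
    have "P (?h l) = etail (es ! l)" using P es(3) that nth_mem by blast
    moreover have "l + (?n - 1) = k + ?n" using Suc that by simp
    then have "(l + (?n - 1)) mod ?n = k" using Suc that by simp
    ultimately show ?thesis using es(4)[of k] Suc that by simp
  qed
  have pow: "(P ^^ d) (?h l) = ?h ((l + d * (?n - 1)) mod ?n)" if "l < ?n" for l d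
  proof (induction d)
    case (Suc d)
    have "(P ^^ Suc d) (?h l) = P (?h ((l + d * (?n - 1)) mod ?n))" using Suc by simp
    also have "\<dots> = ?h (((l + d * (?n - 1)) mod ?n + (?n - 1)) mod ?n)" using n by (intro step) simp
    finally show ?case by (simp only: mod_add_left_eq mod_add_right_eq mult_Suc ac_simps)
  qed (use that in simp)
  show "C \<noteq> {}" "C \<subseteq> Es" using es by auto
  show "\<exists>n>0. \<forall>w\<in>ehead ` C. (P ^^ n) w = w \<and> P w \<in> ehead ` C"
  proof (intro exI[of _ ?n] conjI ballI n)
    fix w assume "w \<in> ehead ` C"
    then obtain l where l: "l < ?n" "w = ?h l" using es(2) by (metis imageE in_set_conv_nth)
    have "(P ^^ ?n) w = w" using pow[OF l(1), of ?n] l by simp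
    moreover have "(l + (?n - 1)) mod ?n < ?n" using n by simp
    then have "P w \<in> ehead ` C" using step[OF l(1)] l(2) es(2) by (metis imageI nth_mem)
    ultimately show "(P ^^ ?n) w = w" "P w \<in> ehead ` C" by auto
  qed
qed

text \<open>Inputs are fixed points, so that chains of parents can be iterated without end and an
  input, once met, is never left.\<close>

fun parent :: "('n \<Rightarrow> 'n vtx \<times> nat) \<Rightarrow> 'n vtx \<Rightarrow> 'n vtx" where
  "parent f (SV j) = fst (f j)"
| "parent f (IV a b) = IV a b"

lemma parent_funpow_input: "is_input v \<Longrightarrow> (parent f ^^ k) v = v"
  by (cases v; induction k) auto

lemma input_absorbing:
  assumes "is_input ((parent f ^^ k) w)" and "k \<le> l"
  shows "(parent f ^^ l) w = (parent f ^^ k) w"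
proof -
  have "(parent f ^^ l) w = (parent f ^^ (l - k)) ((parent f ^^ k) w)"
    using assms(2) by (simp add: funpow_add[THEN fun_cong, unfolded o_apply, symmetric])
  then show ?thesis using parent_funpow_input[OF assms(1)] by metis
qed

text \<open>A periodic chain returns to the state \<open>c\<close> at arbitrarily late times,
  whereas an input is absorbing.\<close>

lemma periodic_not_input:
  assumes "(parent f ^^ L) (SV c) = SV c" "L > 0"
  shows "\<not> is_input ((parent f ^^ k) (SV c))"
proof
  assume i: "is_input ((parent f ^^ k) (SV c))"
  have "(parent f ^^ (L * k)) (SV c) = SV c" using assms(1) by (induction k) (auto simp: funpow_add)
  moreover have "k \<le> L * k" using assms(2) by simp
  ultimately show False using input_absorbing[OF i, of "L * k"] i by simp
qed

lemma finite_Gc_vertices: "finite (Gc_vertices N m :: 'n::finite vtx set)"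
proof -
  have "{IV i k | i k. i \<in> {1..N} \<and> k < m i} \<subseteq> (\<lambda>(i, k). IV i k) ` (SIGMA i:{1..N}. {..<m i})" by auto
  then have "finite {IV i k :: 'n vtx | i k. i \<in> {1..N} \<and> k < m i}" by (rule finite_subset) simp
  then show ?thesis unfolding Gc_vertices_def by simp
qed

lemma matching_imp_cover:
  fixes PA :: "nat \<Rightarrow> 'n::finite \<Rightarrow> 'n \<Rightarrow> bool"
  assumes f: "matching N m PA PB f" and reach: "\<And>j. input_reachable N m PA PB j"
  shows "\<exists>S. stem_bud_cover N m PA PB S"
proof -
  let ?P = "parent f"
  define ed where "ed j = (fst (f j), SV j, snd (f j))" for j
  have ed: "ed j \<in> Gc_edges N m PA PB" "ehead (ed j) = SV j" "etail (ed j) = ?P (SV j)" for j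
    using f by (auto simp: matching_def ed_def ehead_def etail_def)
  \<comment> \<open>The roots \<open>x\<close> are the recurrent vertices: inputs, which give stems,
    and states on cycles of \<open>parent f\<close>, which give buds. \<open>V x\<close> is the
    basin of \<open>x\<close>; all roots on one cycle have the same basin and so yield one
    piece.\<close>
  define V where "V x = {w \<in> Gc_vertices N m. \<exists>k. (?P ^^ k) w = x}" for x
  define E where "E x = {ed j | j. SV j \<in> V x}" for x
  define rt where "rt x \<longleftrightarrow> x \<in> Gc_vertices N m \<and> (\<exists>L>0. (?P ^^ L) x = x)" for x
  have PG: "?P w \<in> Gc_vertices N m" if "w \<in> Gc_vertices N m" for w
  proof (cases w)
    case (SV j) then show ?thesis by (cases rule: matching_cases[OF f, of j]) (auto simp: Gc_vertices_def)
  qed (use that in simp)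
  have PkG: "(?P ^^ k) w \<in> Gc_vertices N m" if "w \<in> Gc_vertices N m" for w k
    by (induction k) (use that PG in auto)
  have PV: "?P w \<in> V x" if "w \<in> V x" "rt x" for w x
  proof -
    from that obtain k L where k: "(?P ^^ k) w = x" and L: "L > 0" "(?P ^^ L) x = x"
      by (auto simp: V_def rt_def)
    have "(?P ^^ (k + L - 1)) (?P w) = (?P ^^ (L + k)) w"
      using L(1) by (metis Suc_pred' add.commute add_gr_0 funpow_Suc_right o_apply)
    also have "\<dots> = x" by (simp add: funpow_add k L)
    finally show ?thesis using that PG by (auto simp: V_def)
  qed
  have S_dis: "S_disjoint (E x)" for x
  proof -
    have "j = k" if "etail (ed j) = etail (ed k)" "ecolor (ed j) = ecolor (ed k)" for j k
    proof -
      have "f j = f k" using that by (simp add: ed_def etail_def ecolor_def prod_eq_iff)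
      then show ?thesis using f by (simp add: matching_def inj_eq)
    qed
    moreover have "j = k" if "ehead (ed j) = ehead (ed k)" for j k
      using that by (simp add: ed(2))
    ultimately show ?thesis unfolding S_disjoint_def E_def by blast
  qed
  have sub: "is_subgraph N m PA PB (V x) (E x)" if "rt x" for x
    unfolding is_subgraph_def
  proof (intro conjI ballI)
    show "V x \<subseteq> Gc_vertices N m" by (auto simp: V_def)
    show "E x \<subseteq> Gc_edges N m PA PB" using ed(1) by (auto simp: E_def)
    fix e assume "e \<in> E x"
    then obtain j where j: "e = ed j" "SV j \<in> V x" by (auto simp: E_def)
    show "etail e \<in> V x" using PV[OF j(2) that] j(1) ed(3) by metis
    show "ehead e \<in> V x" using j ed(2) by metis
  qed
  have uniq: "unique_indeg (V x) (E x)" for x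
    unfolding unique_indeg_def
  proof (intro allI impI)
    fix j assume j: "SV j \<in> V x"
    show "\<exists>!e. e \<in> E x \<and> ehead e = SV j"
    proof (rule ex1I[of _ "ed j"])
      show "ed j \<in> E x \<and> ehead (ed j) = SV j" using j by (auto simp: E_def ed(2))
      fix e assume e: "e \<in> E x \<and> ehead e = SV j"
      then obtain k where "e = ed k" unfolding E_def by blast
      with e ed(2)[of k] show "e = ed j" by simp
    qed
  qed
  have PE: "?P (ehead e) = etail e" if "e \<in> E x" for e x
    using that by (auto simp: E_def ed)
  have stem: "gen_stem N m PA PB (V x) (E x)" if "rt x" "is_input x" for x
  proof -
    have "\<nexists>C. cycle_in (E x) C"
    proof
      assume "\<exists>C. cycle_in (E x) C"
      then obtain C where C: "cycle_in (E x) C" ..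
      obtain n where n: "n > 0 \<and> (\<forall>w\<in>ehead ` C. (?P ^^ n) w = w \<and> ?P w \<in> ehead ` C)"
        using cycle_in_heads(3)[OF C PE[where x = x]] ..
      note n = n[THEN conjunct1] bspec[OF n[THEN conjunct2]] cycle_in_heads(1,2)[OF C PE[where x = x]]
      obtain e where e: "e \<in> C" "e \<in> E x" using n(3,4) by blast
      from e(2) obtain j where "e = ed j" "SV j \<in> V x" unfolding E_def by blast
      with ed(2) have j: "ehead e = SV j" "SV j \<in> V x" by simp_all
      from j(2) obtain k where "(?P ^^ k) (SV j) = x" unfolding V_def by blast
      moreover have "(?P ^^ n) (SV j) = SV j" using n(2)[OF imageI[OF e(1)]] j(1) by simp
      ultimately show False using periodic_not_input[where L = n and f = f and c = j and k = k] n(1) that(2) by simp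
    qed
    moreover have "\<exists>!v. v \<in> V x \<and> is_input v"
    proof (rule ex1I[of _ x])
      show "x \<in> V x \<and> is_input x" using that by (auto simp: V_def rt_def intro!: exI[of _ 0])
      show "v = x" if v: "v \<in> V x \<and> is_input v" for v
      proof -
        from v obtain k where "(?P ^^ k) v = x" unfolding V_def by blast
        with v parent_funpow_input[of v k f] show ?thesis by simp
      qed
    qed
    ultimately show ?thesis unfolding gen_stem_def using sub[OF that(1)] uniq[of x] S_dis[of x] by blast
  qed
  have bud: "gen_bud N m PA PB (V x) (E x)" if "rt x" "\<not> is_input x" for x
  proof -
    from that(2) obtain c where c: "x = SV c" by (cases x) auto
    from that(1) obtain L where L: "L > 0" "(?P ^^ L) (SV c) = SV c" by (auto simp: rt_def c)
    define p where "p j = (case fst (f j) of SV k \<Rightarrow> k | IV a b \<Rightarrow> j)" for j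
    have pk: "SV ((p ^^ k) c) = (?P ^^ k) (SV c)" for k
    proof (induction k)
      case (Suc k)
      have "\<not> is_input (?P (SV ((p ^^ k) c)))" using periodic_not_input[OF L(2,1), of "Suc k"] Suc by simp
      then have "?P (SV ((p ^^ k) c)) = SV (p ((p ^^ k) c))" by (auto simp: p_def split: vtx.splits)
      then show ?case using Suc by simp
    qed simp
    have pL: "(p ^^ L) c = c" using pk[of L] L(2) by simp
    have inV: "SV ((p ^^ k) c) \<in> V x" for k
    proof -
      have "SV c \<in> V x" by (auto simp: V_def c Gc_vertices_def intro!: exI[of _ 0])
      then have "(?P ^^ k) (SV c) \<in> V x" by (induction k) (use PV that in auto)
      then show ?thesis by (simp add: pk)
    qed
    let ?C = "range (\<lambda>k. ed ((p ^^ k) c))"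
    have "cycle_in (E x) ?C"
    proof (rule cycle_in_orbit[OF pL L(1)])
      show "ed ((p ^^ k) c) \<in> E x" for k using inV by (auto simp: E_def)
      show "etail (ed ((p ^^ k) c)) = SV ((p ^^ Suc k) c)" for k
        unfolding ed pk by simp
    qed (simp add: ed)
    \<comment> \<open>The heads of any cycle in the piece are closed under \<open>?P\<close> and
      have chains meeting \<open>c\<close>, so they contain the orbit of \<open>c\<close>.
      Conversely each head is periodic and its chain meets \<open>c\<close>, so it is itself an
      iterate of \<open>c\<close>.\<close>
    moreover have "C = ?C" if C: "cycle_in (E x) C" for C
    proof -
      obtain n where n: "n > 0 \<and> (\<forall>w\<in>ehead ` C. (?P ^^ n) w = w \<and> ?P w \<in> ehead ` C)"
        using cycle_in_heads(3)[OF C PE[where x = x]] ..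
      note n = n[THEN conjunct1] bspec[OF n[THEN conjunct2]] cycle_in_heads(1,2)[OF C PE[where x = x]]
      have closed: "(?P ^^ k) w \<in> ehead ` C" if "w \<in> ehead ` C" for w k
        by (induction k) (use that n(2) in auto)
      have CE: "\<exists>j. e = ed j \<and> SV j \<in> V x" if "e \<in> C" for e
        using that n(4) unfolding E_def by blast
      have edC: "ed j \<in> C" if "SV j \<in> ehead ` C" for j
      proof -
        from that obtain e where e: "e \<in> C" "SV j = ehead e" by blast
        with CE obtain k where "e = ed k" by blast
        with e ed(2)[of k] show ?thesis by simp
      qed
      have to_c: "\<exists>a. (?P ^^ a) w = SV c" if "w \<in> ehead ` C" for w
      proof -
        from that obtain e where e: "e \<in> C" "w = ehead e" by blast
        with CE obtain k where "e = ed k" "SV k \<in> V x" by blast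
        with e(2) ed(2)[of k] show ?thesis by (simp add: V_def c)
      qed
      obtain e0 where e0: "e0 \<in> C" using n(3) by blast
      from to_c[OF imageI[OF e0]] closed[OF imageI[OF e0]] have orb: "SV c \<in> ehead ` C" by metis
      show ?thesis
      proof
        show "?C \<subseteq> C"
        proof (rule image_subsetI)
          fix k show "ed ((p ^^ k) c) \<in> C" using closed[OF orb, of k] edC by (simp flip: pk)
        qed
        show "C \<subseteq> ?C"
        proof
          fix e assume e: "e \<in> C"
          then obtain j where j: "e = ed j" using CE by blast
          have w: "SV j \<in> ehead ` C" using imageI[OF e, of ehead] by (simp add: j ed(2))
          from to_c[OF w] obtain a where a: "(?P ^^ a) (SV j) = SV c" ..
          have "(?P ^^ n) (SV j) = SV j" using n(2)[OF w] by simp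
          then have "(?P ^^ (n * a)) (SV j) = SV j" by (induction a) (auto simp: funpow_add)
          moreover have "n * a = (n * a - a) + a" using n(1) by simp
          ultimately have "SV j = (?P ^^ (n * a - a)) ((?P ^^ a) (SV j))"
            by (metis funpow_add o_apply)
          then have "SV j = SV ((p ^^ (n * a - a)) c)" by (simp add: a pk)
          then show "e \<in> ?C" using j by auto
        qed
      qed
    qed
    ultimately have "\<exists>!C. cycle_in (E x) C" by blast
    moreover have "\<not> (\<exists>v\<in>V x. is_input v)"
    proof
      assume "\<exists>v\<in>V x. is_input v"
      then obtain v k where "is_input v" "(?P ^^ k) v = x" unfolding V_def by blast
      with parent_funpow_input[of v k f] that(2) show False by simp
    qed
    ultimately show ?thesis
      unfolding gen_bud_def using sub[OF that(1)] uniq[of x] S_dis[of x] reach by blast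
  qed
  have disj: "V x = V y" if "rt x" "rt y" "w \<in> V x" "w \<in> V y" for x y w
  proof -
    \<comment> \<open>Repeating the period of \<open>y\<close> another \<open>a\<close> times makes
      the chain from \<open>w\<close> to \<open>y\<close> at least \<open>a\<close> steps long, so
      it passes through \<open>x\<close>. Whatever leads to \<open>x\<close> then leads to
      \<open>y\<close>.\<close>
    have half: "V x \<subseteq> V y" if "rt y" "(?P ^^ a) w = x" "(?P ^^ b) w = y" for x y a b
    proof -
      from that(1) obtain L where L: "L > 0" "(?P ^^ L) y = y" by (auto simp: rt_def)
      have "(?P ^^ (L * a)) y = y" using L(2) by (induction a) (auto simp: funpow_add)
      then have "(?P ^^ (L * a + b)) w = y" by (simp add: funpow_add that)
      moreover have "a \<le> L * a" using L(1) by simp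
      then have "L * a + b = (L * a + b - a) + a" by linarith
      ultimately have xy: "(?P ^^ (L * a + b - a)) x = y" using that(2) by (metis funpow_add o_apply)
      show ?thesis
      proof
        fix z assume "z \<in> V x"
        then obtain k where k: "z \<in> Gc_vertices N m" "(?P ^^ k) z = x" by (auto simp: V_def)
        then have "(?P ^^ (L * a + b - a + k)) z = y" by (simp add: funpow_add xy)
        with k(1) show "z \<in> V y" unfolding V_def by blast
      qed
    qed
    from that(3,4) obtain a b where "(?P ^^ a) w = x" "(?P ^^ b) w = y" by (auto simp: V_def)
    with half that(1,2) show ?thesis by blast
  qed
  have cov: "\<exists>x. rt x \<and> SV j \<in> V x" for j
  proof -
    have G: "SV j \<in> Gc_vertices N m" by (simp add: Gc_vertices_def)
    have "finite (range (\<lambda>k. (?P ^^ k) (SV j)))"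
      by (rule finite_subset[OF _ finite_Gc_vertices]) (use PkG[OF G] in auto)
    then have "\<not> inj (\<lambda>k. (?P ^^ k) (SV j))" using finite_imageD infinite_UNIV_nat by blast
    then obtain a b where ab: "a < b" "(?P ^^ a) (SV j) = (?P ^^ b) (SV j)"
      unfolding inj_on_def by (metis linorder_neqE_nat)
    let ?x = "(?P ^^ a) (SV j)"
    have "(?P ^^ (b - a)) ?x = (?P ^^ (b - a + a)) (SV j)" by (simp add: funpow_add)
    also have "\<dots> = ?x" using ab by simp
    finally have "rt ?x" using ab(1) PkG[OF G] unfolding rt_def by (intro conjI exI[of _ "b - a"]) auto
    moreover have "SV j \<in> V ?x" using G by (auto simp: V_def)
    ultimately show ?thesis by blast
  qed
  have "stem_bud_cover N m PA PB {(V x, E x) | x. rt x}"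
    unfolding stem_bud_cover_def
  proof (intro conjI allI ballI impI)
    fix s assume "s \<in> {(V x, E x) | x. rt x}"
    then show "case s of (Vs, Es) \<Rightarrow> gen_stem N m PA PB Vs Es \<or> gen_bud N m PA PB Vs Es"
      using stem bud by auto
  next
    fix s1 s2 assume s: "s1 \<in> {(V x, E x) | x. rt x}" "s2 \<in> {(V x, E x) | x. rt x}" "s1 \<noteq> s2"
    then obtain x y where xy: "s1 = (V x, E x)" "s2 = (V y, E y)" "rt x" "rt y" by auto
    have "V x \<noteq> V y" using s(3) xy by (auto simp: E_def)
    then show "fst s1 \<inter> fst s2 = {}" using disj[OF xy(3,4)] xy(1,2) by auto
  next
    fix j
    show "\<exists>s\<in>{(V x, E x) | x. rt x}. SV j \<in> fst s" using cov[of j] by force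
  qed
  then show ?thesis by blast
qed

text \<open>The ingoing edge of an unreachable state can only come from an unreachable state of the
  same stem. Going back repeatedly in a finite set would close a cycle, which a stem
  excludes.\<close>

lemma gen_stem_imp_input_reachable:
  fixes PA :: "nat \<Rightarrow> 'n::finite \<Rightarrow> 'n \<Rightarrow> bool"
  assumes stem: "gen_stem N m PA PB Vs Es" and j: "SV j \<in> Vs"
  shows "input_reachable N m PA PB j"
proof (rule ccontr)
  assume nr: "\<not> input_reachable N m PA PB j"
  let ?U = "{j. SV j \<in> Vs \<and> \<not> input_reachable N m PA PB j}"
  have ui: "unique_indeg Vs Es" and sg: "is_subgraph N m PA PB Vs Es" and nc: "\<And>C. \<not> cycle_in Es C"
    using stem unfolding gen_stem_def by blast+
  have "\<exists>e. e \<in> Es \<and> ehead e = SV i \<and> (\<exists>k. etail e = SV k \<and> k \<in> ?U)" if i: "i \<in> ?U" for i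
  proof -
    from ui i obtain e where e: "e \<in> Es" "ehead e = SV i"
      unfolding unique_indeg_def by blast
    then have eG: "e \<in> Gc_edges N m PA PB" "etail e \<in> Vs"
      using sg unfolding is_subgraph_def by blast+
    obtain t c where tc: "e = (t, SV i, c)" using e(2) by (cases e) (auto simp: ehead_def)
    show ?thesis
    proof (cases t)
      case (SV k)
      then have "\<not> input_reachable N m PA PB k"
        using input_reachable_state_edge[of k i c N m PA PB] eG(1) tc i by auto
      moreover have "etail e = SV k" using tc SV by (simp add: etail_def)
      ultimately show ?thesis using e eG(2) by (intro exI[of _ e]) simp
    next
      case (IV a r)
      then show ?thesis using input_reachable_input_edge[of a r i c N m PA PB] eG(1) tc i by auto
    qed
  qed
  then obtain e where e: "\<forall>i\<in>?U. e i \<in> Es \<and> ehead (e i) = SV i \<and> (\<exists>k. etail (e i) = SV k \<and> k \<in> ?U)"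
    using bchoice[of ?U "\<lambda>i e. e \<in> Es \<and> ehead e = SV i \<and> (\<exists>k. etail e = SV k \<and> k \<in> ?U)"] by blast
  then obtain p where "\<forall>i\<in>?U. etail (e i) = SV (p i) \<and> p i \<in> ?U"
    using bchoice[of ?U "\<lambda>i k. etail (e i) = SV k \<and> k \<in> ?U"] by blast
  with e have pe: "\<And>i. i \<in> ?U \<Longrightarrow> e i \<in> Es \<and> ehead (e i) = SV i \<and> etail (e i) = SV (p i) \<and> p i \<in> ?U"
    by blast
  have orb: "(p ^^ k) j \<in> ?U" for k
  proof (induction k)
    case (Suc k)
    then show ?case using pe[of "(p ^^ k) j"] by simp
  qed (use j nr in simp)
  have "finite (range (\<lambda>k. (p ^^ k) j))" by simp
  then have "\<not> inj (\<lambda>k. (p ^^ k) j)" using finite_imageD infinite_UNIV_nat by blast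
  then obtain a b where ab: "a < b" "(p ^^ a) j = (p ^^ b) j"
    unfolding inj_on_def by (metis linorder_neqE_nat)
  have orb': "(p ^^ k) ((p ^^ a) j) \<in> ?U" for k using orb[of "k + a"] by (simp add: funpow_add)
  have "cycle_in Es (range (\<lambda>k. e ((p ^^ k) ((p ^^ a) j))))"
  proof (rule cycle_in_orbit)
    have "(p ^^ (b - a)) ((p ^^ a) j) = (p ^^ (b - a + a)) j" by (simp add: funpow_add)
    then show "(p ^^ (b - a)) ((p ^^ a) j) = (p ^^ a) j" using ab by simp
    fix k
    show "e ((p ^^ k) ((p ^^ a) j)) \<in> Es" "ehead (e ((p ^^ k) ((p ^^ a) j))) = SV ((p ^^ k) ((p ^^ a) j))"
      "etail (e ((p ^^ k) ((p ^^ a) j))) = SV ((p ^^ Suc k) ((p ^^ a) j))"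
      using pe[OF orb'[of k]] by simp_all
  qed (use ab in simp)
  with nc show False by blast
qed

lemma cover_imp_reachable_matching:
  fixes PA :: "nat \<Rightarrow> 'n::finite \<Rightarrow> 'n \<Rightarrow> bool"
  assumes "stem_bud_cover N m PA PB S"
  shows "input_reachable N m PA PB j" and "\<exists>f. matching N m PA PB f"
proof -
  have piece: "gen_stem N m PA PB (fst s) (snd s) \<or> gen_bud N m PA PB (fst s) (snd s)" if "s \<in> S" for s
  proof -
    have "\<forall>(Vs, Es)\<in>S. gen_stem N m PA PB Vs Es \<or> gen_bud N m PA PB Vs Es"
      using assms unfolding stem_bud_cover_def by (elim conjE)
    from bspec[OF this that] show ?thesis by (simp add: case_prod_beta)
  qed
  have cov: "\<exists>s\<in>S. SV j \<in> fst s" for j using assms unfolding stem_bud_cover_def by blast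
  have dis: "s1 = s2" if "s1 \<in> S" "s2 \<in> S" "v \<in> fst s1" "v \<in> fst s2" for s1 s2 v
    using assms that unfolding stem_bud_cover_def by blast
  show "input_reachable N m PA PB j"
  proof -
    obtain s where s: "s \<in> S" "SV j \<in> fst s" using cov by blast
    from piece[OF s(1)] show ?thesis
    proof
      assume "gen_stem N m PA PB (fst s) (snd s)"
      then show ?thesis using s(2) by (rule gen_stem_imp_input_reachable)
    next
      assume "gen_bud N m PA PB (fst s) (snd s)"
      then show ?thesis using s(2) unfolding gen_bud_def by blast
    qed
  qed
  have props: "is_subgraph N m PA PB (fst s) (snd s)" "unique_indeg (fst s) (snd s)" "S_disjoint (snd s)"
    if "s \<in> S" for s using piece[OF that] unfolding gen_stem_def gen_bud_def by blast+
  have "\<exists>s e. s \<in> S \<and> e \<in> snd s \<and> ehead e = SV j" for j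
  proof -
    obtain s where "s \<in> S" "SV j \<in> fst s" using cov by blast
    with props(2)[of s] show ?thesis unfolding unique_indeg_def by blast
  qed
  then obtain s where "\<forall>j. \<exists>e. s j \<in> S \<and> e \<in> snd (s j) \<and> ehead e = SV j"
    using choice[of "\<lambda>j s. \<exists>e. s \<in> S \<and> e \<in> snd s \<and> ehead e = SV j"] by blast
  then obtain e where se: "\<And>j. s j \<in> S" "\<And>j. e j \<in> snd (s j)" "\<And>j. ehead (e j) = SV j"
    using choice[of "\<lambda>j e. s j \<in> S \<and> e \<in> snd (s j) \<and> ehead e = SV j"] by blast
  have eG: "e j \<in> Gc_edges N m PA PB" "etail (e j) \<in> fst (s j)" for j
    using props(1)[OF se(1)[of j]] se(2)[of j] by (auto simp: is_subgraph_def)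
  have ej: "e j = (etail (e j), SV j, ecolor (e j))" for j
    using se(3)[of j] by (simp add: prod_eq_iff etail_def ehead_def ecolor_def)
  have edges: "(etail (e j), SV j, ecolor (e j)) \<in> Gc_edges N m PA PB" for j
    by (rule subst[where P = "\<lambda>x. x \<in> Gc_edges N m PA PB", OF ej eG(1)])
  \<comment> \<open>Equal tails put both edges into one piece, as pieces share no vertex; inside a
    piece, S-disjointness separates the colours.\<close>
  have inj: "inj (\<lambda>j. (etail (e j), ecolor (e j)))"
  proof (rule injI)
    fix j k assume eq: "(etail (e j), ecolor (e j)) = (etail (e k), ecolor (e k))"
    then have t: "etail (e j) = etail (e k)" and c: "ecolor (e j) = ecolor (e k)" by simp_all
    have "etail (e j) \<in> fst (s k)" using eG(2)[of k] t by simp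
    from dis[OF se(1)[of j] se(1)[of k] eG(2)[of j] this] have sk: "s j = s k" .
    have "e j = e k"
    proof (rule ccontr)
      assume ne: "e j \<noteq> e k"
      have ek: "e k \<in> snd (s j)" using se(2)[of k] sk by simp
      have "\<forall>e1\<in>snd (s j). \<forall>e2\<in>snd (s j). e1 \<noteq> e2 \<and> etail e1 = etail e2 \<longrightarrow> ecolor e1 \<noteq> ecolor e2"
        using props(3)[OF se(1)[of j]] unfolding S_disjoint_def by (rule conjunct2)
      from mp[OF bspec[OF bspec[OF this se(2)[of j]] ek] conjI[OF ne t]] c show False by (rule notE)
    qed
    then have "ehead (e j) = ehead (e k)" by (rule arg_cong)
    then show "j = k" unfolding se(3) by simp
  qed
  have "matching N m PA PB (\<lambda>j. (etail (e j), ecolor (e j)))"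
    unfolding matching_def fst_conv snd_conv by (intro conjI allI inj edges)
  then show "\<exists>f. matching N m PA PB f" by (rule exI[of "matching N m PA PB"])
qed

section \<open>Levels and nilpotency of the limit system\<close>

primrec mprod :: "(nat \<Rightarrow> real^'n^'n) \<Rightarrow> nat list \<Rightarrow> real^'n^'n" where
  "mprod A [] = mat 1"
| "mprod A (i # w) = A i ** mprod A w"

lemma mprod_append: "mprod A (u @ w) = mprod A u ** mprod A w"
  by (induction u) (simp_all add: matrix_mul_assoc)

text \<open>
  \<open>top k\<close> is the state through which level \<open>k > 0\<close> is entered, and \<open>entry k\<close> the tail and colour of the
  entry edge.
\<close>

locale leveled =
  fixes N :: nat and m :: "nat \<Rightarrow> nat" and f :: "'n::finite \<Rightarrow> 'n vtx \<times> nat"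
    and lev :: "'n \<Rightarrow> nat" and top :: "nat \<Rightarrow> 'n" and entry :: "nat \<Rightarrow> 'n vtx \<times> nat"
  assumes f_inj: "inj f"
    and f_state: "\<And>j k i. f j = (SV k, i) \<Longrightarrow> i \<in> {1..N} \<and> lev j \<le> lev k"
    and f_input: "\<And>j a r i. f j = (IV a r, i) \<Longrightarrow> a = i \<and> i \<in> {1..N} \<and> r < m i \<and> lev j = 0"
    and lev_zero: "\<And>j. lev j = 0 \<Longrightarrow> \<exists>a. is_input ((parent f ^^ a) (SV j))"
    and lev_pos: "\<And>j. lev j > 0 \<Longrightarrow> lev (top (lev j)) = lev j \<and> (\<exists>a. (parent f ^^ a) (SV j) = SV (top (lev j)))"
    and ent_state: "\<And>j k i. lev j > 0 \<Longrightarrow> entry (lev j) = (SV k, i) \<Longrightarrow> i \<in> {1..N} \<and> lev k < lev j"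
    and ent_input: "\<And>j a r i. lev j > 0 \<Longrightarrow> entry (lev j) = (IV a r, i) \<Longrightarrow> a = i \<and> i \<in> {1..N} \<and> r < m i"
begin

definition is_entry :: "'n \<Rightarrow> 'n vtx \<times> nat \<Rightarrow> bool" where
  "is_entry j t \<longleftrightarrow> lev j > 0 \<and> j = top (lev j) \<and> entry (lev j) = t"

lemma f_eq_iff: "f j = f k \<longleftrightarrow> j = k"
  using f_inj by (simp add: inj_eq)

lemma parent_chain_mono: "(parent f ^^ a) (SV j) = SV z \<Longrightarrow> lev j \<le> lev z"
proof (induction a arbitrary: j)
  case (Suc a)
  then have *: "(parent f ^^ a) (fst (f j)) = SV z" by (simp add: funpow_Suc_right del: funpow.simps)
  show ?case
  proof (cases "fst (f j)")
    case (SV k)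
    then have "lev j \<le> lev k" using f_state[of j k "snd (f j)"] by (simp add: prod_eq_iff)
    also have "lev k \<le> lev z" using Suc.IH[of k] * SV by simp
    finally show ?thesis .
  next
    case (IV b r)
    then show ?thesis using * parent_funpow_input[of "IV b r" a f] by simp
  qed
qed simp

text \<open>\<open>w\<close> lists the colours along a path of the rescaled limit from input
  \<open>r0\<close> of mode \<open>i0\<close> to \<open>x\<close>, last edge first, in the order of
  matrix multiplication; the input edge itself is not in \<open>w\<close>. Weights do not occur, so
  shortest words can be fixed before the weights are chosen.\<close>

primrec walk :: "nat \<Rightarrow> nat \<Rightarrow> nat list \<Rightarrow> 'n \<Rightarrow> bool" where
  "walk i0 r0 [] x \<longleftrightarrow> f x = (IV i0 r0, i0) \<or> is_entry x (IV i0 r0, i0)"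
| "walk i0 r0 (i # w) x \<longleftrightarrow>
     (\<exists>y. walk i0 r0 w y \<and> (f x = (SV y, i) \<and> lev y = lev x \<or> is_entry x (SV y, i)))"

lemma walk_valid: "walk i0 r0 w x \<Longrightarrow> i0 \<in> {1..N} \<and> r0 < m i0 \<and> set w \<subseteq> {1..N}"
proof (induction w arbitrary: x)
  case Nil
  then show ?case using f_input[of x i0 r0 i0] ent_input[of x i0 r0 i0] by (auto simp: is_entry_def)
next
  case (Cons i w)
  then obtain y where y: "walk i0 r0 w y" "f x = (SV y, i) \<and> lev y = lev x \<or> is_entry x (SV y, i)" by auto
  from y(2) have "i \<in> {1..N}" using f_state[of x y i] ent_state[of x y i] by (auto simp: is_entry_def)
  with Cons.IH[OF y(1)] show ?case by simp
qed

text \<open>The entry edge reaches the top of the level from a lower level or from an input, and the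
  parent chain from \<open>x\<close> to the top, read forwards, leads on from there. Level 0 is
  reached from the inputs directly.\<close>

lemma walk_level_exists:
  assumes IH: "\<And>y. lev y < lev x \<Longrightarrow> \<exists>i0 r0 w. walk i0 r0 w y"
  shows "\<exists>i0 r0 w. walk i0 r0 w x"
proof -
  \<comment> \<open>Levels do not decrease along a parent chain, so a chain between two states of
    one level stays inside it and uses only edges that survive in the limit.\<close>
  have down: "\<exists>i0 r0 w. walk i0 r0 w x"
    if "(parent f ^^ a) (SV x) = SV z" "lev x = lev z" "\<exists>i0 r0 w. walk i0 r0 w z" for a x z
    using that(1,2)
  proof (induction a arbitrary: x)
    case 0
    then show ?case using that(3) by simp
  next
    case (Suc a)
    then have *: "(parent f ^^ a) (fst (f x)) = SV z" by (simp add: funpow_Suc_right del: funpow.simps)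
    show ?case
    proof (cases "fst (f x)")
      case (SV k)
      define i where "i = snd (f x)"
      have fx: "f x = (SV k, i)" using SV by (simp add: prod_eq_iff i_def)
      have c: "(parent f ^^ a) (SV k) = SV z" using * SV by simp
      have l: "lev k = lev x" using f_state[OF fx] parent_chain_mono[OF c] Suc.prems(2) by simp
      obtain i0 r0 w where "walk i0 r0 w k" using Suc.IH[OF c] l Suc.prems(2) by auto
      then have "walk i0 r0 (i # w) x" using fx l by auto
      then show ?thesis by blast
    next
      case (IV b r)
      then show ?thesis using * parent_funpow_input[of "IV b r" a f] by simp
    qed
  qed
  show ?thesis
  proof (cases "lev x = 0")
    case True
    have "\<exists>i0 r0 w. walk i0 r0 w x" if "is_input ((parent f ^^ a) (SV x))" "lev x = 0" for a x
      using that
    proof (induction a arbitrary: x)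
      case (Suc a)
      then have *: "is_input ((parent f ^^ a) (fst (f x)))" by (simp add: funpow_Suc_right del: funpow.simps)
      show ?case
      proof (cases "fst (f x)")
        case (IV b r)
        have fx: "f x = (IV b r, snd (f x))" using IV by (simp add: prod_eq_iff)
        with f_input[OF fx] have "f x = (IV b r, b)" by simp
        then have "walk b r [] x" by simp
        then show ?thesis by blast
      next
        case (SV k)
        define i where "i = snd (f x)"
        have fx: "f x = (SV k, i)" using SV by (simp add: prod_eq_iff i_def)
        show ?thesis
        proof (cases "lev k = 0")
          case True
          then obtain i0 r0 w where "walk i0 r0 w k" using Suc.IH[of k] * SV by auto
          then have "walk i0 r0 (i # w) x" using fx True Suc.prems(2) by auto
          then show ?thesis by blast
        next
          case False
          \<comment> \<open>Once above level 0, a parent chain never meets an input; hence the chain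
            from a level 0 state to an input stays on level 0.\<close>
          have st: "\<exists>y. (parent f ^^ t) (SV k) = SV y \<and> lev y > 0" for t
          proof (induction t)
            case 0 then show ?case using False by auto
          next
            case (Suc t)
            then obtain y where y: "(parent f ^^ t) (SV k) = SV y" "lev y > 0" by blast
            show ?case
            proof (cases "f y")
              case (Pair v c)
              show ?thesis
              proof (cases v)
                case (SV y')
                then show ?thesis using y f_state[of y y' c] Pair by auto
              next
                case (IV a' r')
                then show ?thesis using y f_input[of y a' r' c] Pair by auto
              qed
            qed
          qed
          from st[of a] * SV show ?thesis by auto
        qed
      qed
    qed simp
    with lev_zero[OF True] True show ?thesis by blast
  next
    case False
    then obtain a where a: "(parent f ^^ a) (SV x) = SV (top (lev x))" and t: "lev (top (lev x)) = lev x"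
      using lev_pos[of x] by blast
    have "\<exists>i0 r0 w. walk i0 r0 w (top (lev x))"
    proof (cases "entry (lev x)")
      case (Pair v i)
      show ?thesis
      proof (cases v)
        case (SV y)
        then have "lev y < lev x" using ent_state[of x y i] Pair False by simp
        from IH[OF this] obtain i0 r0 w where "walk i0 r0 w y" by blast
        moreover have "is_entry (top (lev x)) (SV y, i)" using t False Pair SV by (simp add: is_entry_def)
        ultimately have "walk i0 r0 (i # w) (top (lev x))" by auto
        then show ?thesis by blast
      next
        case (IV b r)
        then have "b = i" using ent_input[of x b r i] Pair False by simp
        then have "walk i r [] (top (lev x))" using t False Pair IV by (simp add: is_entry_def)
        then show ?thesis by blast
      qed
    qed
    with down[OF a] t show ?thesis by simp
  qed
qed

lemma walk_exists: "\<exists>i0 r0 w. walk i0 r0 w x"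
  by (induction "lev x" arbitrary: x rule: less_induct) (rule walk_level_exists, blast)

text \<open>A level above 0 can be entered only at its top; cutting the path there gives the shorter
  word.\<close>

lemma walk_via_top:
  assumes "walk i0 r0 w y" "lev y > 0"
  shows "y = top (lev y) \<or> (\<exists>w'. length w' < length w \<and> walk i0 r0 w' (top (lev y)))"
  using assms
proof (induction w arbitrary: y)
  case Nil
  then show ?case using f_input[of y i0 r0 i0] by (auto simp: is_entry_def)
next
  case (Cons i w)
  then obtain y' where y': "walk i0 r0 w y'" "f y = (SV y', i) \<and> lev y' = lev y \<or> is_entry y (SV y', i)" by auto
  show ?case
  proof (cases "is_entry y (SV y', i)")
    case True then show ?thesis by (simp add: is_entry_def)
  next
    case False
    then have l: "lev y' = lev y" using y'(2) by simp
    from Cons.IH[OF y'(1)] l Cons.prems(2) consider "y' = top (lev y)"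
      | w' where "length w' < length w" "walk i0 r0 w' (top (lev y))" by auto
    then show ?thesis
    proof cases
      case 1 then show ?thesis using y'(1) by (intro disjI2 exI[of _ w]) simp
    next
      case 2 then show ?thesis by (intro disjI2 exI[of _ w']) simp
    qed
  qed
qed

text \<open>
  The limit of the rescaled system: matching edges inside a level, and entry edges with weight 1.
\<close>

definition level_A :: "(nat \<Rightarrow> real) \<Rightarrow> nat \<Rightarrow> real^'n^'n" where
  "level_A \<mu> i = (\<chi> j k. (if f j = (SV k, i) \<and> lev k = lev j then \<mu> (lev j) else 0) + (if is_entry j (SV k, i) then 1 else 0))"

definition level_B :: "(nat \<Rightarrow> real) \<Rightarrow> nat \<Rightarrow> nat \<Rightarrow> real^'n" where
  "level_B \<mu> i r = (\<chi> j. (if f j = (IV i r, i) then \<mu> (lev j) else 0) + (if is_entry j (IV i r, i) then 1 else 0))"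

text \<open>Covectors act from the right. The intended \<open>W\<close> is
  \<open>{q. q v* Q0 = q}\<close>, the covectors vanishing on the kernel of the limit projection
  \<open>Q0\<close>.\<close>

definition annihilated :: "(nat \<Rightarrow> real) \<Rightarrow> (real^'n) set \<Rightarrow> bool" where
  "annihilated \<mu> W \<longleftrightarrow> (\<forall>q\<in>W. (\<forall>c. c *\<^sub>R q \<in> W) \<and>
     (\<forall>i\<in>{1..N}. q v* level_A \<mu> i \<in> W \<and> (\<forall>r<m i. q \<bullet> level_B \<mu> i r = 0)))"

text \<open>Every state of a level \<open>k > 0\<close> has \<open>top k\<close> on its parent
  chain. So if the parent of the top is on level \<open>k\<close> again, the top lies on a matching
  cycle inside the level.\<close>

definition cyclic :: "nat \<Rightarrow> bool" where
  "cyclic k \<longleftrightarrow> k > 0 \<and> (\<exists>j. lev j = k) \<and> (\<exists>x c. f (top k) = (SV x, c) \<and> lev x = k)"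

lemma sum_subsingleton_le:
  fixes g :: "'n \<Rightarrow> real"
  assumes "\<And>x y. P x \<Longrightarrow> P y \<Longrightarrow> x = y" and "\<And>x. P x \<Longrightarrow> g x \<le> c" and "c \<ge> 0"
  shows "(\<Sum>x\<in>S. if P x then g x else 0) \<le> c"
proof (cases "\<exists>x\<in>S. P x")
  case True
  then obtain x where x: "x \<in> S" "P x" by blast
  have "(\<Sum>y\<in>S. if P y then g y else 0) = (\<Sum>y\<in>S. if y = x then g y else 0)"
    using assms(1) x(2) by (intro sum.cong) auto
  also have "\<dots> = g x" using x(1) by simp
  finally show ?thesis using assms(2)[OF x(2)] by simp
next
  case False
  then have "(\<Sum>x\<in>S. if P x then g x else 0) = 0" by (intro sum.neutral) auto
  with assms(3) show ?thesis by simp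
qed

section \<open>Growth of words and action on covectors for fixed weights\<close>

context
  fixes \<mu> :: "nat \<Rightarrow> real"
  assumes \<mu>_ge_1: "\<And>k. \<mu> k \<ge> 1" and \<mu>_mono: "mono \<mu>"
begin

abbreviation "z i0 r0 w \<equiv> mprod (level_A \<mu>) w *v level_B \<mu> i0 r0"

lemma \<mu>_pos: "\<mu> k > 0"
  using \<mu>_ge_1[of k] by simp

lemma level_A_nonneg: "level_A \<mu> i $ j $ k \<ge> 0"
  using \<mu>_pos[of "lev j"] by (simp add: level_A_def)

lemma z_Cons: "z i0 r0 (i # w) $ x = (\<Sum>y\<in>UNIV. level_A \<mu> i $ x $ y * z i0 r0 w $ y)"
proof -
  have "z i0 r0 (i # w) = level_A \<mu> i *v z i0 r0 w" by (simp add: matrix_vector_mul_assoc)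
  then show ?thesis by (simp add: matrix_vector_mult_def)
qed

text \<open>Entries are nonnegative, and at least 1 where nonzero, so nothing cancels and the
  support of \<open>z\<close> consists of the endpoints of walks.\<close>

lemma z_ge_1: "walk i0 r0 w x \<Longrightarrow> z i0 r0 w $ x \<ge> 1" and z_eq_0: "\<not> walk i0 r0 w x \<Longrightarrow> z i0 r0 w $ x = 0"
proof (induction w arbitrary: x)
  case Nil
  { case 1 then show ?case using \<mu>_ge_1[of "lev x"] by (auto simp: level_B_def) }
  { case 2 then show ?case by (simp add: level_B_def) }
next
  case (Cons i w)
  have nn: "z i0 r0 w $ y \<ge> 0" for y using Cons.IH[of y] by (cases "walk i0 r0 w y") auto
  { case 1
    then obtain y where y: "walk i0 r0 w y" "f x = (SV y, i) \<and> lev y = lev x \<or> is_entry x (SV y, i)" by auto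
    have "1 \<le> level_A \<mu> i $ x $ y" using y(2) \<mu>_ge_1[of "lev x"] by (auto simp: level_A_def)
    then have "1 * 1 \<le> level_A \<mu> i $ x $ y * z i0 r0 w $ y"
      using Cons.IH(1)[OF y(1)] by (intro mult_mono) auto
    also have "\<dots> \<le> (\<Sum>y\<in>UNIV. level_A \<mu> i $ x $ y * z i0 r0 w $ y)"
      by (rule member_le_sum) (auto intro: mult_nonneg_nonneg level_A_nonneg nn)
    finally show ?case by (simp only: z_Cons mult_1_left) }
  { case 2
    have "level_A \<mu> i $ x $ y * z i0 r0 w $ y = 0" for y
    proof (cases "walk i0 r0 w y")
      case True
      then have "\<not> (f x = (SV y, i) \<and> lev y = lev x)" "\<not> is_entry x (SV y, i)" using 2 by auto
      then show ?thesis by (auto simp: level_A_def)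
    qed (simp add: Cons.IH(2))
    then show ?case unfolding z_Cons by (intro sum.neutral) auto }
qed

lemma z_nonneg: "z i0 r0 w $ x \<ge> 0"
  using z_ge_1[of i0 r0 w x] z_eq_0[of i0 r0 w x] by (cases "walk i0 r0 w x") auto

lemma level_A_row_sum_le:
  assumes "\<And>y. lev y \<le> lev x \<Longrightarrow> g y \<le> c" and "c \<ge> 0"
  shows "(\<Sum>y\<in>S. level_A \<mu> i $ x $ y * g y) \<le> (\<mu> (lev x) + 1) * c"
proof -
  have "(\<Sum>y\<in>S. level_A \<mu> i $ x $ y * g y) = (\<Sum>y\<in>S. if f x = (SV y, i) \<and> lev y = lev x then \<mu> (lev x) * g y else 0)
      + (\<Sum>y\<in>S. if is_entry x (SV y, i) then g y else 0)"
    unfolding level_A_def by (simp add: distrib_right sum.distrib if_distrib[of "\<lambda>c. c * _"] cong: if_cong)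
  also have "\<dots> \<le> \<mu> (lev x) * c + c"
  proof (rule add_mono)
    show "(\<Sum>y\<in>S. if f x = (SV y, i) \<and> lev y = lev x then \<mu> (lev x) * g y else 0) \<le> \<mu> (lev x) * c"
      by (rule sum_subsingleton_le) (use assms \<mu>_pos[of "lev x"] in auto)
    show "(\<Sum>y\<in>S. if is_entry x (SV y, i) then g y else 0) \<le> c"
    proof (rule sum_subsingleton_le)
      fix y assume "is_entry x (SV y, i)"
      then have "lev y < lev x" using ent_state[of x y i] by (simp add: is_entry_def)
      then show "g y \<le> c" using assms(1) by simp
    qed (use assms(2) in \<open>auto simp: is_entry_def\<close>)
  qed
  finally show ?thesis by (simp add: algebra_simps)
qed

text \<open>Only levels up to that of \<open>x\<close> feed into \<open>x\<close>, so the weights of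
  higher levels do not appear. The additional factor accounts for the input column.\<close>

lemma z_le: "z i0 r0 w $ x \<le> (\<mu> (lev x) + 1) ^ Suc (length w)"
proof (induction w arbitrary: x)
  case Nil
  show ?case using \<mu>_pos[of "lev x"] by (simp add: level_B_def)
next
  case (Cons i w)
  have "(\<Sum>y\<in>UNIV. level_A \<mu> i $ x $ y * z i0 r0 w $ y) \<le> (\<mu> (lev x) + 1) * (\<mu> (lev x) + 1) ^ Suc (length w)"
  proof (rule level_A_row_sum_le)
    fix y assume "lev y \<le> lev x"
    then have "\<mu> (lev y) \<le> \<mu> (lev x)" by (rule monoD[OF \<mu>_mono])
    then have "(\<mu> (lev y) + 1) ^ Suc (length w) \<le> (\<mu> (lev x) + 1) ^ Suc (length w)"
      using \<mu>_pos[of "lev y"] by (intro power_mono) auto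
    with Cons.IH[of y] show "z i0 r0 w $ y \<le> (\<mu> (lev x) + 1) ^ Suc (length w)" by linarith
  next
    show "(\<mu> (lev x) + 1) ^ Suc (length w) \<ge> 0" using \<mu>_pos[of "lev x"] by simp
  qed
  then show ?case by (simp only: z_Cons list.size power_Suc add_0_right add_Suc_right)
qed

lemma level_A_nz_imp: "level_A \<mu> i $ j $ x \<noteq> 0 \<Longrightarrow> f j = (SV x, i) \<and> lev x = lev j \<or> is_entry j (SV x, i) \<and> lev x < lev j"
  using ent_state[of j x i] by (auto simp: level_A_def is_entry_def split: if_splits)

text \<open>A covector travels from heads to tails, hence within levels or downwards: its support
  never climbs.\<close>

lemma v_level_A_above:
  assumes "\<And>j. lev j \<ge> K \<Longrightarrow> q $ j = 0" and "lev x \<ge> K"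
  shows "(q v* level_A \<mu> i) $ x = 0"
proof -
  have "q $ j * level_A \<mu> i $ j $ x = 0" for j
    using level_A_nz_imp[of i j x] assms(1)[of j] assms(2) by (cases "level_A \<mu> i $ j $ x = 0") auto
  then show ?thesis by (auto simp: vector_matrix_mult_def intro!: sum.neutral)
qed

text \<open>On the highest level of the support only matching edges count, since entry edges carry a
  covector strictly lower; injectivity of \<open>f\<close> leaves one head per tail and
  colour.\<close>

lemma v_level_A_matched:
  assumes "\<And>j. lev j > k \<Longrightarrow> q $ j = 0" and "f j = (SV x, i)" and "lev j = k" and "lev x = k"
  shows "(q v* level_A \<mu> i) $ x = \<mu> k * q $ j"
proof -
  have "q $ l * level_A \<mu> i $ l $ x = (if l = j then \<mu> k * q $ j else 0)" for l
  proof (cases "l = j")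
    case True
    have "\<not> is_entry j (SV x, i)" using ent_state[of j x i] assms(3,4) by (auto simp: is_entry_def)
    then show ?thesis using True assms by (simp add: level_A_def)
  next
    case False
    then have "f l \<noteq> (SV x, i)" using assms(2) f_eq_iff[of l j] by auto
    then show ?thesis using level_A_nz_imp[of i l x] assms(1)[of l] assms(4) False by (cases "level_A \<mu> i $ l $ x = 0") auto
  qed
  then show ?thesis by (simp add: vector_matrix_mult_def)
qed

lemma v_level_A_unmatched:
  assumes "\<And>j. lev j > k \<Longrightarrow> q $ j = 0" and "lev x = k" and "\<not> (\<exists>j. f j = (SV x, i) \<and> lev j = k)"
  shows "(q v* level_A \<mu> i) $ x = 0"
proof -
  have "q $ l * level_A \<mu> i $ l $ x = 0" for l
    using level_A_nz_imp[of i l x] assms(1)[of l] assms(2,3) by (cases "level_A \<mu> i $ l $ x = 0") auto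
  then show ?thesis by (auto simp: vector_matrix_mult_def intro!: sum.neutral)
qed

text \<open>Lower coordinates grow by at most the row sums of the levels below \<open>k\<close>.
  Level \<open>k\<close> feeds into them only through the entry edge of its top, which accounts for
  the summand 1.\<close>

lemma v_level_A_low_norm:
  assumes above: "\<And>j. lev j > k \<Longrightarrow> q $ j = 0" and k: "k > 0"
    and one: "\<And>j. lev j = k \<Longrightarrow> \<bar>q $ j\<bar> \<le> 1"
  shows "(\<Sum>x | lev x < k. \<bar>(q v* level_A \<mu> i) $ x\<bar>) \<le> (\<mu> (k - 1) + 1) * (\<Sum>x | lev x < k. \<bar>q $ x\<bar>) + 1"
proof -
  let ?L = "{x. lev x < k}"
  let ?R = "\<lambda>j. \<Sum>x\<in>?L. \<bar>q $ j\<bar> * level_A \<mu> i $ j $ x"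
  have "(\<Sum>x\<in>?L. \<bar>(q v* level_A \<mu> i) $ x\<bar>) \<le> (\<Sum>x\<in>?L. \<Sum>j\<in>UNIV. \<bar>q $ j\<bar> * level_A \<mu> i $ j $ x)"
  proof (rule sum_mono)
    fix x
    have "\<bar>(q v* level_A \<mu> i) $ x\<bar> \<le> (\<Sum>j\<in>UNIV. \<bar>q $ j * level_A \<mu> i $ j $ x\<bar>)"
      by (simp add: vector_matrix_mult_def sum_abs)
    then show "\<bar>(q v* level_A \<mu> i) $ x\<bar> \<le> (\<Sum>j\<in>UNIV. \<bar>q $ j\<bar> * level_A \<mu> i $ j $ x)"
      by (simp add: abs_mult level_A_nonneg)
  qed
  also have "\<dots> = (\<Sum>j\<in>UNIV. ?R j)" by (rule sum.swap)
  also have "\<dots> = (\<Sum>j\<in>?L. ?R j) + (\<Sum>j\<in>- ?L. ?R j)"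
    by (simp add: sum.union_disjoint[symmetric] Compl_partition flip: Compl_eq)
  also have "(\<Sum>j\<in>?L. ?R j) \<le> (\<mu> (k - 1) + 1) * (\<Sum>x\<in>?L. \<bar>q $ x\<bar>)"
    unfolding sum_distrib_left
  proof (rule sum_mono)
    fix j assume "j \<in> ?L"
    then have "\<mu> (lev j) \<le> \<mu> (k - 1)" by (intro monoD[OF \<mu>_mono]) auto
    have "?R j = \<bar>q $ j\<bar> * (\<Sum>x\<in>?L. level_A \<mu> i $ j $ x * 1)" by (simp add: sum_distrib_left)
    also have "\<dots> \<le> \<bar>q $ j\<bar> * ((\<mu> (lev j) + 1) * 1)"
      by (intro mult_left_mono level_A_row_sum_le) auto
    also have "\<dots> \<le> \<bar>q $ j\<bar> * (\<mu> (k - 1) + 1)"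
      using \<open>\<mu> (lev j) \<le> \<mu> (k - 1)\<close> by (intro mult_left_mono) auto
    finally show "?R j \<le> (\<mu> (k - 1) + 1) * \<bar>q $ j\<bar>" by (simp add: mult.commute)
  qed
  also have "(\<Sum>j\<in>- ?L. ?R j) \<le> 1"
  proof -
    have "?R j \<le> (if j = top k then 1 else 0)" if j: "j \<in> - ?L" for j
    proof (cases "lev j = k")
      case True
      have eq: "\<bar>q $ j\<bar> * level_A \<mu> i $ j $ x = (if is_entry j (SV x, i) then \<bar>q $ j\<bar> else 0)" if "x \<in> ?L" for x
        using that True by (simp add: level_A_def)
      have "?R j = (\<Sum>x\<in>?L. if is_entry j (SV x, i) then \<bar>q $ j\<bar> else 0)" by (rule sum.cong) (simp_all add: eq)
      also have "\<dots> \<le> (if j = top k then 1 else 0)"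
        by (rule sum_subsingleton_le) (use one[OF True] True in \<open>auto simp: is_entry_def\<close>)
      finally show ?thesis .
    next
      case False
      then have "q $ j = 0" using above[of j] j by simp
      then show ?thesis by simp
    qed
    then have "(\<Sum>j\<in>- ?L. ?R j) \<le> (\<Sum>j\<in>- ?L. if j = top k then 1 else 0)" by (rule sum_mono)
    also have "\<dots> \<le> 1" by (rule sum_subsingleton_le) auto
    finally show ?thesis .
  qed
  finally show ?thesis by simp
qed

lemma annihilated_mprod:
  assumes W: "annihilated \<mu> W"
  shows "q \<in> W \<Longrightarrow> set w \<subseteq> {1..N} \<Longrightarrow> q v* mprod (level_A \<mu>) w \<in> W"
proof (induction w arbitrary: q)
  case (Cons i w)
  then have "q v* level_A \<mu> i \<in> W" using W by (simp add: annihilated_def)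
  from Cons.IH[OF this] Cons.prems(2) show ?case by (simp add: vector_matrix_mul_assoc)
qed simp

lemma annihilated_z:
  assumes "annihilated \<mu> W" "q \<in> W" "walk i0 r0 w x"
  shows "q \<bullet> z i0 r0 w = 0"
proof -
  note v = walk_valid[OF assms(3)]
  have "q v* mprod (level_A \<mu>) w \<in> W" using annihilated_mprod[OF assms(1,2)] v by simp
  then have "(q v* mprod (level_A \<mu>) w) \<bullet> level_B \<mu> i0 r0 = 0" using assms(1) v by (simp add: annihilated_def)
  then show ?thesis by (simp only: dot_lmul_matrix)
qed

lemma cyclic_parent:
  assumes "cyclic k" "lev y = k"
  shows "\<exists>y' c. f y = (SV y', c) \<and> lev y' = k"
proof -
  have k: "k > 0" using assms(1) by (simp add: cyclic_def)
  obtain a where a: "(parent f ^^ a) (SV y) = SV (top k)" and t: "lev (top k) = k"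
    using lev_pos[of y] assms(2) k by auto
  show ?thesis
  proof (cases a)
    case 0
    then show ?thesis using a assms(1) by (auto simp: cyclic_def)
  next
    case (Suc b)
    have *: "(parent f ^^ b) (fst (f y)) = SV (top k)" using a Suc by (simp add: funpow_Suc_right del: funpow.simps)
    show ?thesis
    proof (cases "fst (f y)")
      case (SV y')
      then have fy: "f y = (SV y', snd (f y))" by (simp add: prod_eq_iff)
      have "lev y' \<le> k" using parent_chain_mono[of b y' "top k"] * SV t by simp
      moreover have "k \<le> lev y'" using f_state[OF fy] assms(2) by simp
      ultimately have "lev y' = k" by simp
      with fy show ?thesis by blast
    next
      case (IV c r)
      then show ?thesis using * parent_funpow_input[of "IV c r" b f] by simp
    qed
  qed
qed

text \<open>
  Following the matching cycle of level \<open>k\<close> backwards multiplies the coordinates of level \<open>k\<close> by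
  \<open>\<mu> k\<close> but those of lower levels by at most \<open>\<mu> (k - 1) + 1\<close>, so after renormalisation the latter
  become negligible.
\<close>

lemma cyclic_backtrack:
  assumes W: "annihilated \<mu> W" and cyc: "cyclic k" and big: "\<mu> k \<ge> 2 * (\<mu> (k - 1) + 1)"
    and q: "q \<in> W" "\<And>j. lev j > k \<Longrightarrow> q $ j = 0" "\<And>j. lev j = k \<Longrightarrow> \<bar>q $ j\<bar> \<le> 1"
    and y: "lev y = k" "q $ y = 1"
  shows "\<exists>y' q'. (parent f ^^ s) (SV y) = SV y' \<and> lev y' = k \<and> q' \<in> W \<and> (\<forall>j. lev j > k \<longrightarrow> q' $ j = 0) \<and>
    (\<forall>j. lev j = k \<longrightarrow> \<bar>q' $ j\<bar> \<le> 1) \<and> q' $ y' = 1 \<and>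
    (\<Sum>x | lev x < k. \<bar>q' $ x\<bar>) \<le> (\<Sum>x | lev x < k. \<bar>q $ x\<bar>) / 2 ^ s + 2 / \<mu> k"
proof (induction s)
  case 0
  show ?case using q y \<mu>_pos[of k] by (intro exI[of _ y] exI[of _ q]) auto
next
  case (Suc s)
  then obtain y1 q1 where y1: "(parent f ^^ s) (SV y) = SV y1" "lev y1 = k" "q1 $ y1 = 1"
    and q1: "q1 \<in> W" "\<And>j. lev j > k \<Longrightarrow> q1 $ j = 0" "\<And>j. lev j = k \<Longrightarrow> \<bar>q1 $ j\<bar> \<le> 1"
    and n1: "(\<Sum>x | lev x < k. \<bar>q1 $ x\<bar>) \<le> (\<Sum>x | lev x < k. \<bar>q $ x\<bar>) / 2 ^ s + 2 / \<mu> k" by blast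
  have k: "k > 0" using cyc by (simp add: cyclic_def)
  from cyclic_parent[OF cyc y1(2)] obtain y2 c where y2: "f y1 = (SV y2, c)" "lev y2 = k" by blast
  have c: "c \<in> {1..N}" using f_state[OF y2(1)] by simp
  define q2 where "q2 = (1 / \<mu> k) *\<^sub>R (q1 v* level_A \<mu> c)"
  have pos: "\<mu> k > 0" by (rule \<mu>_pos)
  have "q1 v* level_A \<mu> c \<in> W" using W q1(1) c by (simp add: annihilated_def)
  then have q2W: "q2 \<in> W" using W by (simp add: annihilated_def q2_def)
  have above: "q2 $ j = 0" if "lev j > k" for j
    using v_level_A_above[of "Suc k" q1 j c] q1(2) that by (simp add: q2_def Suc_le_eq)
  have level: "\<bar>q2 $ j\<bar> \<le> 1" if j: "lev j = k" for j
  proof (cases "\<exists>l. f l = (SV j, c) \<and> lev l = k")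
    case True
    then obtain l where l: "f l = (SV j, c)" "lev l = k" by blast
    have "q2 $ j = q1 $ l" using v_level_A_matched[OF q1(2) l j] pos by (simp add: q2_def)
    then show ?thesis using q1(3)[OF l(2)] by simp
  next
    case False
    then show ?thesis using v_level_A_unmatched[OF q1(2) j False] by (simp add: q2_def)
  qed
  have top1: "q2 $ y2 = 1" using v_level_A_matched[OF q1(2) y2(1) y1(2) y2(2)] pos y1(3) by (simp add: q2_def)
  let ?n = "\<lambda>q. \<Sum>x | lev x < k. \<bar>q $ x\<bar>"
  have "?n q2 = (1 / \<mu> k) * ?n (q1 v* level_A \<mu> c)"
    using pos by (simp add: q2_def abs_mult sum_distrib_left)
  also have "\<dots> \<le> (1 / \<mu> k) * ((\<mu> (k - 1) + 1) * ?n q1 + 1)"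
    using pos v_level_A_low_norm[OF q1(2) k q1(3)] by (intro mult_left_mono) auto
  also have "\<dots> = (\<mu> (k - 1) + 1) / \<mu> k * ?n q1 + 1 / \<mu> k" using pos by (simp add: field_simps)
  \<comment> \<open>\<open>big\<close> bounds the factor by \<open>1 / 2\<close>; the term
    \<open>2 / \<mu> k\<close> in the claim is the fixed point of
    \<open>t / 2 + 1 / \<mu> k\<close>.\<close>
  also have "\<dots> \<le> 1 / 2 * ?n q1 + 1 / \<mu> k"
    using pos big by (intro add_right_mono mult_right_mono) (auto simp: field_simps intro: sum_nonneg)
  also have "\<dots> \<le> 1 / 2 * (?n q / 2 ^ s + 2 / \<mu> k) + 1 / \<mu> k" using n1 by simp
  also have "\<dots> = ?n q / 2 ^ Suc s + 2 / \<mu> k" by (simp add: field_simps)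
  finally have n2: "?n q2 \<le> ?n q / 2 ^ Suc s + 2 / \<mu> k" .
  have "(parent f ^^ Suc s) (SV y) = SV y2" using y1(1) y2(1) by simp
  with y2(2) q2W above level top1 n2 show ?case by blast
qed

text \<open>
  A shortest word leading from an input to the entry state of the level produces a vector whose
  only coordinate on level \<open>k\<close> is that of the entry state, and which does not depend on \<open>\<mu> k\<close>.
\<close>

lemma cyclic_level_zero:
  assumes W: "annihilated \<mu> W" and cyc: "cyclic k"
    and w: "walk i0 r0 w (top k)" "\<And>w'. walk i0 r0 w' (top k) \<Longrightarrow> length w \<le> length w'"
    and big: "\<mu> k \<ge> 4 * (\<mu> (k - 1) + 1) ^ Suc (length w)"
    and q: "q \<in> W" "\<And>j. lev j > k \<Longrightarrow> q $ j = 0" and x: "lev x = k"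
  shows "q $ x = 0"
proof (rule ccontr)
  assume nz: "q $ x \<noteq> 0"
  have k: "k > 0" using cyc by (simp add: cyclic_def)
  let ?a = "\<mu> (k - 1) + 1"
  let ?n = "\<lambda>q. \<Sum>x | lev x < k. \<bar>q $ x\<bar>"
  have a: "?a \<ge> 1" using \<mu>_pos[of "k - 1"] by simp
  then have "?a ^ 1 \<le> ?a ^ Suc (length w)" by (intro power_increasing) auto
  then have "?a \<le> ?a ^ Suc (length w)" by (simp only: power_one_right)
  then have "4 * ?a \<le> 4 * ?a ^ Suc (length w)" by (rule mult_left_mono) simp
  then have "4 * ?a \<le> \<mu> k" using big by (rule order_trans)
  moreover have "2 * ?a \<le> 4 * ?a" using a by (intro mult_right_mono) auto
  ultimately have big2: "\<mu> k \<ge> 2 * ?a" by (rule order_trans[rotated])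
  \<comment> \<open>Dividing by the largest coordinate of level \<open>k\<close> bounds the others
    by 1, as backtracking requires.\<close>
  define M where "M = Max ((\<lambda>y. \<bar>q $ y\<bar>) ` {y. lev y = k})"
  have Mge: "\<bar>q $ y\<bar> \<le> M" if "lev y = k" for y using that unfolding M_def by (intro Max_ge) auto
  have "M \<in> (\<lambda>y. \<bar>q $ y\<bar>) ` {y. lev y = k}" unfolding M_def using x by (intro Max_in) auto
  then obtain y where y: "lev y = k" "M = \<bar>q $ y\<bar>" by blast
  have M: "M > 0" using Mge[OF x] nz by simp
  then have qy: "q $ y \<noteq> 0" using y(2) by auto
  define q1 where "q1 = (1 / q $ y) *\<^sub>R q"
  have q1: "q1 \<in> W" using W q(1) by (simp add: annihilated_def q1_def)
  have q1a: "q1 $ j = 0" if "lev j > k" for j using q(2)[OF that] by (simp add: q1_def)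
  have q1l: "\<bar>q1 $ j\<bar> \<le> 1" if "lev j = k" for j
    using Mge[OF that] y(2) M by (simp add: q1_def abs_mult field_simps)
  have q1y: "q1 $ y = 1" using qy by (simp add: q1_def)
  have \<mu>k: "\<mu> k > 0" by (rule \<mu>_pos)
  \<comment> \<open>\<open>S\<close> backward steps bring the initial lower part below
    \<open>1 / \<mu> k\<close>, and \<open>b\<close> further steps lead to the top, where the
    coordinate 1 is wanted. With the residue \<open>2 / \<mu> k\<close> this leaves
    \<open>3 / \<mu> k\<close>.\<close>
  obtain S where S: "?n q1 * \<mu> k < 2 ^ S" using real_arch_pow[of 2 "?n q1 * \<mu> k"] by auto
  obtain y2 where y2: "(parent f ^^ S) (SV y) = SV y2" "lev y2 = k"
    using cyclic_backtrack[OF W cyc big2 q1 q1a q1l y(1) q1y, of S] by blast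
  obtain b where b: "(parent f ^^ b) (SV y2) = SV (top k)" and t: "lev (top k) = k"
    using lev_pos[of y2] y2(2) k by auto
  have "(parent f ^^ (b + S)) (SV y) = SV (top k)" using b y2(1) by (simp add: funpow_add)
  then obtain q2 where q2: "q2 \<in> W" "\<And>j. lev j > k \<Longrightarrow> q2 $ j = 0" "q2 $ top k = 1"
    and n2: "?n q2 \<le> ?n q1 / 2 ^ (b + S) + 2 / \<mu> k"
    using cyclic_backtrack[OF W cyc big2 q1 q1a q1l y(1) q1y, of "b + S"] by auto
  have n1: "?n q1 \<ge> 0" by (intro sum_nonneg) auto
  have "?n q1 / 2 ^ (b + S) \<le> ?n q1 / 2 ^ S" using n1 by (intro divide_left_mono) auto
  also have "\<dots> \<le> 1 / \<mu> k" using S \<mu>k by (simp add: field_simps)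
  finally have n3: "?n q2 \<le> 3 / \<mu> k" using n2 by (simp add: add_divide_distrib[symmetric])
  have zt: "z i0 r0 w $ y = 0" if "lev y = k" "y \<noteq> top k" for y
  proof (rule z_eq_0)
    show "\<not> walk i0 r0 w y"
    proof
      assume "walk i0 r0 w y"
      from walk_via_top[OF this] that k obtain w' where "length w' < length w" "walk i0 r0 w' (top k)" by auto
      with w(2)[of w'] show False by simp
    qed
  qed
  have zl: "z i0 r0 w $ y \<le> ?a ^ Suc (length w)" if "lev y < k" for y
  proof -
    have "\<mu> (lev y) \<le> \<mu> (k - 1)" using that by (intro monoD[OF \<mu>_mono]) simp
    then have "(\<mu> (lev y) + 1) ^ Suc (length w) \<le> ?a ^ Suc (length w)"
      using \<mu>_pos[of "lev y"] by (intro power_mono) auto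
    with z_le[of w i0 r0 y] show ?thesis by linarith
  qed
  have split: "q2 $ y * z i0 r0 w $ y \<ge> (if lev y < k then - (\<bar>q2 $ y\<bar> * ?a ^ Suc (length w)) else 0)
      + (if y = top k then 1 else 0)" for y
  proof -
    consider "lev y < k" | "lev y = k" "y = top k" | "lev y = k" "y \<noteq> top k" | "lev y > k" by linarith
    then show ?thesis
    proof cases
      case 1
      have "\<bar>q2 $ y * z i0 r0 w $ y\<bar> \<le> \<bar>q2 $ y\<bar> * ?a ^ Suc (length w)"
        unfolding abs_mult using zl[OF 1] z_nonneg[of w i0 r0 y] by (intro mult_left_mono) auto
      then show ?thesis using 1 t by auto
    next
      case 2
      then show ?thesis using q2(3) z_ge_1[OF w(1)] by simp
    next
      case 3
      then show ?thesis using zt by simp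
    next
      case 4
      then show ?thesis using q2(2) t by auto
    qed
  qed
  \<comment> \<open>The top contributes at least 1, the lower levels at most
    \<open>3 / \<mu> k * ?a ^ Suc (length w)\<close> in absolute value; the factor 4 in
    \<open>big\<close> makes this less than 1.\<close>
  have "0 = q2 \<bullet> z i0 r0 w" using annihilated_z[OF W q2(1) w(1)] by simp
  also have "\<dots> = (\<Sum>y\<in>UNIV. q2 $ y * z i0 r0 w $ y)" by (simp add: inner_vec_def)
  also have "\<dots> \<ge> (\<Sum>y\<in>UNIV. (if lev y < k then - (\<bar>q2 $ y\<bar> * ?a ^ Suc (length w)) else 0)
      + (if y = top k then 1 else 0))" by (intro sum_mono split)
  also have "(\<Sum>y\<in>UNIV. (if lev y < k then - (\<bar>q2 $ y\<bar> * ?a ^ Suc (length w)) else 0)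
      + (if y = top k then 1 else 0)) = 1 - ?n q2 * ?a ^ Suc (length w)"
    by (simp add: sum.distrib sum.If_cases sum_negf sum_distrib_right)
  finally have "1 \<le> ?n q2 * ?a ^ Suc (length w)" by simp
  also have "\<dots> \<le> 3 / \<mu> k * ?a ^ Suc (length w)" using n3 a by (intro mult_right_mono) auto
  finally have "\<mu> k \<le> 3 * ?a ^ Suc (length w)" using \<mu>k by (simp add: field_simps)
  from order_trans[OF big this] have "?a ^ Suc (length w) \<le> 0" by simp
  moreover have "?a ^ Suc (length w) > 0" using a by (intro zero_less_power) simp
  ultimately show False by (rule leD[THEN notE])
qed

text \<open>On level 0 the chain ends in an input. On another acyclic level it passes the top and
  then moves to higher levels for good.\<close>

lemma acyclic_level_bound:
  assumes "\<not> cyclic k"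
  shows "\<exists>s. \<forall>j. lev j = k \<longrightarrow> (\<forall>t x. t \<ge> s \<longrightarrow> (parent f ^^ t) (SV j) = SV x \<longrightarrow> lev x \<noteq> k)"
proof -
  have "\<exists>s. \<forall>t x. t \<ge> s \<longrightarrow> (parent f ^^ t) (SV j) = SV x \<longrightarrow> lev x \<noteq> k" if j: "lev j = k" for j
  proof (cases "k = 0")
    case True
    then obtain a where a: "is_input ((parent f ^^ a) (SV j))" using lev_zero[of j] j by auto
    have "(parent f ^^ t) (SV j) \<noteq> SV x" if "t \<ge> a" for t x
      using input_absorbing[OF a that] a by auto
    then show ?thesis by blast
  next
    case False
    then obtain a where a: "(parent f ^^ a) (SV j) = SV (top k)" and t: "lev (top k) = k"
      using lev_pos[of j] j by auto
    have "lev x \<noteq> k" if "t \<ge> Suc a" "(parent f ^^ t) (SV j) = SV x" for t x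
    proof -
      have "t = (t - Suc a) + Suc a" using that(1) by simp
      then have "(parent f ^^ t) (SV j) = (parent f ^^ (t - Suc a)) ((parent f ^^ Suc a) (SV j))"
        by (metis funpow_add o_apply)
      then have *: "(parent f ^^ (t - Suc a)) (fst (f (top k))) = SV x" using that(2) a by simp
      show ?thesis
      proof (cases "fst (f (top k))")
        case (SV y)
        then have fy: "f (top k) = (SV y, snd (f (top k)))" by (simp add: prod_eq_iff)
        have "lev y \<noteq> k" using assms fy False j unfolding cyclic_def by blast
        then have "k < lev y" using f_state[OF fy] t by simp
        also have "lev y \<le> lev x" using parent_chain_mono[of "t - Suc a" y x] * SV by simp
        finally show ?thesis by simp
      next
        case (IV b r)
        then show ?thesis using * parent_funpow_input[of "IV b r" "t - Suc a" f] by simp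
      qed
    qed
    then show ?thesis by blast
  qed
  then have "\<forall>j. \<exists>s. lev j = k \<longrightarrow> (\<forall>t x. t \<ge> s \<longrightarrow> (parent f ^^ t) (SV j) = SV x \<longrightarrow> lev x \<noteq> k)" by blast
  from choice[OF this] obtain s where
    s: "\<forall>j. lev j = k \<longrightarrow> (\<forall>t x. t \<ge> s j \<longrightarrow> (parent f ^^ t) (SV j) = SV x \<longrightarrow> lev x \<noteq> k)" ..
  show ?thesis
  proof (intro exI[of _ "Max (range s)"] allI impI)
    fix j t x assume j: "lev j = k" and t: "Max (range s) \<le> t" and p: "(parent f ^^ t) (SV j) = SV x"
    have "s j \<le> Max (range s)" by (intro Max_ge) auto
    then have "s j \<le> t" using t by simp
    with s j p show "lev x \<noteq> k" by blast
  qed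
qed

lemma v_mprod_above:
  assumes "\<And>j. lev j \<ge> K \<Longrightarrow> q $ j = 0" and "lev x \<ge> K"
  shows "(q v* mprod (level_A \<mu>) w) $ x = 0"
  using assms(1)
proof (induction w arbitrary: q)
  case Nil
  then show ?case using assms(2) by simp
next
  case (Cons i w)
  have "((q v* level_A \<mu> i) v* mprod (level_A \<mu>) w) $ x = 0"
    by (rule Cons.IH) (rule v_level_A_above[OF Cons.prems])
  then show ?case by (simp add: vector_matrix_mul_assoc)
qed

text \<open>On the highest level each letter moves a coordinate along one matching edge, so a
  surviving coordinate marks the end of a parent chain as long as the word.\<close>

lemma v_mprod_chain:
  assumes "(q v* mprod (level_A \<mu>) w) $ x \<noteq> 0" and "lev x = k" and "\<And>j. lev j > k \<Longrightarrow> q $ j = 0"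
  shows "\<exists>j. lev j = k \<and> q $ j \<noteq> 0 \<and> (parent f ^^ length w) (SV j) = SV x"
  using assms(1,3)
proof (induction w arbitrary: q)
  case Nil
  then show ?case using assms(2) by auto
next
  case (Cons i w)
  let ?q = "q v* level_A \<mu> i"
  have above: "?q $ j = 0" if "lev j > k" for j
    using v_level_A_above[of "Suc k" q j i] Cons.prems(2) that by (simp add: Suc_le_eq)
  have "(?q v* mprod (level_A \<mu>) w) $ x \<noteq> 0" using Cons.prems(1) by (simp add: vector_matrix_mul_assoc)
  from Cons.IH[OF this above] obtain j where j: "lev j = k" "?q $ j \<noteq> 0" "(parent f ^^ length w) (SV j) = SV x"
    by blast
  from v_level_A_unmatched[OF Cons.prems(2) j(1)] j(2) obtain l where l: "f l = (SV j, i)" "lev l = k" by blast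
  have "?q $ j = \<mu> k * q $ l" by (rule v_level_A_matched[OF Cons.prems(2) l j(1)])
  then have "q $ l \<noteq> 0" using j(2) by auto
  moreover have "(parent f ^^ length (i # w)) (SV l) = SV x"
    using l(1) j(3) by (simp add: funpow_Suc_right del: funpow.simps)
  ultimately show ?case using l(2) by blast
qed

text \<open>Levels are peeled off from the top of the support. On a cyclic level the coordinates of
  covectors in \<open>W\<close> vanish already; an acyclic level is emptied by \<open>s\<close>
  letters, and the remaining \<open>K\<close> letters fall to the induction hypothesis.\<close>

lemma annihilated_nilpotent_below:
  assumes W: "annihilated \<mu> W"
    and big: "\<And>k. cyclic k \<Longrightarrow> \<exists>i0 r0 w. walk i0 r0 w (top k) \<and>
      (\<forall>w'. walk i0 r0 w' (top k) \<longrightarrow> length w \<le> length w') \<and> \<mu> k \<ge> 4 * (\<mu> (k - 1) + 1) ^ Suc (length w)"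
  shows "\<exists>K. \<forall>q u. q \<in> W \<longrightarrow> (\<forall>j. lev j \<ge> k \<longrightarrow> q $ j = 0) \<longrightarrow> set u \<subseteq> {1..N} \<longrightarrow> length u \<ge> K
    \<longrightarrow> q v* mprod (level_A \<mu>) u = 0"
proof (induction k)
  case 0
  have "q v* mprod (level_A \<mu>) u = 0" if "\<forall>j. lev j \<ge> 0 \<longrightarrow> q $ j = 0" for q u
  proof -
    have "q = 0" using that by (simp add: vec_eq_iff)
    then show ?thesis by simp
  qed
  then show ?case by blast
next
  case (Suc k)
  then obtain K where K: "\<And>q u. q \<in> W \<Longrightarrow> (\<And>j. lev j \<ge> k \<Longrightarrow> q $ j = 0) \<Longrightarrow> set u \<subseteq> {1..N} \<Longrightarrow> length u \<ge> K
    \<Longrightarrow> q v* mprod (level_A \<mu>) u = 0" by blast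
  show ?case
  proof (cases "cyclic k")
    case True
    from big[OF True] obtain i0 r0 w where w: "walk i0 r0 w (top k)"
      "\<And>w'. walk i0 r0 w' (top k) \<Longrightarrow> length w \<le> length w'" "\<mu> k \<ge> 4 * (\<mu> (k - 1) + 1) ^ Suc (length w)"
      by blast
    have "q v* mprod (level_A \<mu>) u = 0" if q: "q \<in> W" "\<forall>j. lev j \<ge> Suc k \<longrightarrow> q $ j = 0"
      and u: "set u \<subseteq> {1..N}" "length u \<ge> K" for q u
    proof (rule K[OF q(1) _ u])
      fix j assume "lev j \<ge> k"
      have above: "q $ l = 0" if "lev l > k" for l using q(2) that by (simp add: Suc_le_eq)
      show "q $ j = 0"
      proof (cases "lev j = k")
        case True
        show ?thesis by (rule cyclic_level_zero[OF W \<open>cyclic k\<close> w q(1) above True])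
      next
        case False
        then show ?thesis using above[of j] \<open>lev j \<ge> k\<close> by simp
      qed
    qed
    then show ?thesis by blast
  next
    case False
    from acyclic_level_bound[OF this] obtain s where
      s: "\<And>j t x. lev j = k \<Longrightarrow> t \<ge> s \<Longrightarrow> (parent f ^^ t) (SV j) = SV x \<Longrightarrow> lev x \<noteq> k" by blast
    have "q v* mprod (level_A \<mu>) u = 0" if q: "q \<in> W" "\<forall>j. lev j \<ge> Suc k \<longrightarrow> q $ j = 0"
      and u: "set u \<subseteq> {1..N}" "length u \<ge> s + K" for q u
    proof -
      let ?v = "take s u" and ?w = "drop s u"
      let ?q = "q v* mprod (level_A \<mu>) ?v"
      have above: "q $ l = 0" if "lev l > k" for l using q(2) that by (simp add: Suc_le_eq)
      have sets: "set ?v \<subseteq> {1..N}" "set ?w \<subseteq> {1..N}" using u(1) set_take_subset[of s u] set_drop_subset[of s u] by auto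
      have "?q $ j = 0" if j: "lev j \<ge> k" for j
      proof (cases "lev j = k")
        case True
        show ?thesis
        proof (rule ccontr)
          assume "?q $ j \<noteq> 0"
          from v_mprod_chain[OF this True above] obtain l where "lev l = k" "(parent f ^^ length ?v) (SV l) = SV j" by blast
          with s[of l "length ?v" j] True u(2) show False by simp
        qed
      next
        case False
        then show ?thesis using v_mprod_above[of "Suc k" q j ?v] q(2) j by simp
      qed
      moreover have "?q \<in> W" by (rule annihilated_mprod[OF W q(1) sets(1)])
      ultimately have "?q v* mprod (level_A \<mu>) ?w = 0" using K[of ?q ?w] sets(2) u(2) by simp
      then have "q v* mprod (level_A \<mu>) (?v @ ?w) = 0" by (simp only: mprod_append vector_matrix_mul_assoc)
      then show ?thesis by simp
    qed
    then show ?thesis by blast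
  qed
qed

end

lemma exists_weights_nilpotent:
  "\<exists>\<mu>. (\<forall>k. \<mu> k \<ge> 1) \<and> mono \<mu> \<and> (\<forall>W. annihilated \<mu> W \<longrightarrow>
     (\<exists>K. \<forall>q u. q \<in> W \<longrightarrow> set u \<subseteq> {1..N} \<longrightarrow> length u \<ge> K \<longrightarrow> q v* mprod (level_A \<mu>) u = 0))"
proof -
  define Q where "Q k i0 r0 w \<longleftrightarrow> walk i0 r0 w (top k) \<and> (\<forall>w'. walk i0 r0 w' (top k) \<longrightarrow> length w \<le> length w')"
    for k i0 r0 w
  have "\<exists>l i0 r0 w. length w = l \<and> Q k i0 r0 w" for k
  proof -
    obtain i0 r0 v where v: "walk i0 r0 v (top k)" using walk_exists by blast
    from ex_has_least_nat[of "\<lambda>w. walk i0 r0 w (top k)", OF v, of length]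
    obtain w where "Q k i0 r0 w" unfolding Q_def by blast
    then show ?thesis by (intro exI[of _ "length w"] exI[of _ i0] exI[of _ r0] exI[of _ w]) simp
  qed
  then have "\<forall>k. \<exists>l. \<exists>i0 r0 w. length w = l \<and> Q k i0 r0 w" by blast
  from choice[OF this] obtain L where L: "\<forall>k. \<exists>i0 r0 w. length w = L k \<and> Q k i0 r0 w" ..
  \<comment> \<open>The lengths \<open>L\<close> depend on the graph alone, so this recursion is not
    circular; it imposes exactly the inequality that cyclic levels require.\<close>
  define \<mu> where "\<mu> = rec_nat (1 :: real) (\<lambda>k x. 4 * (x + 1) ^ Suc (L (Suc k)))"
  have \<mu>0: "\<mu> 0 = 1" and \<mu>S: "\<mu> (Suc k) = 4 * (\<mu> k + 1) ^ Suc (L (Suc k))" for k by (simp_all add: \<mu>_def)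
  have ge1: "\<mu> k \<ge> 1" for k
  proof (induction k)
    case (Suc k)
    then have "1 \<le> (\<mu> k + 1) ^ Suc (L (Suc k))" by (intro one_le_power) simp
    then have "4 * 1 \<le> \<mu> (Suc k)" unfolding \<mu>S by (rule mult_left_mono) simp
    then show ?case by simp
  qed (simp add: \<mu>0)
  have mono: "mono \<mu>"
  proof (rule monoI, rule lift_Suc_mono_le[of \<mu>])
    fix k
    have "(\<mu> k + 1) ^ 1 \<le> (\<mu> k + 1) ^ Suc (L (Suc k))" using ge1[of k] by (intro power_increasing) auto
    then have "\<mu> k + 1 \<le> (\<mu> k + 1) ^ Suc (L (Suc k))" by (simp only: power_one_right)
    then have "4 * (\<mu> k + 1) \<le> \<mu> (Suc k)" unfolding \<mu>S by (rule mult_left_mono) simp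
    then show "\<mu> k \<le> \<mu> (Suc k)" using ge1[of k] by simp
  qed
  have big: "\<exists>i0 r0 w. walk i0 r0 w (top k) \<and> (\<forall>w'. walk i0 r0 w' (top k) \<longrightarrow> length w \<le> length w') \<and>
      \<mu> k \<ge> 4 * (\<mu> (k - 1) + 1) ^ Suc (length w)" if "cyclic k" for k
  proof -
    have "k > 0" using that unfolding cyclic_def by blast
    then obtain k' where k': "k = Suc k'" by (cases k) auto
    from spec[OF L, of k] obtain i0 r0 w where w: "length w = L k" "Q k i0 r0 w" by blast
    have "4 * (\<mu> (k - 1) + 1) ^ Suc (length w) \<le> \<mu> k" unfolding w(1) by (simp only: k' \<mu>S diff_Suc_1 order_refl)
    with w(2) show ?thesis unfolding Q_def by blast
  qed
  have "\<exists>K. \<forall>q u. q \<in> W \<longrightarrow> set u \<subseteq> {1..N} \<longrightarrow> length u \<ge> K \<longrightarrow> q v* mprod (level_A \<mu>) u = 0"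
    if "annihilated \<mu> W" for W
  proof -
    have "lev j < Suc (Max (range lev))" for j by (simp add: less_Suc_eq_le)
    then have "\<not> lev j \<ge> Suc (Max (range lev))" for j by (simp add: not_le)
    with annihilated_nilpotent_below[OF ge1 mono that big, of "Suc (Max (range lev))"] show ?thesis by blast
  qed
  with ge1 mono show ?thesis by blast
qed

end

section \<open>Traces of words along matching cycles\<close>

text \<open>Powers of a self-map of a finite set are eventually periodic; multiples of the period
  beyond the preperiod give idempotents. \<open>d\<close> does not depend on \<open>t\<close>, which
  permits arbitrarily long words.\<close>

lemma powers_eventually_idempotent:
  fixes G :: "'a::finite \<Rightarrow> 'a"
  shows "\<exists>d>0. \<forall>t>0. (G ^^ (d * t + d * t)) = (G ^^ (d * t))"
proof -
  have "finite (range (\<lambda>r. G ^^ r))" by (rule finite_subset[OF subset_UNIV]) simp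
  then have "\<not> inj (\<lambda>r. G ^^ r)" using finite_imageD infinite_UNIV_nat by blast
  then obtain a b where ab: "a < b" "(G ^^ a) = (G ^^ b)" unfolding inj_on_def by (metis linorder_neqE_nat)
  define p where "p = b - a"
  have p: "p > 0" using ab by (simp add: p_def)
  have step: "(G ^^ (n + p)) = (G ^^ n)" if "n \<ge> a" for n
  proof -
    have e: "n + p = (n - a) + b" "n = (n - a) + a" using that ab(1) by (simp_all add: p_def)
    have "(G ^^ (n + p)) = (G ^^ (n - a)) \<circ> (G ^^ b)" unfolding e(1) by (rule funpow_add)
    also have "\<dots> = (G ^^ ((n - a) + a))" unfolding ab(2)[symmetric] by (rule funpow_add[symmetric])
    finally show ?thesis unfolding e(2)[symmetric] .
  qed
  have steps: "(G ^^ (n + p * t)) = (G ^^ n)" if "n \<ge> a" for n t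
  proof (induction t)
    case (Suc t)
    have "(G ^^ (n + p * Suc t)) = (G ^^ (n + p * t + p))" by (simp add: algebra_simps)
    also have "\<dots> = (G ^^ (n + p * t))" using that by (intro step) simp
    finally show ?case using Suc by simp
  qed simp
  show ?thesis
  proof (intro exI[of _ "p * b"] conjI allI impI)
    show "p * b > 0" using p ab(1) by simp
    fix t :: nat assume t: "t > 0"
    have "1 * b * 1 \<le> p * b * t" using p t by (intro mult_mono) auto
    then have "b \<le> p * b * t" unfolding mult_1_left mult_1_right .
    then have "a \<le> p * b * t" using ab(1) by (rule order_trans[OF less_imp_le, rotated])
    then show "(G ^^ (p * b * t + p * b * t)) = (G ^^ (p * b * t))"
      using steps[of "p * b * t" "b * t"] unfolding mult.assoc by blast
  qed
qed

lemma symmetric_matrix_entry: "transpose P = P \<Longrightarrow> P $ i $ j = P $ j $ i"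
  for P :: "real^'n^'n"
proof -
  assume "transpose P = P"
  then have "P $ i $ j = transpose P $ i $ j" by simp
  then show "P $ i $ j = P $ j $ i" by (simp only: transpose_def vec_lambda_beta)
qed

text \<open>From \<open>P = P ** transpose P\<close>: diagonal entries are squared row norms. Their
  positivity serves the trace estimate, the resulting bound by 1 the compactness argument.\<close>

lemma symmetric_idempotent_diag:
  fixes P :: "real^'n^'n"
  assumes "transpose P = P" "P ** P = P"
  shows "P $ i $ i = (\<Sum>k\<in>UNIV. (P $ i $ k)\<^sup>2)"
proof -
  have sym: "P $ k $ i = P $ i $ k" for k by (rule symmetric_matrix_entry[OF assms(1)])
  have "P $ i $ i = (P ** P) $ i $ i" using assms(2) by simp
  also have "\<dots> = (\<Sum>k\<in>UNIV. (P $ i $ k)\<^sup>2)"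
    by (simp add: matrix_matrix_mult_def sym power2_eq_square)
  finally show ?thesis .
qed

lemma symmetric_idempotent_entry:
  fixes P :: "real^'n^'n"
  assumes "transpose P = P" "P ** P = P"
  shows "(P $ i $ j)\<^sup>2 \<le> P $ i $ i" and "\<bar>P $ i $ j\<bar> \<le> 1"
proof -
  have *: "(P $ i $ j)\<^sup>2 \<le> P $ i $ i" for j
    unfolding symmetric_idempotent_diag[OF assms, of i] by (rule member_le_sum) auto
  show "(P $ i $ j)\<^sup>2 \<le> P $ i $ i" by (rule *)
  have "P $ i $ i \<le> 1"
  proof (rule ccontr)
    assume "\<not> P $ i $ i \<le> 1"
    then have "P $ i $ i * 1 < P $ i $ i * P $ i $ i" by (intro mult_strict_left_mono) auto
    with *[of i] show False by (simp add: power2_eq_square)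
  qed
  with *[of j] have "(P $ i $ j)\<^sup>2 \<le> 1" by linarith
  then show "\<bar>P $ i $ j\<bar> \<le> 1" by (simp add: abs_square_le_1)
qed

lemma trace_mult_diagonal:
  fixes P X :: "real^'n^'n"
  assumes "\<And>k j. k \<noteq> j \<Longrightarrow> X $ k $ j = 0"
  shows "trace (P ** X) = (\<Sum>j\<in>UNIV. P $ j $ j * X $ j $ j)"
proof -
  have "(P ** X) $ j $ j = P $ j $ j * X $ j $ j" for j
  proof -
    have "(P ** X) $ j $ j = (\<Sum>k\<in>UNIV. P $ j $ k * X $ k $ j)" by (simp add: matrix_matrix_mult_def)
    also have "\<dots> = (\<Sum>k\<in>UNIV. if k = j then P $ j $ j * X $ j $ j else 0)"
    proof (rule sum.cong[OF refl])
      fix k show "P $ j $ k * X $ k $ j = (if k = j then P $ j $ j * X $ j $ j else 0)"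
        using assms[of k j] by (cases "k = j") simp_all
    qed
    finally show ?thesis by simp
  qed
  then show ?thesis by (simp add: trace_def)
qed

context leveled
begin

definition match_A :: "(nat \<Rightarrow> real) \<Rightarrow> nat \<Rightarrow> real^'n^'n" where
  "match_A \<mu> i = (\<chi> j k. if f j = (SV k, i) then \<mu> (lev j) else 0)"

definition match_B :: "(nat \<Rightarrow> real) \<Rightarrow> nat \<Rightarrow> nat \<Rightarrow> real^'n" where
  "match_B \<mu> i r = (\<chi> j. if f j = (IV i r, i) then \<mu> (lev j) else 0)"

text \<open>A letter moves from a head to its matching tail if the colours agree;
  \<open>None\<close> records that the coordinate is killed.\<close>

definition back_step :: "nat \<Rightarrow> 'n option \<Rightarrow> 'n option" where
  "back_step i x = (case x of None \<Rightarrow> None | Some j \<Rightarrow>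
     (case fst (f j) of SV k \<Rightarrow> if snd (f j) = i then Some k else None | IV _ _ \<Rightarrow> None))"

primrec back_word :: "nat list \<Rightarrow> 'n option \<Rightarrow> 'n option" where
  "back_word [] x = x"
| "back_word (i # w) x = back_word w (back_step i x)"

lemma back_step_None [simp]: "back_step i None = None" by (simp add: back_step_def)

lemma back_step_Some_iff: "back_step i (Some j) = Some k \<longleftrightarrow> f j = (SV k, i)"
  by (cases "f j"; cases "fst (f j)") (auto simp: back_step_def)

lemma back_word_None [simp]: "back_word w None = None" by (induction w) auto

lemma back_word_append: "back_word (u @ w) x = back_word w (back_word u x)" by (induction u arbitrary: x) auto

lemma back_word_power: "back_word (concat (replicate r v)) x = (back_word v ^^ r) x"
  by (induction r arbitrary: x) (simp_all add: back_word_append funpow_Suc_right del: funpow.simps)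

lemma back_word_inj: "back_word w (Some j) = Some k \<Longrightarrow> back_word w (Some j') = Some k \<Longrightarrow> j = j'"
proof (induction w arbitrary: j j')
  case (Cons i w)
  obtain l where l: "back_step i (Some j) = Some l" using Cons.prems(1) by (cases "back_step i (Some j)") auto
  obtain l' where l': "back_step i (Some j') = Some l'" using Cons.prems(2) by (cases "back_step i (Some j')") auto
  have "l = l'" using Cons.IH[of l l'] Cons.prems l l' by simp
  then have "f j = f j'" using l l' by (simp add: back_step_Some_iff)
  then show ?case by (simp add: f_eq_iff)
qed simp

lemma mprod_match_A_pos_iff:
  assumes "\<And>k. \<mu> k > 0"
  shows "mprod (match_A \<mu>) w $ j $ k \<ge> 0 \<and> (mprod (match_A \<mu>) w $ j $ k > 0 \<longleftrightarrow> back_word w (Some j) = Some k)"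
proof (induction w arbitrary: j)
  case Nil
  show ?case by (auto simp: mat_def)
next
  case (Cons i w)
  have e: "mprod (match_A \<mu>) (i # w) $ j $ k = (\<Sum>l\<in>UNIV. match_A \<mu> i $ j $ l * mprod (match_A \<mu>) w $ l $ k)"
    by (simp add: matrix_matrix_mult_def)
  show ?case
  proof (cases "back_step i (Some j)")
    case None
    then have "match_A \<mu> i $ j $ l = 0" for l using back_step_Some_iff[of i j l] by (simp add: match_A_def)
    then show ?thesis unfolding e using None by simp
  next
    case (Some l)
    then have fj: "f j = (SV l, i)" by (simp add: back_step_Some_iff)
    have "match_A \<mu> i $ j $ l' * mprod (match_A \<mu>) w $ l' $ k = (if l' = l then \<mu> (lev j) * mprod (match_A \<mu>) w $ l $ k else 0)" for l'
      by (simp add: match_A_def fj)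
    then have "mprod (match_A \<mu>) (i # w) $ j $ k = \<mu> (lev j) * mprod (match_A \<mu>) w $ l $ k" unfolding e by simp
    then show ?thesis using Cons.IH[of l] Some assms[of "lev j"] by (simp add: zero_less_mult_iff)
  qed
qed

text \<open>
  The colour word of a matching cycle acts as a weighted partial injection; a suitable power of it
  is a nonnegative diagonal matrix, which is positive at a point of the cycle.
\<close>

lemma matching_trace_pos:
  assumes \<mu>: "\<And>k. \<mu> k > 0"
    and P: "transpose P = P" "P ** P = P"
    and inv: "\<And>i. i \<in> {1..N} \<Longrightarrow> P ** match_A \<mu> i ** P = P ** match_A \<mu> i"
    and ker: "\<And>i r. i \<in> {1..N} \<Longrightarrow> r < m i \<Longrightarrow> P *v match_B \<mu> i r = 0"
    and q0: "q0 \<noteq> 0" "P *v q0 = q0"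
  shows "\<exists>u. set u \<subseteq> {1..N} \<and> length u \<ge> K \<and> trace (P ** mprod (match_A \<mu>) u) > 0"
proof -
  define W where "W = {q. q v* P = q}"
  have WM: "q v* match_A \<mu> i \<in> W" if "q \<in> W" "i \<in> {1..N}" for q i
  proof -
    have qP: "q v* P = q" using that(1) by (simp add: W_def)
    have "q v* match_A \<mu> i = q v* (P ** match_A \<mu> i)" by (simp only: vector_matrix_mul_assoc[symmetric] qP)
    also have "\<dots> = q v* (P ** match_A \<mu> i ** P)" using inv[OF that(2)] by simp
    also have "\<dots> = (q v* match_A \<mu> i) v* P" by (simp only: vector_matrix_mul_assoc[symmetric] qP)
    finally show ?thesis by (simp add: W_def)
  qed
  \<comment> \<open>\<open>J\<close> collects the coordinates seen by covectors vanishing on the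
    kernel of \<open>P\<close>. The parent of a state in \<open>J\<close> is again in
    \<open>J\<close> and is never an input, because these covectors annihilate the input columns; so
    \<open>J\<close> contains a matching cycle.\<close>
  define J where "J = {j. \<exists>q\<in>W. q $ j \<noteq> 0}"
  have "q0 v* P = transpose P *v q0" by (simp only: transpose_matrix_vector)
  then have "q0 v* P = q0" using P(1) q0(2) by simp
  then have "q0 \<in> W" by (simp add: W_def)
  moreover obtain j0 where "q0 $ j0 \<noteq> 0" using q0(1) by (auto simp: vec_eq_iff)
  ultimately have j0: "j0 \<in> J" unfolding J_def by blast
  have J: "\<exists>k i. f j = (SV k, i) \<and> k \<in> J \<and> i \<in> {1..N}" if j: "j \<in> J" for j
  proof -
    from j obtain q where q: "q \<in> W" "q $ j \<noteq> 0" unfolding J_def by blast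
    obtain v i where fj: "f j = (v, i)" by (cases "f j")
    show ?thesis
    proof (cases v)
      case (SV k)
      have i: "i \<in> {1..N}" using f_state[of j k i] fj SV by simp
      have "q $ l * match_A \<mu> i $ l $ k = (if l = j then \<mu> (lev j) * q $ j else 0)" for l
        using f_eq_iff[of l j] fj SV by (auto simp: match_A_def)
      then have "(q v* match_A \<mu> i) $ k = \<mu> (lev j) * q $ j" by (simp add: vector_matrix_mult_def)
      then have "(q v* match_A \<mu> i) $ k \<noteq> 0" using q(2) \<mu>[of "lev j"] by simp
      then have "k \<in> J" unfolding J_def using WM[OF q(1) i] by blast
      then show ?thesis using fj SV i by blast
    next
      case (IV a r)
      have i: "a = i" "i \<in> {1..N}" "r < m i" using f_input[of j a r i] fj IV by simp_all
      have "q $ l * match_B \<mu> i r $ l = (if l = j then \<mu> (lev j) * q $ j else 0)" for l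
        using f_eq_iff[of l j] fj IV i(1) by (auto simp: match_B_def)
      then have "q \<bullet> match_B \<mu> i r = \<mu> (lev j) * q $ j" by (simp add: inner_vec_def)
      moreover have "q \<bullet> match_B \<mu> i r = (q v* P) \<bullet> match_B \<mu> i r" using q(1) by (simp add: W_def)
      moreover have "(q v* P) \<bullet> match_B \<mu> i r = 0" using ker[OF i(2,3)] by (simp add: dot_lmul_matrix)
      ultimately show ?thesis using q(2) \<mu>[of "lev j"] by simp
    qed
  qed
  have "\<forall>j\<in>J. \<exists>t. f j = (SV (fst t), snd t) \<and> fst t \<in> J \<and> snd t \<in> {1..N}"
  proof
    fix j assume "j \<in> J"
    from J[OF this] obtain k i where "f j = (SV k, i) \<and> k \<in> J \<and> i \<in> {1..N}" by blast
    then show "\<exists>t. f j = (SV (fst t), snd t) \<and> fst t \<in> J \<and> snd t \<in> {1..N}"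
      by (intro exI[of _ "(k, i)"]) simp
  qed
  from bchoice[OF this] obtain t where t: "\<forall>j\<in>J. f j = (SV (fst (t j)), snd (t j)) \<and> fst (t j) \<in> J \<and> snd (t j) \<in> {1..N}" ..
  define p where "p j = fst (t j)" for j
  define col where "col j = snd (t j)" for j
  have pc: "f j = (SV (p j), col j)" "p j \<in> J" "col j \<in> {1..N}" if "j \<in> J" for j
    using t that by (simp_all add: p_def col_def)
  have orb: "(p ^^ s) j \<in> J" if "j \<in> J" for s j by (induction s) (use that pc(2) in auto)
  have "finite (range (\<lambda>k. (p ^^ k) j0))" by simp
  then have "\<not> inj (\<lambda>k. (p ^^ k) j0)" using finite_imageD infinite_UNIV_nat by blast
  then obtain a b where ab: "a < b" "(p ^^ a) j0 = (p ^^ b) j0"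
    unfolding inj_on_def by (metis linorder_neqE_nat)
  define c where "c = (p ^^ a) j0"
  define L where "L = b - a"
  have L: "L > 0" using ab by (simp add: L_def)
  have "(p ^^ L) c = (p ^^ (L + a)) j0" by (simp add: c_def funpow_add)
  then have pL: "(p ^^ L) c = c" using ab by (simp add: L_def c_def)
  have cJ: "c \<in> J" unfolding c_def by (rule orb[OF j0])
  define v where "v = map (\<lambda>s. col ((p ^^ s) c)) [0..<L]"
  have gv: "back_word (map (\<lambda>s. col ((p ^^ s) c)) [0..<n]) (Some c) = Some ((p ^^ n) c)" for n
  proof (induction n)
    case (Suc n)
    have "back_step (col ((p ^^ n) c)) (Some ((p ^^ n) c)) = Some (p ((p ^^ n) c))"
      using pc(1)[OF orb[OF cJ, of n]] by (simp add: back_step_Some_iff)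
    with Suc show ?case by (simp add: back_word_append)
  qed simp
  have Gc: "back_word v (Some c) = Some c" using gv[of L] pL by (simp add: v_def)
  have setv: "set v \<subseteq> {1..N}" using pc(3) orb[OF cJ] by (auto simp: v_def)
  obtain d where d: "d > 0" "\<And>t. t > 0 \<Longrightarrow> (back_word v ^^ (d * t + d * t)) = (back_word v ^^ (d * t))"
    using powers_eventually_idempotent[of "back_word v"] by blast
  \<comment> \<open>\<open>R\<close> is an exponent making \<open>H\<close> idempotent. As
    \<open>H\<close> is also injective where defined, it is a partial identity, so the matrix of
    \<open>u\<close> is diagonal. The factor \<open>Suc K\<close> makes \<open>u\<close> long
    enough.\<close>
  define R where "R = d * Suc K"
  define u where "u = concat (replicate R v)"
  have lu: "length u = R * L" by (simp add: u_def v_def length_concat sum_list_replicate)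
  have "1 * Suc K * 1 \<le> R * L" unfolding R_def using d(1) L by (intro mult_mono) auto
  then have "Suc K \<le> length u" unfolding lu mult_1_left mult_1_right .
  then have len: "length u \<ge> K" by simp
  have setu: "set u \<subseteq> {1..N}" using setv by (auto simp: u_def)
  define H where "H = back_word u"
  have H: "H = back_word v ^^ R" by (simp add: fun_eq_iff H_def u_def back_word_power)
  have idem: "H (H x) = H x" for x
  proof -
    have "(back_word v ^^ (R + R)) x = (back_word v ^^ R) x" using d(2)[of "Suc K"] by (simp add: R_def)
    then show ?thesis by (simp add: H funpow_add)
  qed
  have diag: "j = k" if "H (Some j) = Some k" for j k
    using idem[of "Some j"] that back_word_inj[of u j k k] by (simp add: H_def)
  have Hc: "H (Some c) = Some c"
  proof -
    have "(back_word v ^^ r) (Some c) = Some c" for r by (induction r) (simp_all add: Gc)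
    then show ?thesis by (simp add: H)
  qed
  let ?X = "mprod (match_A \<mu>) u"
  note X = mprod_match_A_pos_iff[of \<mu> u, OF \<mu>]
  have X0: "?X $ k $ j = 0" if "k \<noteq> j" for k j
  proof -
    have "back_word u (Some k) \<noteq> Some j" using diag[of k j] that unfolding H_def by blast
    then show ?thesis using X[of k j] by simp
  qed
  have "trace (P ** ?X) = (\<Sum>j\<in>UNIV. P $ j $ j * ?X $ j $ j)" by (rule trace_mult_diagonal[OF X0])
  also have "\<dots> \<ge> P $ c $ c * ?X $ c $ c"
  proof (rule member_le_sum[of c UNIV "\<lambda>j. P $ j $ j * ?X $ j $ j"])
    fix j
    have "P $ j $ j \<ge> 0" unfolding symmetric_idempotent_diag[OF P, of j] by (intro sum_nonneg) auto
    then show "0 \<le> P $ j $ j * ?X $ j $ j" using X[of j j] by simp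
  qed auto
  finally have tr: "trace (P ** ?X) \<ge> P $ c $ c * ?X $ c $ c" .
  have "P $ c $ c > 0"
  proof -
    from cJ obtain q where q: "q \<in> W" "q $ c \<noteq> 0" unfolding J_def by blast
    have "(q v* P) $ c \<noteq> 0" using q by (simp add: W_def)
    then have "(\<Sum>l\<in>UNIV. q $ l * P $ l $ c) \<noteq> 0" by (simp add: vector_matrix_mult_def)
    then obtain l where "q $ l * P $ l $ c \<noteq> 0" by (rule sum.not_neutral_contains_not_neutral)
    then have "P $ l $ c \<noteq> 0" by simp
    moreover have "P $ l $ c = P $ c $ l" by (rule symmetric_matrix_entry[OF P(1)])
    ultimately have "(P $ c $ l)\<^sup>2 > 0" by simp
    then show ?thesis using symmetric_idempotent_entry(1)[OF P, of c l] by linarith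
  qed
  moreover have "?X $ c $ c > 0" using X[of c c] Hc unfolding H_def by blast
  ultimately have "0 < P $ c $ c * ?X $ c $ c" by (rule mult_pos_pos)
  from order_less_le_trans[OF this tr] have "trace (P ** ?X) > 0" .
  with setu len show ?thesis by (intro exI[of _ u] conjI)
qed

end

section \<open>Existence of levels\<close>

text \<open>If no edge entered the complement of \<open>R\<close> from \<open>R\<close> or from an
  input, a path starting at an input could never arrive at \<open>j\<close>.\<close>

lemma crossing_edge_exists:
  assumes "input_reachable N m PA PB j" "j \<notin> R"
  shows "\<exists>e\<in>Gc_edges N m PA PB. (\<exists>h. ehead e = SV h \<and> h \<notin> R) \<and> (\<forall>t. etail e = SV t \<longrightarrow> t \<in> R)"
proof (rule ccontr)
  assume no: "\<not> ?thesis"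
  let ?E = "{(etail e, ehead e) | e. e \<in> Gc_edges N m PA PB}"
  obtain v where v: "is_input v" "(v, SV j) \<in> ?E\<^sup>+" using assms(1) unfolding input_reachable_def by blast
  have edge: "\<forall>h. y = SV h \<longrightarrow> h \<in> R" if "(x, y) \<in> ?E" "\<forall>t. x = SV t \<longrightarrow> t \<in> R" for x y
  proof -
    from that(1) obtain e where "e \<in> Gc_edges N m PA PB" "x = etail e" "y = ehead e" by blast
    with that(2) no show ?thesis by metis
  qed
  have start: "\<forall>t. v = SV t \<longrightarrow> t \<in> R" using v(1) by (cases v) auto
  from v(2) have "\<forall>h. SV j = SV h \<longrightarrow> h \<in> R"
  proof (induction rule: trancl_induct)
    case (base y)
    show ?case by (rule edge[OF base start])
  next
    case (step y z)
    show ?case by (rule edge[OF step(2) step(3)])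
  qed
  with assms(2) show False by blast
qed

context
  fixes N :: nat and m :: "nat \<Rightarrow> nat" and PA :: "nat \<Rightarrow> 'n::finite \<Rightarrow> 'n \<Rightarrow> bool"
    and PB :: "nat \<Rightarrow> 'n \<Rightarrow> nat \<Rightarrow> bool" and f :: "'n \<Rightarrow> 'n vtx \<times> nat"
begin

text \<open>The head comes first, so that \<open>snd\<close> is a pair of tail and colour in the
  format of \<open>f\<close>.\<close>

definition crossing :: "'n set \<Rightarrow> 'n \<times> 'n vtx \<times> nat" where
  "crossing R = (SOME e. (fst (snd e), SV (fst e), snd (snd e)) \<in> Gc_edges N m PA PB \<and> fst e \<notin> R \<and>
     (\<forall>t. fst (snd e) = SV t \<longrightarrow> t \<in> R))"

primrec layer :: "nat \<Rightarrow> 'n set" where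
  "layer 0 = {j. \<exists>a. is_input ((parent f ^^ a) (SV j))}"
| "layer (Suc k) = layer k \<union> (if layer k = UNIV then {} else
     {j. \<exists>a. (parent f ^^ a) (SV j) = SV (fst (crossing (layer k)))})"

end

declare layer.simps [simp del]

lemma matching_leveled:
  fixes PA :: "nat \<Rightarrow> 'n::finite \<Rightarrow> 'n \<Rightarrow> bool"
  assumes f: "matching N m PA PB f" and reach: "\<And>j. input_reachable N m PA PB j"
  shows "\<exists>lev top entry. leveled N m f lev top entry \<and>
    (\<forall>j. lev j > 0 \<longrightarrow> (fst (entry (lev j)), SV (top (lev j)), snd (entry (lev j))) \<in> Gc_edges N m PA PB)"
proof -
  let ?R = "layer N m PA PB f"
  let ?c = "\<lambda>k. crossing N m PA PB (?R k)"
  have cr: "(fst (snd (?c k)), SV (fst (?c k)), snd (snd (?c k))) \<in> Gc_edges N m PA PB \<and> fst (?c k) \<notin> ?R k \<and>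
     (\<forall>t. fst (snd (?c k)) = SV t \<longrightarrow> t \<in> ?R k)" if ne: "?R k \<noteq> UNIV" for k
  proof -
    obtain j where "j \<notin> ?R k" using ne by blast
    from crossing_edge_exists[OF reach this] obtain e h where
      e: "e \<in> Gc_edges N m PA PB" "ehead e = SV h" "h \<notin> ?R k" "\<forall>t. etail e = SV t \<longrightarrow> t \<in> ?R k" by blast
    obtain t c where tc: "e = (t, SV h, c)" using e(2) by (cases e) (simp add: ehead_def)
    let ?Q = "\<lambda>e. (fst (snd e), SV (fst e), snd (snd e)) \<in> Gc_edges N m PA PB \<and> fst e \<notin> ?R k \<and>
      (\<forall>t. fst (snd e) = SV t \<longrightarrow> t \<in> ?R k)"
    have "?Q (h, t, c)" using e(1,3,4) unfolding tc etail_def fst_conv snd_conv by blast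
    from someI[of ?Q, OF this] show ?thesis unfolding crossing_def .
  qed
  have mono1: "?R k \<subseteq> ?R (Suc k)" for k unfolding layer.simps(2) by (rule Un_upper1)
  have mono: "?R k \<subseteq> ?R l" if "k \<le> l" for k l
    using that
  proof (induction l)
    case (Suc l)
    then show ?case using mono1[of l] by (cases "k = Suc l") auto
  qed simp
  have top_in: "fst (?c k) \<in> ?R (Suc k)" if "?R k \<noteq> UNIV" for k
  proof -
    have "\<exists>a. (parent f ^^ a) (SV (fst (?c k))) = SV (fst (?c k))" by (intro exI[of _ 0]) simp
    then have "fst (?c k) \<in> {j. \<exists>a. (parent f ^^ a) (SV j) = SV (fst (?c k))}" by simp
    then show ?thesis unfolding layer.simps(2) if_not_P[OF that] by (rule UnI2)
  qed
  have "\<exists>k. ?R k = UNIV"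
  proof (rule ccontr)
    assume "\<not> ?thesis"
    then have ne: "?R k \<noteq> UNIV" for k by blast
    have "card (?R k) \<ge> k" for k
    proof (induction k)
      case (Suc k)
      have "fst (?c k) \<in> ?R (Suc k)" "fst (?c k) \<notin> ?R k" using top_in[OF ne[of k]] cr[OF ne[of k]] by simp_all
      then have "?R k \<subset> ?R (Suc k)" using mono1[of k] by blast
      then have "card (?R k) < card (?R (Suc k))" by (intro psubset_card_mono) auto
      with Suc show ?case by simp
    qed simp
    from this[of "Suc CARD('n)"] card_mono[of "UNIV :: 'n set" "?R (Suc CARD('n))"] show False by simp
  qed
  then obtain k0 where k0: "?R k0 = UNIV" ..
  define lev where "lev j = (LEAST k. j \<in> ?R k)" for j
  have in_lev: "j \<in> ?R (lev j)" for j unfolding lev_def by (rule LeastI[of _ k0]) (simp add: k0)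
  have lev_le: "lev j \<le> k \<longleftrightarrow> j \<in> ?R k" for j k
  proof
    show "lev j \<le> k \<Longrightarrow> j \<in> ?R k" using in_lev[of j] mono[of "lev j" k] by blast
    show "j \<in> ?R k \<Longrightarrow> lev j \<le> k" unfolding lev_def by (rule Least_le)
  qed
  have f_edge: "(fst (f j), SV j, snd (f j)) \<in> Gc_edges N m PA PB" for j
    using f unfolding matching_def by blast
  \<comment> \<open>Layer \<open>k\<close> supplies the edge that opens level \<open>k + 1\<close>;
    hence the shift by one.\<close>
  define top where "top k = fst (?c (k - 1))" for k
  define entry where "entry k = snd (?c (k - 1))" for k
  \<comment> \<open>Layers are closed under following matching edges forwards; hence a parent is
    never on a lower level than its child.\<close>
  have closed: "j \<in> ?R k" if "x \<in> ?R k" "f j = (SV x, i)" for j x i k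
    using that(1)
  proof (induction k)
    case 0
    then obtain a where "is_input ((parent f ^^ a) (SV x))" unfolding layer.simps(1) by blast
    then have "is_input ((parent f ^^ Suc a) (SV j))"
      using that(2) by (simp add: funpow_Suc_right del: funpow.simps)
    then show ?case unfolding layer.simps by blast
  next
    case (Suc k)
    show ?case
    proof (cases "x \<in> ?R k")
      case True
      then show ?thesis using Suc.IH mono1[of k] by blast
    next
      case False
      then have ne: "?R k \<noteq> UNIV" by blast
      from Suc.prems have "x \<in> {j. \<exists>a. (parent f ^^ a) (SV j) = SV (fst (?c k))}"
        unfolding layer.simps(2) if_not_P[OF ne] using False by blast
      then obtain a where "(parent f ^^ a) (SV x) = SV (fst (?c k))" by blast
      then have "(parent f ^^ Suc a) (SV j) = SV (fst (?c k))"
        using that(2) by (simp add: funpow_Suc_right del: funpow.simps)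
      then show ?thesis unfolding layer.simps(2) if_not_P[OF ne] by blast
    qed
  qed
  have pos: "\<exists>k. lev j = Suc k \<and> ?R k \<noteq> UNIV \<and> (\<exists>a. (parent f ^^ a) (SV j) = SV (fst (?c k)))" if "lev j > 0" for j
  proof -
    from that obtain k where k: "lev j = Suc k" by (cases "lev j") auto
    have n: "j \<notin> ?R k" using lev_le[of j k] k by simp
    then have ne: "?R k \<noteq> UNIV" by blast
    have "j \<in> ?R (Suc k)" using in_lev[of j] k by simp
    then have "\<exists>a. (parent f ^^ a) (SV j) = SV (fst (?c k))"
      unfolding layer.simps(2) if_not_P[OF ne] using n by blast
    with k ne show ?thesis by blast
  qed
  have "leveled N m f lev top entry"
  proof
    show "inj f" using f by (simp add: matching_def)
  next
    fix j k i assume a: "f j = (SV k, i)"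
    have "(SV k, SV j, i) \<in> Gc_edges N m PA PB" using f_edge[of j] a by simp
    then have "i \<in> {1..N}" by (auto simp: Gc_edges_def)
    moreover have "lev j \<le> lev k" using closed[OF in_lev[of k] a] lev_le by blast
    ultimately show "i \<in> {1..N} \<and> lev j \<le> lev k" ..
  next
    fix j a r i assume fj: "f j = (IV a r, i)"
    have "(IV a r, SV j, i) \<in> Gc_edges N m PA PB" using f_edge[of j] fj by simp
    then have 1: "a = i" "i \<in> {1..N}" "r < m i" by (auto simp: Gc_edges_def)
    have "is_input ((parent f ^^ 1) (SV j))" using fj by simp
    then have "j \<in> ?R 0" unfolding layer.simps by blast
    then have "lev j = 0" using lev_le[of j 0] by simp
    with 1 show "a = i \<and> i \<in> {1..N} \<and> r < m i \<and> lev j = 0" by simp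
  next
    fix j assume "lev j = 0"
    then have "j \<in> ?R 0" using in_lev[of j] by simp
    then show "\<exists>a. is_input ((parent f ^^ a) (SV j))" unfolding layer.simps(1) by blast
  next
    fix j assume "lev j > 0"
    from pos[OF this] obtain k where k: "lev j = Suc k" "?R k \<noteq> UNIV"
      "\<exists>a. (parent f ^^ a) (SV j) = SV (fst (?c k))" by blast
    have t: "top (lev j) = fst (?c k)" by (simp add: top_def k)
    have "lev (fst (?c k)) \<le> Suc k" using top_in[OF k(2)] lev_le by blast
    moreover have "\<not> lev (fst (?c k)) \<le> k" using cr[OF k(2)] lev_le by blast
    ultimately have "lev (fst (?c k)) = Suc k" by simp
    with k t show "lev (top (lev j)) = lev j \<and> (\<exists>a. (parent f ^^ a) (SV j) = SV (top (lev j)))" by simp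
  next
    fix j r i assume j: "lev j > 0" "entry (lev j) = (SV r, i)"
    from pos[OF j(1)] obtain k where k: "lev j = Suc k" "?R k \<noteq> UNIV" by blast
    have e: "snd (?c k) = (SV r, i)" using j(2) by (simp add: entry_def k)
    have "i \<in> {1..N}" using cr[OF k(2)] e by (auto simp: Gc_edges_def)
    moreover have "lev r \<le> k" using cr[OF k(2)] e lev_le by simp
    ultimately show "i \<in> {1..N} \<and> lev r < lev j" using k by simp
  next
    fix j a r i assume j: "lev j > 0" "entry (lev j) = (IV a r, i)"
    from pos[OF j(1)] obtain k where k: "lev j = Suc k" "?R k \<noteq> UNIV" by blast
    have e: "snd (?c k) = (IV a r, i)" using j(2) by (simp add: entry_def k)
    show "a = i \<and> i \<in> {1..N} \<and> r < m i" using cr[OF k(2)] e by (auto simp: Gc_edges_def)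
  qed
  moreover have "(fst (entry (lev j)), SV (top (lev j)), snd (entry (lev j))) \<in> Gc_edges N m PA PB" if "lev j > 0" for j
  proof -
    from pos[OF that] obtain k where k: "lev j = Suc k" "?R k \<noteq> UNIV" by blast
    show ?thesis using cr[OF k(2)] by (simp add: entry_def top_def k)
  qed
  ultimately show ?thesis by blast
qed

section \<open>Projections and limits\<close>

text \<open>\<open>P\<close> is the sum of \<open>b b^T\<close> over an orthonormal basis of the
  orthogonal complement of \<open>C\<close>.\<close>

lemma orthogonal_projection_matrix:
  fixes C :: "(real^'n) set"
  assumes C: "subspace C"
  shows "\<exists>P. transpose P = P \<and> P ** P = P \<and> (\<forall>x. P *v x = 0 \<longleftrightarrow> x \<in> C)"
proof -
  obtain B where B: "B \<subseteq> C\<^sup>\<bottom>" "pairwise orthogonal B" "\<And>x. x \<in> B \<Longrightarrow> norm x = 1"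
    "independent B" "card B = dim (C\<^sup>\<bottom>)" "span B = C\<^sup>\<bottom>"
    by (rule orthonormal_basis_subspace[OF subspace_orthogonal_comp[of C]]) (rule that)
  have fin: "finite B" using B(4) by (rule independent_imp_finite)
  define P :: "real^'n^'n" where "P = (\<chi> i j. \<Sum>b\<in>B. b $ i * b $ j)"
  have Pv: "P *v x = (\<Sum>b\<in>B. (b \<bullet> x) *\<^sub>R b)" for x
  proof -
    have "(P *v x) $ i = (\<Sum>b\<in>B. (b \<bullet> x) *\<^sub>R b) $ i" for i
    proof -
      have "(P *v x) $ i = (\<Sum>j\<in>UNIV. \<Sum>b\<in>B. b $ i * b $ j * x $ j)"
        by (simp add: P_def matrix_vector_mult_def sum_distrib_right)
      also have "\<dots> = (\<Sum>b\<in>B. \<Sum>j\<in>UNIV. b $ i * b $ j * x $ j)" by (rule sum.swap)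
      also have "\<dots> = (\<Sum>b\<in>B. (b \<bullet> x) * b $ i)"
        by (simp add: inner_vec_def sum_distrib_right sum_distrib_left ac_simps)
      finally show ?thesis by simp
    qed
    then show ?thesis by (simp add: vec_eq_iff)
  qed
  have bP: "b \<bullet> (P *v x) = b \<bullet> x" if b: "b \<in> B" for b x
  proof -
    have "b \<bullet> (P *v x) = (\<Sum>c\<in>B. (c \<bullet> x) * (b \<bullet> c))" by (simp add: Pv inner_sum_right)
    also have "\<dots> = (\<Sum>c\<in>B. if c = b then b \<bullet> x else 0)"
    proof (rule sum.cong[OF refl])
      fix c assume c: "c \<in> B"
      show "(c \<bullet> x) * (b \<bullet> c) = (if c = b then b \<bullet> x else 0)"
      proof (cases "c = b")
        case True
        have "b \<bullet> b = 1" using B(3)[OF b] by (simp add: dot_square_norm)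
        with True show ?thesis by simp
      next
        case False
        then have "b \<bullet> c = 0" using pairwiseD[OF B(2) b c] by (simp add: orthogonal_def)
        with False show ?thesis by simp
      qed
    qed
    also have "\<dots> = b \<bullet> x" using fin b by simp
    finally show ?thesis .
  qed
  have "transpose P = P" by (simp add: P_def transpose_def mult.commute)
  moreover have "P ** P = P"
  proof -
    have "P *v (P *v x) = P *v x" for x
    proof -
      have "P *v (P *v x) = (\<Sum>b\<in>B. (b \<bullet> (P *v x)) *\<^sub>R b)" by (rule Pv)
      also have "\<dots> = (\<Sum>b\<in>B. (b \<bullet> x) *\<^sub>R b)" by (rule sum.cong[OF refl]) (simp only: bP)
      also have "\<dots> = P *v x" by (rule Pv[symmetric])
      finally show ?thesis .
    qed
    then show ?thesis unfolding matrix_eq matrix_vector_mul_assoc[symmetric] by blast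
  qed
  moreover have "P *v x = 0 \<longleftrightarrow> x \<in> C" for x
  proof
    assume "P *v x = 0"
    then have b0: "b \<bullet> x = 0" if "b \<in> B" for b using bP[OF that, of x] by simp
    have "x \<in> C\<^sup>\<bottom>\<^sup>\<bottom>"
      unfolding orthogonal_comp_def[of "C\<^sup>\<bottom>"]
    proof (intro CollectI ballI)
      fix y assume "y \<in> C\<^sup>\<bottom>"
      then have "y \<in> span B" using B(6) by simp
      then have "orthogonal x y" by (rule orthogonal_to_span) (simp add: orthogonal_def inner_commute b0)
      then show "orthogonal y x" by (simp add: orthogonal_commute)
    qed
    then show "x \<in> C" using orthogonal_comp_self[OF C] by simp
  next
    assume x: "x \<in> C"
    have "b \<bullet> x = 0" if "b \<in> B" for b
      using B(1) that x unfolding orthogonal_comp_def orthogonal_def by (auto simp: inner_commute)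
    then show "P *v x = 0" by (simp add: Pv)
  qed
  ultimately show ?thesis by blast
qed

text \<open>As \<open>x - P x\<close> lies in \<open>C\<close>, invariance turns into matrix
  equations, which pass to limits.\<close>

lemma invariant_projection:
  assumes C: "invariant_subspace N m A Bc C" and P: "P ** P = P" "\<And>x. P *v x = 0 \<longleftrightarrow> x \<in> C"
    and i: "i \<in> {1..N}"
  shows "P ** A i ** P = P ** A i" and "r < m i \<Longrightarrow> P *v Bc i r = 0"
proof -
  have "P *v (A i *v (P *v x)) = P *v (A i *v x)" for x
  proof -
    have "P *v (x - P *v x) = P *v x - (P ** P) *v x"
      by (simp only: matrix_vector_mult_diff_distrib matrix_vector_mul_assoc)
    then have "x - P *v x \<in> C" using P by simp
    then have "A i *v (x - P *v x) \<in> C" using C i unfolding invariant_subspace_def by blast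
    then have "P *v (A i *v (x - P *v x)) = 0" using P(2) by blast
    then show ?thesis by (simp add: matrix_vector_mult_diff_distrib)
  qed
  then show "P ** A i ** P = P ** A i" unfolding matrix_eq matrix_vector_mul_assoc[symmetric] by blast
  show "r < m i \<Longrightarrow> P *v Bc i r = 0" using C i P(2) unfolding invariant_subspace_def by blast
qed

lemma invariant_subspace_similarity:
  fixes S T :: "real^'n^'n"
  assumes C: "invariant_subspace N m A Bc C" and ST: "S ** T = mat 1"
  shows "invariant_subspace N m (\<lambda>i. T ** A i ** S) (\<lambda>i r. T *v Bc i r) {x. S *v x \<in> C}"
proof -
  have STv: "S *v (T *v x) = x" for x by (simp add: matrix_vector_mul_assoc ST)
  have sub: "subspace C" using C unfolding invariant_subspace_def by blast
  have "subspace {x. S *v x \<in> C}"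
    using subspace_0[OF sub] subspace_add[OF sub] subspace_scale[OF sub]
    by (auto simp: subspace_def matrix_vector_right_distrib matrix_vector_mult_scaleR)
  moreover have "(T ** A i ** S) *v x \<in> {x. S *v x \<in> C}" if "i \<in> {1..N}" "x \<in> {x. S *v x \<in> C}" for i x
  proof -
    have "S *v ((T ** A i ** S) *v x) = A i *v (S *v x)"
      by (simp only: matrix_vector_mul_assoc[symmetric] STv)
    then show ?thesis using C that unfolding invariant_subspace_def by simp
  qed
  moreover have "T *v Bc i r \<in> {x. S *v x \<in> C}" if "i \<in> {1..N}" "r < m i" for i r
    using C that unfolding invariant_subspace_def by (simp add: STv)
  ultimately show ?thesis unfolding invariant_subspace_def by blast
qed

lemma invariant_subspace_mprod:
  assumes C: "invariant_subspace N m A Bc C"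
  shows "set w \<subseteq> {1..N} \<Longrightarrow> x \<in> C \<Longrightarrow> mprod A w *v x \<in> C"
proof (induction w)
  case (Cons i w)
  then have "mprod A w *v x \<in> C" "i \<in> {1..N}" by simp_all
  then have "A i *v (mprod A w *v x) \<in> C" using C unfolding invariant_subspace_def by blast
  then show ?case by (simp add: matrix_vector_mul_assoc)
qed simp

text \<open>Both sides are the trace of the map induced by \<open>X\<close> on the quotient by
  \<open>C\<close>. Concretely, \<open>P X Q = P X\<close> and \<open>Q P = Q\<close>, and the trace
  is cyclic.\<close>

lemma trace_same_kernel:
  fixes P Q X :: "real^'n^'n"
  assumes P: "P ** P = P" "\<And>x. P *v x = 0 \<longleftrightarrow> x \<in> C" and Q: "Q ** Q = Q" "\<And>x. Q *v x = 0 \<longleftrightarrow> x \<in> C"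
    and X: "\<And>x. x \<in> C \<Longrightarrow> X *v x \<in> C"
  shows "trace (P ** X) = trace (Q ** X)"
proof -
  have inC: "x - R *v x \<in> C" if "R ** R = R" "\<And>x. R *v x = 0 \<longleftrightarrow> x \<in> C" for R :: "real^'n^'n" and x
  proof -
    have "R *v (x - R *v x) = R *v x - (R ** R) *v x"
      by (simp only: matrix_vector_mult_diff_distrib matrix_vector_mul_assoc)
    then show ?thesis using that by simp
  qed
  have 1: "P ** X ** Q = P ** X"
  proof -
    have "P *v (X *v (Q *v x)) = P *v (X *v x)" for x
    proof -
      have "P *v (X *v (x - Q *v x)) = 0" using X[OF inC[OF Q]] P(2) by blast
      then show ?thesis by (simp add: matrix_vector_mult_diff_distrib)
    qed
    then show ?thesis unfolding matrix_eq matrix_vector_mul_assoc[symmetric] by blast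
  qed
  have 2: "Q ** P = Q"
  proof -
    have "Q *v (P *v x) = Q *v x" for x
    proof -
      have "Q *v (x - P *v x) = 0" using inC[OF P] Q(2) by blast
      then show ?thesis by (simp add: matrix_vector_mult_diff_distrib)
    qed
    then show ?thesis unfolding matrix_eq matrix_vector_mul_assoc[symmetric] by blast
  qed
  have "trace (P ** X) = trace ((P ** X) ** Q)" by (simp only: 1)
  also have "\<dots> = trace (Q ** (P ** X))" by (rule trace_mul_sym)
  also have "\<dots> = trace (Q ** X)" by (simp only: matrix_mul_assoc 2)
  finally show ?thesis .
qed

lemma mprod_similarity:
  fixes S T :: "real^'n^'n"
  assumes "S ** T = mat 1" "T ** S = mat 1"
  shows "mprod (\<lambda>i. T ** A i ** S) w = T ** mprod A w ** S"
proof (induction w)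
  case Nil
  show ?case by (simp add: assms)
next
  case (Cons i w)
  have "mprod (\<lambda>i. T ** A i ** S) (i # w) = T ** A i ** (S ** T) ** mprod A w ** S"
    by (simp only: mprod.simps Cons matrix_mul_assoc)
  then show ?case by (simp only: assms matrix_mul_rid mprod.simps matrix_mul_assoc)
qed

text \<open>\<open>S ** Q ** T\<close> is a projection with kernel \<open>C\<close>, in general
  oblique even if \<open>Q\<close> is orthogonal; so the trace on the quotient can be computed in
  either coordinate system.\<close>

lemma trace_similar_kernel:
  fixes P Q X S T :: "real^'n^'n"
  assumes P: "P ** P = P" "\<And>x. P *v x = 0 \<longleftrightarrow> x \<in> C"
    and Q: "Q ** Q = Q" "\<And>x. Q *v x = 0 \<longleftrightarrow> S *v x \<in> C"
    and ST: "S ** T = mat 1" "T ** S = mat 1" and X: "\<And>x. x \<in> C \<Longrightarrow> X *v x \<in> C"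
  shows "trace (P ** X) = trace (Q ** (T ** X ** S))"
proof -
  let ?Q = "S ** Q ** T"
  have "?Q ** ?Q = S ** Q ** (T ** S) ** Q ** T" by (simp only: matrix_mul_assoc)
  also have "\<dots> = S ** (Q ** Q) ** T" by (simp only: ST matrix_mul_rid matrix_mul_assoc)
  finally have idem: "?Q ** ?Q = ?Q" by (simp only: Q(1))
  have STv: "S *v (T *v x) = x" "T *v (S *v x) = x" for x by (simp_all add: matrix_vector_mul_assoc ST)
  have ker: "?Q *v x = 0 \<longleftrightarrow> x \<in> C" for x
  proof -
    have "?Q *v x = S *v (Q *v (T *v x))" by (simp only: matrix_vector_mul_assoc matrix_mul_assoc)
    moreover have "S *v y = 0 \<longleftrightarrow> y = 0" for y
    proof
      assume "S *v y = 0"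
      with STv(2)[of y] show "y = 0" by simp
    qed simp
    ultimately have "?Q *v x = 0 \<longleftrightarrow> Q *v (T *v x) = 0" by simp
    also have "\<dots> \<longleftrightarrow> x \<in> C" using Q(2)[of "T *v x"] STv(1) by simp
    finally show ?thesis .
  qed
  have "trace (P ** X) = trace (?Q ** X)" by (rule trace_same_kernel[OF P idem ker X])
  also have "\<dots> = trace (S ** (Q ** T ** X))" by (simp only: matrix_mul_assoc)
  also have "\<dots> = trace (Q ** T ** X ** S)" by (rule trace_mul_sym)
  finally show ?thesis by (simp only: matrix_mul_assoc)
qed

lemma norm_symmetric_idempotent_le:
  fixes P :: "real^'n^'n"
  assumes "transpose P = P" "P ** P = P"
  shows "norm P \<le> real (CARD('n) * CARD('n))"
proof -
  have "norm P \<le> (\<Sum>i\<in>UNIV. norm (P $ i))" unfolding norm_vec_def[of P] by (rule L2_set_le_sum) simp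
  also have "\<dots> \<le> (\<Sum>i\<in>(UNIV::'n set). real CARD('n))"
  proof (rule sum_mono)
    fix i
    have "norm (P $ i) \<le> (\<Sum>j\<in>UNIV. \<bar>P $ i $ j\<bar>)" by (rule norm_le_l1_cart)
    also have "\<dots> \<le> (\<Sum>j\<in>(UNIV::'n set). 1)"
      by (intro sum_mono symmetric_idempotent_entry(2)[OF assms])
    finally show "norm (P $ i) \<le> real CARD('n)" by simp
  qed
  finally show ?thesis by simp
qed

section \<open>Continuity of matrix expressions\<close>

lemma tendsto_matrix_mult:
  fixes X Y :: "'a \<Rightarrow> real^'n^'n"
  assumes "(X \<longlongrightarrow> P) F" "(Y \<longlongrightarrow> Q) F"
  shows "((\<lambda>n. X n ** Y n) \<longlongrightarrow> P ** Q) F"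
  unfolding matrix_matrix_mult_def
  by (intro vec_tendstoI, simp only: vec_lambda_beta, intro tendsto_sum tendsto_mult tendsto_vec_nth assms)

lemma tendsto_matrix_vector_mult:
  fixes X :: "'a \<Rightarrow> real^'n^'n"
  assumes "(X \<longlongrightarrow> P) F" "(y \<longlongrightarrow> v) F"
  shows "((\<lambda>n. X n *v y n) \<longlongrightarrow> P *v v) F"
  unfolding matrix_vector_mult_def
  by (intro vec_tendstoI, simp only: vec_lambda_beta, intro tendsto_sum tendsto_mult tendsto_vec_nth assms)

lemma tendsto_transpose:
  fixes X :: "'a \<Rightarrow> real^'n^'n"
  assumes "(X \<longlongrightarrow> P) F"
  shows "((\<lambda>n. transpose (X n)) \<longlongrightarrow> transpose P) F"
  unfolding transpose_def
  by (intro vec_tendstoI, simp only: vec_lambda_beta, intro tendsto_vec_nth assms)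

lemma tendsto_trace:
  fixes X :: "'a \<Rightarrow> real^'n^'n"
  assumes "(X \<longlongrightarrow> P) F"
  shows "((\<lambda>n. trace (X n)) \<longlongrightarrow> trace P) F"
  unfolding trace_def by (intro tendsto_sum tendsto_vec_nth assms)

lemma tendsto_mprod:
  assumes "\<And>i. ((\<lambda>n. X n i) \<longlongrightarrow> A i) F"
  shows "((\<lambda>n. mprod (X n) w) \<longlongrightarrow> mprod A w) F"
  by (induction w) (simp_all add: tendsto_matrix_mult assms)

section \<open>Sufficiency\<close>

context leveled
begin

text \<open>The exponent is the number of levels that the entry edge climbs; conjugation by
  \<open>scale\<close> turns exactly this power into 1.\<close>

definition pert_A :: "(nat \<Rightarrow> real) \<Rightarrow> real \<Rightarrow> nat \<Rightarrow> real^'n^'n" where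
  "pert_A \<mu> \<epsilon> i = (\<chi> j k. (if f j = (SV k, i) then \<mu> (lev j) else 0) +
     (if is_entry j (SV k, i) then \<epsilon> ^ (lev j - lev k) else 0))"

definition pert_B :: "(nat \<Rightarrow> real) \<Rightarrow> real \<Rightarrow> nat \<Rightarrow> nat \<Rightarrow> real^'n" where
  "pert_B \<mu> \<epsilon> i r = (\<chi> j. (if f j = (IV i r, i) then \<mu> (lev j) else 0) +
     (if is_entry j (IV i r, i) then \<epsilon> ^ lev j else 0))"

definition scale :: "real \<Rightarrow> real^'n^'n" where
  "scale \<epsilon> = (\<chi> i j. if i = j then \<epsilon> ^ lev i else 0)"

lemma scale_mult: "(scale \<epsilon> ** X) $ j $ k = \<epsilon> ^ lev j * X $ j $ k"
  by (simp add: matrix_matrix_mult_def scale_def if_distrib[of "\<lambda>c. c * _"] cong: if_cong)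

lemma mult_scale: "(X ** scale \<epsilon>) $ j $ k = X $ j $ k * \<epsilon> ^ lev k"
  by (simp add: matrix_matrix_mult_def scale_def if_distrib[of "\<lambda>c. _ * c"] cong: if_cong)

lemma scale_vec: "(scale \<epsilon> *v x) $ j = \<epsilon> ^ lev j * x $ j"
  by (simp add: matrix_vector_mult_def scale_def if_distrib[of "\<lambda>c. c * _"] cong: if_cong)

lemma scale_inverse:
  assumes "\<epsilon> \<noteq> 0"
  shows "scale \<epsilon> ** scale (inverse \<epsilon>) = mat 1" and "scale (inverse \<epsilon>) ** scale \<epsilon> = mat 1"
  unfolding vec_eq_iff scale_mult using assms
  by (simp_all add: scale_def mat_def power_inverse)

lemma not_matched_and_entry: "f j = (SV k, i) \<Longrightarrow> \<not> is_entry j (SV k, i)"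
  using f_state[of j k i] ent_state[of j k i] by (auto simp: is_entry_def)

lemma pert_A_tendsto:
  assumes "e \<longlonglongrightarrow> 0"
  shows "(\<lambda>n. pert_A \<mu> (e n) i) \<longlonglongrightarrow> match_A \<mu> i"
proof (intro vec_tendstoI)
  fix j k
  show "(\<lambda>n. pert_A \<mu> (e n) i $ j $ k) \<longlonglongrightarrow> match_A \<mu> i $ j $ k"
  proof (cases "is_entry j (SV k, i)")
    case True
    then have "lev k < lev j" using ent_state[of j k i] by (simp add: is_entry_def)
    then have "(\<lambda>n. e n ^ (lev j - lev k)) \<longlonglongrightarrow> 0" by (intro tendsto_null_power assms) simp
    moreover have "f j \<noteq> (SV k, i)" using True not_matched_and_entry by blast
    ultimately show ?thesis using True by (simp add: pert_A_def match_A_def)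
  next
    case False
    then show ?thesis by (simp add: pert_A_def match_A_def)
  qed
qed

lemma pert_B_tendsto:
  assumes "e \<longlonglongrightarrow> 0"
  shows "(\<lambda>n. pert_B \<mu> (e n) i r) \<longlonglongrightarrow> match_B \<mu> i r"
proof (intro vec_tendstoI)
  fix j
  show "(\<lambda>n. pert_B \<mu> (e n) i r $ j) \<longlonglongrightarrow> match_B \<mu> i r $ j"
  proof (cases "is_entry j (IV i r, i)")
    case True
    then have l: "lev j > 0" by (simp add: is_entry_def)
    then have "(\<lambda>n. e n ^ lev j) \<longlonglongrightarrow> 0" by (intro tendsto_null_power assms)
    moreover have "f j \<noteq> (IV i r, i)" using l f_input[of j i r i] by auto
    ultimately show ?thesis using True by (simp add: pert_B_def match_B_def)
  next
    case False
    then show ?thesis by (simp add: pert_B_def match_B_def)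
  qed
qed

text \<open>Conjugation leaves matching edges inside a level unchanged, gives descending ones a
  positive power of \<open>e n\<close>, and cancels the power on entry edges.\<close>

lemma scaled_pert_A_tendsto:
  assumes e: "e \<longlonglongrightarrow> 0" "\<And>n. e n \<noteq> 0"
  shows "(\<lambda>n. scale (inverse (e n)) ** pert_A \<mu> (e n) i ** scale (e n)) \<longlonglongrightarrow> level_A \<mu> i"
proof (intro vec_tendstoI)
  fix j k
  have entry: "(scale (inverse (e n)) ** pert_A \<mu> (e n) i ** scale (e n)) $ j $ k
      = inverse (e n) ^ lev j * pert_A \<mu> (e n) i $ j $ k * e n ^ lev k" for n
    by (simp only: mult_scale scale_mult)
  consider (m) "f j = (SV k, i)" | (e) "is_entry j (SV k, i)" "f j \<noteq> (SV k, i)"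
    | (n) "f j \<noteq> (SV k, i)" "\<not> is_entry j (SV k, i)" by blast
  then show "(\<lambda>n. (scale (inverse (e n)) ** pert_A \<mu> (e n) i ** scale (e n)) $ j $ k) \<longlonglongrightarrow> level_A \<mu> i $ j $ k"
  proof cases
    case m
    have le: "lev j \<le> lev k" using f_state[OF m] by simp
    have "inverse (e n) ^ lev j * pert_A \<mu> (e n) i $ j $ k * e n ^ lev k = \<mu> (lev j) * e n ^ (lev k - lev j)" for n
      using e(2)[of n] le m not_matched_and_entry[OF m] by (simp add: pert_A_def power_diff power_inverse field_simps)
    moreover have "(\<lambda>n. \<mu> (lev j) * e n ^ (lev k - lev j)) \<longlonglongrightarrow> level_A \<mu> i $ j $ k"
    proof (cases "lev k = lev j")
      case True
      then show ?thesis using m not_matched_and_entry[OF m] by (simp add: level_A_def)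
    next
      case False
      then have "(\<lambda>n. e n ^ (lev k - lev j)) \<longlonglongrightarrow> 0" using le by (intro tendsto_null_power e(1)) simp
      then have "(\<lambda>n. \<mu> (lev j) * e n ^ (lev k - lev j)) \<longlonglongrightarrow> \<mu> (lev j) * 0" by (rule tendsto_mult_left)
      then show ?thesis using False not_matched_and_entry[OF m] by (simp add: level_A_def)
    qed
    ultimately show ?thesis unfolding entry by simp
  next
    case e
    then have lt: "lev k < lev j" using ent_state[of j k i] by (simp add: is_entry_def)
    have "inverse (e n) ^ lev j * pert_A \<mu> (e n) i $ j $ k * e n ^ lev k = 1" for n
    proof -
      have "e n ^ (lev j - lev k) * e n ^ lev k = e n ^ lev j" using lt by (simp flip: power_add)
      then show ?thesis using e assms(2)[of n] by (simp add: pert_A_def power_inverse mult.assoc)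
    qed
    moreover have "level_A \<mu> i $ j $ k = 1" using e by (simp add: level_A_def)
    ultimately show ?thesis unfolding entry by simp
  next
    case n
    then show ?thesis unfolding entry by (simp add: pert_A_def level_A_def)
  qed
qed

text \<open>No limit is taken here: a state matched to an input is on level 0, and on an entry edge
  the two powers cancel.\<close>

lemma scaled_pert_B:
  assumes "\<epsilon> \<noteq> 0"
  shows "scale (inverse \<epsilon>) *v pert_B \<mu> \<epsilon> i r = level_B \<mu> i r"
proof -
  have "inverse \<epsilon> ^ lev j * pert_B \<mu> \<epsilon> i r $ j = level_B \<mu> i r $ j" for j
  proof (cases "f j = (IV i r, i)")
    case True
    then have "lev j = 0" using f_input[of j i r i] by simp
    then show ?thesis by (simp add: pert_B_def level_B_def is_entry_def)
  next
    case False
    then show ?thesis using assms by (simp add: pert_B_def level_B_def power_inverse)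
  qed
  then show ?thesis by (simp add: vec_eq_iff scale_vec)
qed

lemma exists_controllable_weights: "\<exists>\<mu> \<epsilon>. switched_controllable N m (pert_A \<mu> \<epsilon>) (pert_B \<mu> \<epsilon>)"
proof (rule ccontr)
  assume "\<not> ?thesis"
  then have nc: "\<not> switched_controllable N m (pert_A \<mu> \<epsilon>) (pert_B \<mu> \<epsilon>)" for \<mu> \<epsilon> by blast
  obtain \<mu> where ge1: "\<And>k. \<mu> k \<ge> 1" and nil: "\<And>W. annihilated \<mu> W \<Longrightarrow>
     \<exists>K. \<forall>q u. q \<in> W \<longrightarrow> set u \<subseteq> {1..N} \<longrightarrow> length u \<ge> K \<longrightarrow> q v* mprod (level_A \<mu>) u = 0"
    using exists_weights_nilpotent by blast
  define e where "e n = inverse (real (Suc n))" for n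
  have e0: "e n \<noteq> 0" for n by (simp add: e_def)
  have elim: "e \<longlonglongrightarrow> 0" unfolding e_def by (rule LIMSEQ_inverse_real_of_nat)
  let ?A = "\<lambda>n. pert_A \<mu> (e n)" and ?B = "\<lambda>n. pert_B \<mu> (e n)"
  let ?S = "\<lambda>n. scale (e n)" and ?T = "\<lambda>n. scale (inverse (e n))"
  let ?A' = "\<lambda>n i. ?T n ** ?A n i ** ?S n"
  have "\<forall>n. \<exists>C. invariant_subspace N m (?A n) (?B n) C \<and> C \<noteq> UNIV"
    using not_controllable_imp_invariant_subspace[OF nc] by blast
  from choice[OF this] obtain C where C: "\<And>n. invariant_subspace N m (?A n) (?B n) (C n)" "\<And>n. C n \<noteq> UNIV"
    by blast
  have subC: "subspace (C n)" for n using C(1)[of n] unfolding invariant_subspace_def by blast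
  have "\<forall>n. \<exists>P. transpose P = P \<and> P ** P = P \<and> (\<forall>x. P *v x = 0 \<longleftrightarrow> x \<in> C n)"
    using orthogonal_projection_matrix[OF subC] by blast
  from choice[OF this] obtain P where P: "\<And>n. transpose (P n) = P n" "\<And>n. P n ** P n = P n"
    "\<And>n x. P n *v x = 0 \<longleftrightarrow> x \<in> C n" by blast
  let ?D = "\<lambda>n. {x. ?S n *v x \<in> C n}"
  have D: "invariant_subspace N m (?A' n) (\<lambda>i r. ?T n *v ?B n i r) (?D n)" for n
    by (rule invariant_subspace_similarity[OF C(1) scale_inverse(1)[OF e0]])
  have subD: "subspace (?D n)" for n using D[of n] unfolding invariant_subspace_def by blast
  have "\<forall>n. \<exists>P. transpose P = P \<and> P ** P = P \<and> (\<forall>x. P *v x = 0 \<longleftrightarrow> x \<in> ?D n)"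
    using orthogonal_projection_matrix[OF subD] by blast
  from choice[OF this] obtain Q where Q: "\<And>n. transpose (Q n) = Q n" "\<And>n. Q n ** Q n = Q n"
    "\<And>n x. Q n *v x = 0 \<longleftrightarrow> x \<in> ?D n" by blast
  \<comment> \<open>A unit vector fixed by \<open>P n\<close> witnesses that \<open>C n\<close> is
    proper. Its limit shows that the limit projection is nonzero, without following the ranks of the
    \<open>P n\<close>.\<close>
  have "\<exists>q. norm q = 1 \<and> P n *v q = q" for n
  proof -
    obtain x where "x \<notin> C n" using C(2)[of n] by blast
    then have nz: "P n *v x \<noteq> 0" using P(3) by blast
    let ?q = "(1 / norm (P n *v x)) *\<^sub>R (P n *v x)"
    have "P n *v (P n *v x) = P n *v x" unfolding matrix_vector_mul_assoc P(2) ..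
    then have "P n *v ?q = ?q" unfolding matrix_vector_mult_scaleR by simp
    moreover have "norm ?q = 1" using nz by simp
    ultimately show ?thesis by blast
  qed
  then have "\<forall>n. \<exists>q. norm q = 1 \<and> P n *v q = q" by blast
  from choice[OF this] obtain q where q: "\<And>n. norm (q n) = 1" "\<And>n. P n *v q n = q n" by blast
  \<comment> \<open>One subsequence must serve both projections and the unit vector, so they form a
    single bounded sequence.\<close>
  have "bounded (range (\<lambda>n. (P n, Q n, q n)))"
  proof (rule bounded_subset)
    let ?b = "real (CARD('n) * CARD('n))"
    show "bounded (cball 0 ?b \<times> cball 0 ?b \<times> cball (0::real^'n) 1)"
      by (intro bounded_Times bounded_cball)
    show "range (\<lambda>n. (P n, Q n, q n)) \<subseteq> cball 0 ?b \<times> cball 0 ?b \<times> cball 0 1"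
      using norm_symmetric_idempotent_le[OF P(1,2)] norm_symmetric_idempotent_le[OF Q(1,2)] q(1)
      by (auto simp: mem_cball dist_0_norm)
  qed
  from bounded_imp_convergent_subsequence[OF this] obtain l r where
    r: "strict_mono r" and l: "((\<lambda>n. (P n, Q n, q n)) \<circ> r) \<longlonglongrightarrow> l" by blast
  define P0 where "P0 = fst l"
  define Q0 where "Q0 = fst (snd l)"
  define q0 where "q0 = snd (snd l)"
  have lP: "(\<lambda>n. P (r n)) \<longlonglongrightarrow> P0" using tendsto_fst[OF l] by (simp add: o_def P0_def)
  have lQ: "(\<lambda>n. Q (r n)) \<longlonglongrightarrow> Q0" using tendsto_fst[OF tendsto_snd[OF l]] by (simp add: o_def Q0_def)
  have lq: "(\<lambda>n. q (r n)) \<longlonglongrightarrow> q0" using tendsto_snd[OF tendsto_snd[OF l]] by (simp add: o_def q0_def)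
  have er: "(\<lambda>n. e (r n)) \<longlonglongrightarrow> 0" using LIMSEQ_subseq_LIMSEQ[OF elim r] by (simp add: o_def)
  have lA: "(\<lambda>n. ?A (r n) i) \<longlonglongrightarrow> match_A \<mu> i" for i by (rule pert_A_tendsto[OF er])
  have lB: "(\<lambda>n. ?B (r n) i s) \<longlonglongrightarrow> match_B \<mu> i s" for i s by (rule pert_B_tendsto[OF er])
  have lA': "(\<lambda>n. ?A' (r n) i) \<longlonglongrightarrow> level_A \<mu> i" for i by (rule scaled_pert_A_tendsto[OF er e0])
  have symP: "transpose P0 = P0" using LIMSEQ_unique[OF tendsto_transpose[OF lP]] lP by (simp only: P(1))
  have idP: "P0 ** P0 = P0" using LIMSEQ_unique[OF tendsto_matrix_mult[OF lP lP]] lP by (simp only: P(2))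
  have idQ: "Q0 ** Q0 = Q0" using LIMSEQ_unique[OF tendsto_matrix_mult[OF lQ lQ]] lQ by (simp only: Q(2))
  have invP: "P0 ** match_A \<mu> i ** P0 = P0 ** match_A \<mu> i" if i: "i \<in> {1..N}" for i
  proof (rule LIMSEQ_unique)
    show "(\<lambda>n. P (r n) ** ?A (r n) i ** P (r n)) \<longlonglongrightarrow> P0 ** match_A \<mu> i ** P0"
      by (intro tendsto_matrix_mult lP lA)
    have "P n ** ?A n i ** P n = P n ** ?A n i" for n by (rule invariant_projection(1)[OF C(1) P(2,3) i])
    then show "(\<lambda>n. P (r n) ** ?A (r n) i ** P (r n)) \<longlonglongrightarrow> P0 ** match_A \<mu> i"
      using tendsto_matrix_mult[OF lP lA[of i]] by simp
  qed
  have invQ: "Q0 ** level_A \<mu> i ** Q0 = Q0 ** level_A \<mu> i" if i: "i \<in> {1..N}" for i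
  proof (rule LIMSEQ_unique)
    show "(\<lambda>n. Q (r n) ** ?A' (r n) i ** Q (r n)) \<longlonglongrightarrow> Q0 ** level_A \<mu> i ** Q0"
      by (intro tendsto_matrix_mult[OF tendsto_matrix_mult[OF lQ lA'] lQ])
    have "Q n ** ?A' n i ** Q n = Q n ** ?A' n i" for n by (rule invariant_projection(1)[OF D Q(2,3) i])
    then show "(\<lambda>n. Q (r n) ** ?A' (r n) i ** Q (r n)) \<longlonglongrightarrow> Q0 ** level_A \<mu> i"
      using tendsto_matrix_mult[OF lQ lA'[of i]] by (simp only:)
  qed
  have kerP: "P0 *v match_B \<mu> i s = 0" if i: "i \<in> {1..N}" and s: "s < m i" for i s
  proof (rule LIMSEQ_unique)
    show "(\<lambda>n. P (r n) *v ?B (r n) i s) \<longlonglongrightarrow> P0 *v match_B \<mu> i s"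
      by (rule tendsto_matrix_vector_mult[OF lP lB])
    have "P n *v ?B n i s = 0" for n by (rule invariant_projection(2)[OF C(1) P(2,3) i s])
    then show "(\<lambda>n. P (r n) *v ?B (r n) i s) \<longlonglongrightarrow> 0" by simp
  qed
  have kerQ: "Q0 *v level_B \<mu> i s = 0" if i: "i \<in> {1..N}" and s: "s < m i" for i s
  proof (rule LIMSEQ_unique)
    show "(\<lambda>n. Q (r n) *v level_B \<mu> i s) \<longlonglongrightarrow> Q0 *v level_B \<mu> i s"
      by (rule tendsto_matrix_vector_mult[OF lQ tendsto_const])
    have "Q n *v (?T n *v ?B n i s) = 0" for n by (rule invariant_projection(2)[OF D Q(2,3) i s])
    then have "Q n *v level_B \<mu> i s = 0" for n unfolding scaled_pert_B[OF e0] .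
    then show "(\<lambda>n. Q (r n) *v level_B \<mu> i s) \<longlonglongrightarrow> 0" by simp
  qed
  have "norm q0 = 1" using LIMSEQ_unique[OF tendsto_norm[OF lq]] q(1) by simp
  then have q0: "q0 \<noteq> 0" by auto
  have Pq0: "P0 *v q0 = q0"
    using LIMSEQ_unique[OF tendsto_matrix_vector_mult[OF lP lq]] lq by (simp only: q(2))
  \<comment> \<open>For fixed \<open>n\<close>, both sides are the trace of one word on the quotient
    by \<open>C n\<close>, in two coordinate systems.\<close>
  have tr_eq: "trace (P n ** mprod (?A n) w) = trace (Q n ** mprod (?A' n) w)" if "set w \<subseteq> {1..N}" for n w
    unfolding mprod_similarity[OF scale_inverse[OF e0]]
  proof (rule trace_similar_kernel[OF P(2,3) Q(2) _ scale_inverse[OF e0]])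
    show "Q n *v x = 0 \<longleftrightarrow> ?S n *v x \<in> C n" for x using Q(3)[of n x] by simp
    show "x \<in> C n \<Longrightarrow> mprod (?A n) w *v x \<in> C n" for x
      by (rule invariant_subspace_mprod[OF C(1) that])
  qed
  have tr_lim: "trace (P0 ** mprod (match_A \<mu>) w) = trace (Q0 ** mprod (level_A \<mu>) w)" if w: "set w \<subseteq> {1..N}" for w
  proof (rule LIMSEQ_unique)
    show "(\<lambda>n. trace (P (r n) ** mprod (?A (r n)) w)) \<longlonglongrightarrow> trace (P0 ** mprod (match_A \<mu>) w)"
      by (rule tendsto_trace[OF tendsto_matrix_mult[OF lP tendsto_mprod[OF lA]]])
    show "(\<lambda>n. trace (P (r n) ** mprod (?A (r n)) w)) \<longlonglongrightarrow> trace (Q0 ** mprod (level_A \<mu>) w)"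
      unfolding tr_eq[OF w]
      by (rule tendsto_trace[OF tendsto_matrix_mult[OF lQ tendsto_mprod[OF lA']]])
  qed
  define W where "W = {q. q v* Q0 = q}"
  have "annihilated \<mu> W"
    unfolding annihilated_def
  proof (intro ballI conjI allI impI)
    fix p c assume "p \<in> W"
    then show "c *\<^sub>R p \<in> W" unfolding W_def by (simp add: scaleR_vector_matrix_assoc)
  next
    fix p i assume p: "p \<in> W" and i: "i \<in> {1..N}"
    have pQ: "p v* Q0 = p" using p by (simp add: W_def)
    have "p v* level_A \<mu> i = p v* (Q0 ** level_A \<mu> i)" by (simp only: vector_matrix_mul_assoc[symmetric] pQ)
    also have "\<dots> = p v* (Q0 ** level_A \<mu> i ** Q0)" using invQ[OF i] by simp
    also have "\<dots> = (p v* level_A \<mu> i) v* Q0" by (simp only: vector_matrix_mul_assoc[symmetric] pQ)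
    finally show "p v* level_A \<mu> i \<in> W" by (simp add: W_def)
  next
    fix p i s assume p: "p \<in> W" and i: "i \<in> {1..N}" and s: "s < m i"
    have "p \<bullet> level_B \<mu> i s = (p v* Q0) \<bullet> level_B \<mu> i s" using p by (simp add: W_def)
    also have "\<dots> = 0" using kerQ[OF i s] by (simp add: dot_lmul_matrix)
    finally show "p \<bullet> level_B \<mu> i s = 0" .
  qed
  from nil[OF this] obtain K where
    K: "\<And>p u. p \<in> W \<Longrightarrow> set u \<subseteq> {1..N} \<Longrightarrow> length u \<ge> K \<Longrightarrow> p v* mprod (level_A \<mu>) u = 0" by blast
  have pos: "\<mu> k > 0" for k using ge1[of k] by simp
  from matching_trace_pos[where K = K, OF pos symP idP invP kerP q0 Pq0]
  obtain u where u: "set u \<subseteq> {1..N}" "length u \<ge> K" "trace (P0 ** mprod (match_A \<mu>) u) > 0" by blast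
  \<comment> \<open>The rows of \<open>Q0\<close> belong to \<open>W\<close>, since
    \<open>Q0\<close> is idempotent; so a word of length at least \<open>K\<close> annihilates each
    of them.\<close>
  have "Q0 ** mprod (level_A \<mu>) u = 0"
  proof -
    have "(Q0 ** mprod (level_A \<mu>) u) $ i $ j = 0" for i j
    proof -
      have "(axis i 1 v* Q0) v* Q0 = axis i 1 v* Q0" by (simp only: vector_matrix_mul_assoc idQ)
      then have "axis i 1 v* Q0 \<in> W" by (simp add: W_def)
      from K[OF this u(1,2)] have "axis i 1 v* (Q0 ** mprod (level_A \<mu>) u) = 0"
        by (simp only: vector_matrix_mul_assoc)
      then have "(axis i 1 v* (Q0 ** mprod (level_A \<mu>) u)) $ j = 0" by simp
      moreover have "(axis i 1 v* Y) $ j = Y $ i $ j" for Y :: "real^'n^'n"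
        by (simp add: vector_matrix_mult_def axis_def if_distrib[of "\<lambda>c. c * _"] cong: if_cong)
      ultimately show ?thesis by simp
    qed
    then show ?thesis by (simp add: vec_eq_iff)
  qed
  then have "trace (P0 ** mprod (match_A \<mu>) u) = 0" using tr_lim[OF u(1)] by (simp add: trace_def)
  with u(3) show False by simp
qed

end

lemma matching_imp_structurally_controllable:
  fixes PA :: "nat \<Rightarrow> 'n::finite \<Rightarrow> 'n \<Rightarrow> bool"
  assumes f: "matching N m PA PB f" and reach: "\<And>j. input_reachable N m PA PB j"
  shows "structurally_controllable N m PA PB"
proof -
  obtain lev top entry where lv: "leveled N m f lev top entry"
    and ed: "\<And>j. lev j > 0 \<Longrightarrow> (fst (entry (lev j)), SV (top (lev j)), snd (entry (lev j))) \<in> Gc_edges N m PA PB"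
    using matching_leveled[OF f reach] by blast
  interpret leveled N m f lev top entry by (rule lv)
  obtain \<mu> \<epsilon> where c: "switched_controllable N m (pert_A \<mu> \<epsilon>) (pert_B \<mu> \<epsilon>)" using exists_controllable_weights by blast
  have fe: "(fst (f j), SV j, snd (f j)) \<in> Gc_edges N m PA PB" for j using f unfolding matching_def by blast
  have ee: "(fst t, SV j, snd t) \<in> Gc_edges N m PA PB" if "is_entry j t" for j t
    using that ed[of j] unfolding is_entry_def by auto
  have "PA i j k" if "pert_A \<mu> \<epsilon> i $ j $ k \<noteq> 0" for i j k
  proof -
    have "f j = (SV k, i) \<or> is_entry j (SV k, i)" using that by (auto simp: pert_A_def split: if_splits)
    then have "(SV k, SV j, i) \<in> Gc_edges N m PA PB" using fe[of j] ee[of j "(SV k, i)"] by auto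
    then show ?thesis by (auto simp: Gc_edges_def)
  qed
  moreover have "PB i j r" if "pert_B \<mu> \<epsilon> i r $ j \<noteq> 0" for i j r
  proof -
    have "f j = (IV i r, i) \<or> is_entry j (IV i r, i)" using that by (auto simp: pert_B_def split: if_splits)
    then have "(IV i r, SV j, i) \<in> Gc_edges N m PA PB" using fe[of j] ee[of j "(IV i r, i)"] by auto
    then show ?thesis by (auto simp: Gc_edges_def)
  qed
  ultimately have "realization N m PA PB (pert_A \<mu> \<epsilon>) (pert_B \<mu> \<epsilon>)" unfolding realization_def by blast
  with c show ?thesis unfolding structurally_controllable_def by blast
qed

theorem theorem2:
  fixes N :: nat and m :: "nat \<Rightarrow> nat"
    and PA :: "nat \<Rightarrow> 'n::finite \<Rightarrow> 'n \<Rightarrow> bool"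
    and PB :: "nat \<Rightarrow> 'n \<Rightarrow> nat \<Rightarrow> bool"
  shows "(((\<forall>j. input_reachable N m PA PB j) \<and> grank N m PA PB = CARD('n))
            \<longleftrightarrow> (\<exists>S. stem_bud_cover N m PA PB S)) \<and>
         ((\<exists>S. stem_bud_cover N m PA PB S) \<longleftrightarrow> structurally_controllable N m PA PB)"
proof -
  have b_a: "(\<forall>j. input_reachable N m PA PB j) \<and> grank N m PA PB = CARD('n)" if "stem_bud_cover N m PA PB S" for S
  proof -
    from cover_imp_reachable_matching(2)[OF that] obtain f where f: "matching N m PA PB f" by blast
    from matching_imp_full_rank[OF f] cover_imp_reachable_matching(1)[OF that] show ?thesis
      unfolding grank_eq_card_iff by (intro conjI allI)
  qed
  have a_b: "(\<exists>S. stem_bud_cover N m PA PB S) \<and> structurally_controllable N m PA PB"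
    if "\<forall>j. input_reachable N m PA PB j" "grank N m PA PB = CARD('n)"
  proof -
    from that(2) obtain A Bc where "realization N m PA PB A Bc" "span (concat_columns N m A Bc) = UNIV"
      unfolding grank_eq_card_iff by blast
    then obtain f where f: "matching N m PA PB f" using full_rank_imp_matching[of N m PA PB A Bc] by blast
    have reach: "input_reachable N m PA PB j" for j using that(1) ..
    show ?thesis
      using matching_imp_cover[OF f reach] matching_imp_structurally_controllable[OF f reach] by (rule conjI)
  qed
  have c_a: "(\<forall>j. input_reachable N m PA PB j) \<and> grank N m PA PB = CARD('n)" if "structurally_controllable N m PA PB"
  proof -
    from that obtain A Bc where c: "realization N m PA PB A Bc" "switched_controllable N m A Bc"
      unfolding structurally_controllable_def by blast
    have "input_reachable N m PA PB j" for j by (rule controllable_imp_input_reachable[OF c])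
    moreover have "grank N m PA PB = CARD('n)"
      unfolding grank_eq_card_iff using c(1) controllable_imp_full_rank[OF c(2)] by blast
    ultimately show ?thesis by blast
  qed
  from a_b b_a c_a show ?thesis by blast
qed

end
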